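(* Let $T$ be a three-colorable triangulation of the torus. Then $\kappa(T,4)>1$ if and only if there exists a four-coloring $f$ of $T$ with $\deg(f)\equiv 6\pmod{12}$.
   Context: A triangulation is called three-colorable if its vertices admit a proper coloring with three colors. A four-coloring of a triangulation $T$ is a proper vertex coloring $f:V(T)\to\{1,2,3,4\}$; equivalently, a non-degenerate simplicial map $f:T\to\partial\Delta^3$, where $\partial\Delta^3$ is the boundary of the tetrahedron with vertices $1,2,3,4$. Degree: fix an orientation of the torus and an orientation of $\partial\Delta^3$. For a triangle $t$ of $\partial\Delta^3$ let $p$ (resp. $n$) be the number of triangles of $T$ mapped by $f$ onto $t$ with orientation preserved (resp. reversed). Then $\deg(f)=p-n$, which does not depend on $t$. Reversing a chosen orientation changes only the sign. Kempe equivalence: for a graph $G$ and a proper $q$-coloring, a Kempe change (K-change) interchanges two colors $a,b$ on one connected component of the subgraph induced by the vertices colored $a$ or $b$. Two $q$-colorings are Kempe equivalent if one can be obtained from the other by a finite sequence of K-changes. $\kappa(G,q)$ denotes the number of Kempe equivalence classes of proper $q$-colorings of $G$. Colorings differing by a global permutation of colors are identified. For a triangulation $T$, $\kappa(T,q)$ refers to the graph of $T$. *)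

theory Defs
  imports "HOL-Analysis.Analysis" "HOL-Number_Theory.Cong"
begin

section \<open>Triangulations of the torus\<close>

definition abstract_complex :: "'v set set \<Rightarrow> bool" where
  "abstract_complex K \<longleftrightarrow> finite K \<and> (\<forall>s\<in>K. finite s \<and> s \<noteq> {}) \<and>
     (\<forall>s\<in>K. \<forall>s'. s' \<subseteq> s \<and> s' \<noteq> {} \<longrightarrow> s' \<in> K)"

text \<open>Points are given by barycentric coordinates. For a finite complex, the product topology
  on \<open>'v \<Rightarrow> real\<close> induces the usual topology on this set.\<close>

definition geometric_realization :: "'v set set \<Rightarrow> ('v \<Rightarrow> real) set" where
  "geometric_realization K =
     {x. (\<forall>v. 0 \<le> x v) \<and> {v. x v \<noteq> 0} \<in> K \<and> (\<Sum>v | x v \<noteq> 0. x v) = 1}"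

definition torus :: "(complex \<times> complex) set" where
  "torus = sphere 0 1 \<times> sphere 0 1"

definition torus_triangulation :: "'v set set \<Rightarrow> bool" where
  "torus_triangulation T \<longleftrightarrow> abstract_complex T \<and> geometric_realization T homeomorphic torus"

definition vertices :: "'v set set \<Rightarrow> 'v set" where
  "vertices K = \<Union>K"

definition edges :: "'v set set \<Rightarrow> 'v set set" where
  "edges K = {e \<in> K. card e = 2}"

definition triangles :: "'v set set \<Rightarrow> 'v set set" where
  "triangles K = {t \<in> K. card t = 3}"


section \<open>Colorings and Kempe equivalence\<close>

text \<open>A graph is given by a vertex set \<open>V\<close> and a set \<open>E\<close> of two-element subsets of \<open>V\<close>.
  Colorings are extensional, so that they are determined by their values on \<open>V\<close>.\<close>

definition colorings :: "'v set \<Rightarrow> 'v set set \<Rightarrow> nat \<Rightarrow> ('v \<Rightarrow> nat) set" where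
  "colorings V E q = {f \<in> V \<rightarrow>\<^sub>E {1..q}. \<forall>u v. {u, v} \<in> E \<longrightarrow> f u \<noteq> f v}"

definition kempe_component ::
  "'v set set \<Rightarrow> ('v \<Rightarrow> nat) \<Rightarrow> nat \<Rightarrow> nat \<Rightarrow> 'v \<Rightarrow> 'v set" where
  "kempe_component E f a b v =
     {w. (v, w) \<in> {(x, y). {x, y} \<in> E \<and> f x \<in> {a, b} \<and> f y \<in> {a, b}}\<^sup>*}"

definition kempe_change ::
  "'v set \<Rightarrow> 'v set set \<Rightarrow> nat \<Rightarrow> ('v \<Rightarrow> nat) \<Rightarrow> ('v \<Rightarrow> nat) \<Rightarrow> bool" where
  "kempe_change V E q f g \<longleftrightarrow>
     (\<exists>a\<in>{1..q}. \<exists>b\<in>{1..q}. \<exists>v\<in>V. a \<noteq> b \<and> f v \<in> {a, b} \<and>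
        g = (\<lambda>w. if w \<in> kempe_component E f a b v then Transposition.transpose a b (f w) else f w))"

definition color_permutation ::
  "'v set \<Rightarrow> nat \<Rightarrow> ('v \<Rightarrow> nat) \<Rightarrow> ('v \<Rightarrow> nat) \<Rightarrow> bool" where
  "color_permutation V q f g \<longleftrightarrow> (\<exists>\<pi>. \<pi> permutes {1..q} \<and> g = restrict (\<pi> \<circ> f) V)"

text \<open>Colorings that differ by a global permutation of the colors are identified, hence the
  second disjunct. Both kinds of steps are reversible, so this is an equivalence relation
  on the colorings.\<close>

definition kempe_equivalent ::
  "'v set \<Rightarrow> 'v set set \<Rightarrow> nat \<Rightarrow> ('v \<Rightarrow> nat) \<Rightarrow> ('v \<Rightarrow> nat) \<Rightarrow> bool" where
  "kempe_equivalent V E q =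
     (\<lambda>f g. kempe_change V E q f g \<or> color_permutation V q f g)\<^sup>*\<^sup>*"

definition kempe_number :: "'v set \<Rightarrow> 'v set set \<Rightarrow> nat \<Rightarrow> nat" where
  "kempe_number V E q =
     card (colorings V E q //
       {(f, g). f \<in> colorings V E q \<and> g \<in> colorings V E q \<and> kempe_equivalent V E q f g})"

abbreviation complex_colorings :: "'v set set \<Rightarrow> nat \<Rightarrow> ('v \<Rightarrow> nat) set" where
  "complex_colorings T q \<equiv> colorings (vertices T) (edges T) q"

abbreviation complex_kempe_number :: "'v set set \<Rightarrow> nat \<Rightarrow> nat" where
  "complex_kempe_number T q \<equiv> kempe_number (vertices T) (edges T) q"


section \<open>Degree\<close>

definition tetrahedron_boundary :: "nat set set" where
  "tetrahedron_boundary = {s. s \<noteq> {} \<and> s \<subset> {1, 2, 3, 4}}"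

text \<open>An orientation of a triangulated surface is the set of its positively oriented ordered
  triangles: every triangle carries exactly one of its two cyclic orders, and two triangles
  sharing an edge induce opposite directions on that edge.\<close>

definition surface_orientation :: "'v set set \<Rightarrow> ('v \<times> 'v \<times> 'v) set \<Rightarrow> bool" where
  "surface_orientation K R \<longleftrightarrow>
     (\<forall>a b c. (a, b, c) \<in> R \<longrightarrow> {a, b, c} \<in> triangles K) \<and>
     (\<forall>a b c. (a, b, c) \<in> R \<longrightarrow> (b, c, a) \<in> R) \<and>
     (\<forall>a b c. {a, b, c} \<in> triangles K \<longrightarrow> ((a, b, c) \<in> R \<longleftrightarrow> (b, a, c) \<notin> R)) \<and>
     (\<forall>a b c d. (a, b, c) \<in> R \<and> {a, b, d} \<in> triangles K \<and> d \<noteq> c \<longrightarrow> (b, a, d) \<in> R)"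

definition preserved_triangles ::
  "('v \<times> 'v \<times> 'v) set \<Rightarrow> ('w \<times> 'w \<times> 'w) set \<Rightarrow> 'v set set \<Rightarrow> ('v \<Rightarrow> 'w) \<Rightarrow> 'w set \<Rightarrow> 'v set set"
  where
  "preserved_triangles R S T f t = {s \<in> triangles T. f ` s = t \<and>
     (\<exists>a b c. s = {a, b, c} \<and> (a, b, c) \<in> R \<and> (f a, f b, f c) \<in> S)}"

definition reversed_triangles ::
  "('v \<times> 'v \<times> 'v) set \<Rightarrow> ('w \<times> 'w \<times> 'w) set \<Rightarrow> 'v set set \<Rightarrow> ('v \<Rightarrow> 'w) \<Rightarrow> 'w set \<Rightarrow> 'v set set"
  where
  "reversed_triangles R S T f t = {s \<in> triangles T. f ` s = t \<and>
     (\<exists>a b c. s = {a, b, c} \<and> (a, b, c) \<in> R \<and> (f b, f a, f c) \<in> S)}"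

text \<open>The common value of \<open>p - n\<close> over all triangles \<open>t\<close> of the tetrahedron boundary.\<close>

definition map_degree ::
  "('v \<times> 'v \<times> 'v) set \<Rightarrow> (nat \<times> nat \<times> nat) set \<Rightarrow> 'v set set \<Rightarrow> ('v \<Rightarrow> nat) \<Rightarrow> int" where
  "map_degree R S T f = (THE d. \<forall>t \<in> triangles tetrahedron_boundary.
     int (card (preserved_triangles R S T f t)) - int (card (reversed_triangles R S T f t)) = d)"

end

theory Submission
  imports Defs
begin

text \<open>Identify the four colors with \<open>(\<int>/2)\<^sup>2\<close>. Together with the 3-coloring, a 4-coloring \<open>f\<close> develops the
  torus into the triangular lattice, so it has a \<open>\<int>\<^sup>2\<close>-valued height cocycle. Modulo 2 the heights are the
  colors, so they are coboundaries plus twice integer cocycles \<open>\<mu>\<close>, \<open>\<nu>\<close>, and \<open>deg f = \<plusminus>2 \<langle>\<mu> \<union> \<nu>, [T]\<rangle>\<close>;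
  modulo 3 the sum of the heights is the coboundary of the 3-coloring, so 6 divides the degree. A Kempe change
  reflects the heights on a region, which preserves the parity of \<open>\<mu> \<union> \<nu>\<close>.

  Conversely let \<open>\<mu> \<union> \<nu>\<close> be even and let \<open>f\<close> have the fewest unfolded edges in its Kempe class. The first
  cohomology of the torus modulo 2 has dimension at most 2 and a nondegenerate alternating cup product, so
  one of \<open>\<mu>\<close>, \<open>\<nu>\<close>, \<open>\<mu> + \<nu>\<close> is a coboundary modulo 2. Hence one coordinate of the development is globally
  defined modulo 4, and folding along lattice lines in that direction is a sequence of Kempe changes; by
  minimality the development stays in a strip. Then the other two coordinates are globally defined
  modulo 3, folding applies to them as well, and the development is a single triangle: \<open>f\<close> is the 3-coloring
  up to a permutation of the colors.\<close>

section \<open>The torus and its universal cover\<close>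

text \<open>Up to sign \<open>color_degree f\<close> is twice the degree, and it is four times the
  value of the cup product of \<open>\<mu>\<close> and \<open>\<nu>\<close>. As 12 divides it,
  degree 6 modulo 12 says exactly that this value is odd, which the proof tests as
  \<open>\<not> 8 dvd color_degree f\<close>. The 3-coloring has value 0, so the claim becomes: the
  even colorings form a single Kempe class, and parity is an invariant.

  Cocycles stay integral, because the factor 4 arises by halving two heights; only coboundaries are
  taken modulo 2. The cohomology of the torus enters through elementary substitutes: invariance of
  domain for the local structure, two integer periods read off in the plane for the dimension bound,
  and sums over walls between triangles for nondegeneracy.

  Folding at an edge separates two points whose heights differ by 2, so the height must be known
  modulo some \<open>M \<ge> 3\<close>; the colors alone give it modulo 2. This is why a coboundary
  modulo 2 of a half-height is wanted (it gives \<open>M = 4\<close>), and why the 3-coloring can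
  serve the other two directions (\<open>M = 3\<close>).\<close>

lemma torus_parametrization:
  fixes X :: "'x::topological_space set"
  assumes "X homeomorphic torus"
  obtains P :: "real \<times> real \<Rightarrow> 'x" where
    "continuous_on UNIV P" "range P = X"
    "\<And>s t. P (s + 1, t) = P (s, t)" "\<And>s t. P (s, t + 1) = P (s, t)"
    "\<And>y z. P y = P z \<Longrightarrow> \<exists>m n. y = z + (of_int m, of_int n)"
    "\<And>z U. open U \<Longrightarrow> z \<in> U \<Longrightarrow> \<exists>W. open W \<and> P z \<in> W \<and> X \<inter> W \<subseteq> P ` U"
proof -
  obtain g k where hom: "homeomorphism X torus g k"
    using assms unfolding homeomorphic_def by blast
  define E :: "real \<times> real \<Rightarrow> complex \<times> complex" where
    "E = (\<lambda>z. (cis (2 * pi * fst z), cis (2 * pi * snd z)))"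
  define P where "P = k \<circ> E"
  have E_torus: "E z \<in> torus" for z
    by (simp add: E_def torus_def)
  have E_cont: "continuous_on A E" for A
    unfolding E_def cis_conv_exp by (intro continuous_intros)
  have kg: "k (g x) = x" "g x \<in> torus" if "x \<in> X" for x
    using hom that by (auto simp: homeomorphism_def)
  have gk: "g (k w) = w" "k w \<in> X" if "w \<in> torus" for w
    using hom that by (auto simp: homeomorphism_def)
  have c1: "cis (Arg u) = u" if "norm u = 1" for u
    using that by (metis cis_Arg norm_zero sgn_eq div_by_1 of_real_1 zero_neq_one)
  have E_onto: "\<exists>z. E z = w" if "w \<in> torus" for w
  proof (intro exI)
    show "E (Arg (fst w) / (2 * pi), Arg (snd w) / (2 * pi)) = w"
      using that by (cases w) (auto simp: E_def torus_def c1)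
  qed
  show ?thesis
  proof
    show "continuous_on UNIV P"
      unfolding P_def
      by (rule continuous_on_compose[OF E_cont continuous_on_subset])
         (use hom E_torus in \<open>auto simp: homeomorphism_def\<close>)
    show "range P = X"
    proof
      show "range P \<subseteq> X"
        by (rule image_subsetI) (simp only: P_def comp_apply gk(2)[OF E_torus])
      show "X \<subseteq> range P"
        using E_onto kg by (metis P_def comp_apply rangeI subsetI)
    qed
    have cis1: "cis (2 * pi * (s + 1)) = cis (2 * pi * s)" for s
      by (simp add: distrib_left flip: cis_mult)
    show "P (s + 1, t) = P (s, t)" "P (s, t + 1) = P (s, t)" for s t
      by (simp_all only: P_def E_def comp_apply fst_conv snd_conv cis1)
    show "\<exists>m n. y = z + (of_int m, of_int n)" if "P y = P z" for y z
    proof -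
      have eq: "E y = E z"
        using that gk(1)[OF E_torus] unfolding P_def comp_apply by metis
      have *: "\<exists>m. a = b + of_int m" if "cis (2 * pi * a) = cis (2 * pi * b)" for a b :: real
      proof -
        have "exp (\<i> * complex_of_real (2 * pi * a)) = exp (\<i> * complex_of_real (2 * pi * b))"
          using that by (simp only: cis_conv_exp)
        then obtain n :: int where
          "\<i> * complex_of_real (2 * pi * a) = \<i> * complex_of_real (2 * pi * b) + (of_int (2 * n) * pi) * \<i>"
          unfolding exp_eq by auto
        then have "2 * pi * a = 2 * pi * b + of_int (2 * n) * pi"
          by (simp add: complex_eq_iff)
        then have "2 * pi * a = 2 * pi * (b + of_int n)"
          by (simp add: algebra_simps)
        then show ?thesis by (intro exI[of _ n]) simp
      qed
      from eq obtain m n where "fst y = fst z + of_int m" "snd y = snd z + of_int n"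
        using *[of "fst y" "fst z"] *[of "snd y" "snd z"] by (auto simp: E_def)
      then show ?thesis by (intro exI[of _ m] exI[of _ n]) (simp add: prod_eq_iff)
    qed
    show "\<exists>W. open W \<and> P z \<in> W \<and> X \<inter> W \<subseteq> P ` U" if U: "open U" "z \<in> U" for z U
    proof -
      define a b where "a = cis (2 * pi * fst z)" and "b = cis (2 * pi * snd z)"
      \<comment> \<open>On \<open>N\<close> both arguments relative to the base point are
        continuous; there \<open>Q\<close> is the branch of the inverse of \<open>E\<close> that
        sends \<open>(a, b)\<close> to \<open>z\<close>.\<close>
      define N where "N = {w. fst w / a \<notin> \<real>\<^sub>\<le>\<^sub>0 \<and> snd w / b \<notin> \<real>\<^sub>\<le>\<^sub>0}"
      define Q where "Q = (\<lambda>w. (fst z + Arg (fst w / a) / (2 * pi), snd z + Arg (snd w / b) / (2 * pi)))"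
      have [simp]: "a \<noteq> 0" "b \<noteq> 0" "norm a = 1" "norm b = 1" by (auto simp: a_def b_def)
      have "N = (\<lambda>w. (fst w / a, snd w / b)) -` ((-\<real>\<^sub>\<le>\<^sub>0) \<times> (-\<real>\<^sub>\<le>\<^sub>0))"
        by (auto simp: N_def)
      moreover have "open \<dots>"
        by (intro open_vimage open_Times continuous_intros) auto
      ultimately have N: "open N" by simp
      have Q: "continuous_on N Q"
        unfolding Q_def by (intro continuous_intros) (auto simp: N_def)
      have O: "open (N \<inter> Q -` U)"
        using continuous_open_preimage[OF Q N U(1)] .
      have "continuous_on X g" using hom by (simp add: homeomorphism_def)
      then obtain W where W: "open W" "W \<inter> X = g -` (N \<inter> Q -` U) \<inter> X"
        using O unfolding continuous_on_open_invariant by blast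
      have gPz: "g (P z) = (a, b)"
        using gk(1)[OF E_torus] by (simp add: P_def E_def a_def b_def)
      have PzX: "P z \<in> X" using gk(2)[OF E_torus] by (simp add: P_def)
      have "P z \<in> W"
      proof -
        have "(a, b) \<in> N \<inter> Q -` U" using U(2) by (simp add: N_def Q_def)
        then show ?thesis using W(2) PzX gPz by blast
      qed
      moreover have "X \<inter> W \<subseteq> P ` U"
      proof
        fix x assume x: "x \<in> X \<inter> W"
        then have qU: "Q (g x) \<in> U" using W(2) by blast
        have gx: "norm (fst (g x)) = 1" "norm (snd (g x)) = 1"
          using kg(2)[of x] x by (auto simp: torus_def mem_Times_iff)
        have "E (Q (g x)) = (a * cis (Arg (fst (g x) / a)), b * cis (Arg (snd (g x) / b)))"
          by (simp add: E_def Q_def a_def b_def distrib_left flip: cis_mult)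
        also have "\<dots> = g x"
          using gx by (subst c1, simp add: norm_divide)+ (simp add: prod_eq_iff)
        finally have "P (Q (g x)) = x" using kg(1)[of x] x by (simp add: P_def)
        then show "x \<in> P ` U" using qU by (metis imageI)
      qed
      ultimately show ?thesis using W(1) by blast
    qed
  qed
qed

text \<open>The covering of the surface by the plane: the fibres are the orbits of the integer
  translations, and \<open>cover_open\<close> says that the map is open onto
  \<open>X\<close>.\<close>

locale torus_cover =
  fixes P :: "real \<times> real \<Rightarrow> 'x::topological_space" and X :: "'x set"
  assumes cover_cont: "continuous_on UNIV P"
    and cover_range: "range P = X"
    and cover_period: "P (s + 1, t) = P (s, t)" "P (s, t + 1) = P (s, t)"
    and cover_fibre: "P y = P z \<Longrightarrow> \<exists>m n. y = z + (of_int m, of_int n)"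
    and cover_open: "open U \<Longrightarrow> z \<in> U \<Longrightarrow> \<exists>W. open W \<and> P z \<in> W \<and> X \<inter> W \<subseteq> P ` U"
begin

text \<open>Points of one fibre differ by an integer vector, and the only integer vector of norm
  below 1 is zero.\<close>

lemma cover_inj: "inj_on P (ball z (1/2))"
proof (rule inj_onI)
  fix x y assume xy: "x \<in> ball z (1/2)" "y \<in> ball z (1/2)" "P x = P y"
  obtain m n :: int where mn: "x = y + (of_int m, of_int n)"
    using cover_fibre[OF xy(3)] by blast
  have "dist x y < 1"
    using xy(1,2) dist_triangle[of x y z] by (simp add: dist_commute field_simps)
  then have "norm (of_int m :: real, of_int n :: real) < 1"
    by (simp add: mn dist_norm)
  then have "\<bar>of_int m :: real\<bar> < 1" "\<bar>of_int n :: real\<bar> < 1"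
    using norm_fst_le[of "of_int m :: real" "of_int n :: real"]
      norm_snd_le[of "of_int n :: real" "of_int m :: real"] by auto
  then have "m = 0" "n = 0" by linarith+
  then show "x = y" using mn by (simp add: prod_eq_iff)
qed

text \<open>Invariance of domain in the plane, transported through the locally injective
  \<open>P\<close>. It rules out local shapes of the complex that embed in the plane with an image
  that is not open.\<close>

lemma invariance_of_domain_surface:
  fixes \<phi> :: "'x \<Rightarrow> real \<times> real"
  assumes "x \<in> X" "open W" "x \<in> W" "continuous_on (X \<inter> W) \<phi>" "inj_on \<phi> (X \<inter> W)"
  obtains U where "open U" "\<phi> x \<in> U" "U \<subseteq> \<phi> ` (X \<inter> W)"
proof -
  obtain z where z: "P z = x" using assms(1) cover_range by blast
  define B where "B = ball z (1/2) \<inter> P -` W"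
  have B: "open B" "z \<in> B" "B \<subseteq> ball z (1/2)" "P ` B \<subseteq> X \<inter> W"
    using open_vimage[OF assms(2) cover_cont] z assms(3) cover_range by (auto simp: B_def)
  have "open ((\<phi> \<circ> P) ` B)"
  proof (rule invariance_of_domain)
    show "continuous_on B (\<phi> \<circ> P)"
      by (intro continuous_on_compose continuous_on_subset[OF cover_cont]
          continuous_on_subset[OF assms(4)] B) auto
    show "inj_on (\<phi> \<circ> P) B"
      by (intro comp_inj_on inj_on_subset[OF cover_inj B(3)] inj_on_subset[OF assms(5) B(4)])
  qed (rule B)
  then show ?thesis
    using B(2,4) z by (intro that[of "(\<phi> \<circ> P) ` B"]) auto
qed

lemma cover_connected: "connected X"
  using connected_continuous_image[OF cover_cont connected_UNIV] cover_range by simp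

end

section \<open>Points and open stars in the geometric realization\<close>

definition vertex_point :: "'v \<Rightarrow> 'v \<Rightarrow> real" where
  "vertex_point v = (\<lambda>u. if u = v then 1 else 0)"

definition edge_point :: "'v \<Rightarrow> 'v \<Rightarrow> real \<Rightarrow> 'v \<Rightarrow> real" where
  "edge_point v w r = (\<lambda>u. (1 - r) * vertex_point v u + r * vertex_point w u)"

lemma edge_point_ends [simp]: "edge_point v w 0 = vertex_point v" "edge_point v w 1 = vertex_point w"
  by (simp_all add: edge_point_def)

lemma continuous_edge_point: "continuous_on S (edge_point v w)"
  unfolding edge_point_def
  by (intro continuous_on_coordinatewise_then_product continuous_intros)

lemma continuous_coordinate: "continuous_on S (\<lambda>x. x v)" for S :: "('v \<Rightarrow> real) set"
  by (rule continuous_on_product_then_coordinatewise) (rule continuous_on_id)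

text \<open>Within the realization this set is the open star of \<open>v\<close>.\<close>

lemma open_coordinate_pos: "open {x. 0 < (x :: 'v \<Rightarrow> real) v}"
  by (rule open_Collect_less) (auto intro: continuous_intros continuous_coordinate)

section \<open>Local structure of a triangulated torus\<close>

locale triangulated_torus = torus_cover P "geometric_realization K"
  for P :: "real \<times> real \<Rightarrow> 'v \<Rightarrow> real" and K :: "'v set set" +
  assumes complex: "abstract_complex K"
    and dim: "s \<in> K \<Longrightarrow> card s \<le> 3"
begin

lemma faceD: "s \<in> K \<Longrightarrow> s' \<subseteq> s \<Longrightarrow> s' \<noteq> {} \<Longrightarrow> s' \<in> K"
  using complex unfolding abstract_complex_def by blast

lemma simplex_finite: "s \<in> K \<Longrightarrow> finite s"
  using complex by (auto simp: abstract_complex_def)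

lemma vertices_finite: "finite (vertices K)"
  using complex by (auto simp: abstract_complex_def vertices_def)

lemma in_vertices: "s \<in> K \<Longrightarrow> v \<in> s \<Longrightarrow> v \<in> vertices K"
  unfolding vertices_def by blast

lemma realizationD_pos: "x \<in> geometric_realization K \<Longrightarrow> 0 \<le> x v"
  by (simp add: geometric_realization_def)

lemma realizationD_supp: "x \<in> geometric_realization K \<Longrightarrow> {v. x v \<noteq> 0} \<in> K"
  by (simp add: geometric_realization_def)

lemma realizationD_sum:
  assumes "x \<in> geometric_realization K" "finite F" "{v. x v \<noteq> 0} \<subseteq> F"
  shows "(\<Sum>v\<in>F. x v) = 1"
proof -
  have "(\<Sum>v | x v \<noteq> 0. x v) = (\<Sum>v\<in>F. x v)"
    by (rule sum.mono_neutral_left[OF assms(2,3)]) simp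
  then show ?thesis using assms(1) by (simp add: geometric_realization_def)
qed

lemma realizationD_face:
  assumes "x \<in> geometric_realization K" "S \<noteq> {}" "\<And>v. v \<in> S \<Longrightarrow> x v \<noteq> 0"
  shows "S \<in> K"
  by (rule faceD[OF realizationD_supp[OF assms(1)] _ assms(2)]) (simp add: subset_iff assms(3))

lemma realizationD_vertex:
  "x \<in> geometric_realization K \<Longrightarrow> x v \<noteq> 0 \<Longrightarrow> v \<in> vertices K"
  using in_vertices[OF realizationD_supp, of x v] by simp

lemma vertex_point_in: "v \<in> vertices K \<Longrightarrow> vertex_point v \<in> geometric_realization K"
  using faceD[of _ "{v}"] by (auto simp: vertices_def geometric_realization_def vertex_point_def)

lemma edge_point_in:
  assumes "{v, w} \<in> K" "0 \<le> r" "r \<le> 1" "v \<noteq> w"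
  shows "edge_point v w r \<in> geometric_realization K"
proof (cases "r = 0 \<or> r = 1")
  case True
  then show ?thesis using assms vertex_point_in in_vertices by auto
next
  case False
  then have "{u. edge_point v w r u \<noteq> 0} = {v, w}"
    using assms by (auto simp: edge_point_def vertex_point_def)
  then show ?thesis
    using assms False by (auto simp: geometric_realization_def edge_point_def vertex_point_def)
qed

text \<open>With at most one triangle at the edge, the coordinates at \<open>u\<close> and
  \<open>v\<close> embed its open star into the half-plane where their sum is at most 1. The
  midpoint lies on the boundary line, so the image is not a neighborhood of it.\<close>

lemma edge_in_two_triangles:
  assumes uv: "{u, v} \<in> edges K"
  shows "\<exists>x y. x \<noteq> y \<and> {u, v, x} \<in> triangles K \<and> {u, v, y} \<in> triangles K"
proof (rule ccontr)
  assume "\<not> ?thesis"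
  then obtain w where w: "\<And>x. {u, v, x} \<in> triangles K \<Longrightarrow> x = w" by blast
  have "u \<noteq> v" "{u, v} \<in> K" using uv by (auto simp: edges_def)
  define W where "W = {x :: 'v \<Rightarrow> real. 0 < x u} \<inter> {x. 0 < x v}"
  let ?X = "geometric_realization K"
  have "open W" by (simp add: W_def open_Int open_coordinate_pos)
  have supp: "{z. x z \<noteq> 0} \<subseteq> {u, v, w}" if x: "x \<in> ?X \<inter> W" for x
  proof
    fix z assume z: "z \<in> {z. x z \<noteq> 0}"
    show "z \<in> {u, v, w}"
    proof (rule ccontr)
      assume *: "z \<notin> {u, v, w}"
      have "{u, v, z} \<in> K" by (rule realizationD_face[of x]) (use x z in \<open>auto simp: W_def\<close>)
      then have "{u, v, z} \<in> triangles K" using * \<open>u \<noteq> v\<close> by (auto simp: triangles_def)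
      then show False using w * by blast
    qed
  qed
  define \<phi> where "\<phi> = (\<lambda>x :: 'v \<Rightarrow> real. (x u, x v))"
  have sum: "(\<Sum>z\<in>{u, v, w}. x z) = 1" if "x \<in> ?X \<inter> W" for x
    by (rule realizationD_sum) (use supp[OF that] that in auto)
  have inj: "inj_on \<phi> (?X \<inter> W)"
  proof (rule inj_onI)
    fix x y assume x: "x \<in> ?X \<inter> W" and y: "y \<in> ?X \<inter> W" and "\<phi> x = \<phi> y"
    then have eq: "x u = y u" "x v = y v" by (auto simp: \<phi>_def)
    have "x w = y w"
      using sum[OF x] sum[OF y] eq \<open>u \<noteq> v\<close> by (cases "w = u \<or> w = v") auto
    moreover have "x z = y z" if "z \<notin> {u, v, w}" for z
    proof -
      have "x z = 0" using supp[OF x] that by blast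
      moreover have "y z = 0" using supp[OF y] that by blast
      ultimately show ?thesis by simp
    qed
    ultimately show "x = y"
      using eq by (intro ext) (metis insertE singletonD)
  qed
  have mid: "edge_point u v (1/2) \<in> ?X \<inter> W"
    using edge_point_in[OF \<open>{u, v} \<in> K\<close>, of "1/2"] \<open>u \<noteq> v\<close>
    by (auto simp: W_def edge_point_def vertex_point_def)
  obtain U where U: "open U" "\<phi> (edge_point u v (1/2)) \<in> U" "U \<subseteq> \<phi> ` (?X \<inter> W)"
  proof (rule invariance_of_domain_surface[OF _ \<open>open W\<close> _ _ inj])
    show "continuous_on (?X \<inter> W) \<phi>"
      unfolding \<phi>_def by (intro continuous_intros continuous_coordinate)
  qed (use mid in auto)
  have "(1/2, 1/2) \<in> U"
    using U(2) \<open>u \<noteq> v\<close> by (simp add: \<phi>_def edge_point_def vertex_point_def)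
  then obtain e where e: "e > 0" "ball (1/2, 1/2) e \<subseteq> U"
    using U(1) open_contains_ball by blast
  have "(1/2 + e/2, 1/2) \<in> ball (1/2, 1/2) e"
    using e(1) by (simp add: dist_Pair_Pair dist_norm)
  then obtain x where x: "x \<in> ?X \<inter> W" "(1/2 + e/2, 1/2) = \<phi> x" using e(2) U(3) by blast
  have "(\<Sum>z\<in>{u, v}. x z) \<le> (\<Sum>z\<in>{u, v, w}. x z)"
    by (rule sum_mono2) (use realizationD_pos[of x] x(1) in auto)
  then have "x u + x v \<le> (\<Sum>z\<in>{u, v, w}. x z)" using \<open>u \<noteq> v\<close> by simp
  then show False using sum[OF x(1)] x(2) e(1) by (simp add: \<phi>_def)
qed

text \<open>The star of an isolated vertex is a single point, so even a constant map is injective on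
  it, and a singleton of the plane would be open.\<close>

lemma vertex_in_edge:
  assumes v: "v \<in> vertices K"
  shows "\<exists>w. {v, w} \<in> edges K"
proof (rule ccontr)
  assume no: "\<not> ?thesis"
  let ?X = "geometric_realization K" and ?W = "{x :: 'v \<Rightarrow> real. 0 < x v}"
  have single: "x = vertex_point v" if x: "x \<in> ?X \<inter> ?W" for x
  proof -
    have supp: "{u. x u \<noteq> 0} \<subseteq> {v}"
    proof (rule subsetI, rule ccontr)
      fix u assume u: "u \<in> {u. x u \<noteq> 0}" "u \<notin> {v}"
      then have "{v, u} \<in> K" by (intro realizationD_face[of x]) (use x in auto)
      then show False using no u by (auto simp: edges_def)
    qed
    then have "x v = 1" using realizationD_sum[of x "{v}"] x by simp
    then show ?thesis using supp by (auto simp: vertex_point_def fun_eq_iff)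
  qed
  define p0 where "p0 = (0 :: real \<times> real)"
  have "inj_on (\<lambda>x. p0) (?X \<inter> ?W)"
  proof (rule inj_onI)
    fix x y assume "x \<in> ?X \<inter> ?W" "y \<in> ?X \<inter> ?W"
    then show "x = y" using single[of x] single[of y] by simp
  qed
  moreover have "vertex_point v \<in> ?W" by (simp add: vertex_point_def)
  ultimately obtain U where U: "open U" "p0 \<in> U" "U \<subseteq> (\<lambda>x. p0) ` (?X \<inter> ?W)"
    using invariance_of_domain_surface[OF vertex_point_in[OF v] open_coordinate_pos[of v] _
        continuous_on_const] by metis
  then have "U = {p0}" by blast
  then show False using U(1) not_open_singleton[of p0] by simp
qed

text \<open>A small punctured disc around the vertex is connected. The stars of the link vertices
  inside \<open>A\<close> and outside \<open>A\<close> cover it by two open sets; a common point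
  would lie in a triangle joining the two kinds.\<close>

lemma link_connected:
  assumes w: "{v, w} \<in> edges K" "w \<in> A"
    and step: "\<And>x y. {v, x, y} \<in> triangles K \<Longrightarrow> x \<in> A \<Longrightarrow> y \<in> A"
    and u: "{v, u} \<in> edges K"
  shows "u \<in> A"
proof (rule ccontr)
  assume "u \<notin> A"
  let ?X = "geometric_realization K"
  define L where "L = {a. {v, a} \<in> edges K}"
  define pos where "pos = (\<lambda>a. {x :: 'v \<Rightarrow> real. 0 < x a})"
  have L: "v \<noteq> a" "{v, a} \<in> K" if "a \<in> L" for a
    using that by (auto simp: L_def edges_def)
  have v: "v \<in> vertices K" using in_vertices[OF L(2)[of w]] w by (auto simp: L_def)
  obtain z where z: "P z = vertex_point v" using vertex_point_in[OF v] cover_range by (metis imageE)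
  have "open (P -` pos v)" "z \<in> P -` pos v"
    using open_vimage[OF open_coordinate_pos cover_cont] z by (auto simp: pos_def vertex_point_def)
  then obtain r0 where r0: "r0 > 0" "ball z r0 \<subseteq> P -` pos v"
    using open_contains_ball by blast
  \<comment> \<open>Within distance \<open>1/2\<close> the map \<open>P\<close> is injective, so no
    other point of the ball is sent to the vertex.\<close>
  define r where "r = min r0 (1/2)"
  have r: "r > 0" "ball z r \<subseteq> P -` pos v" "ball z r \<subseteq> ball z (1/2)"
    using r0 by (auto simp: r_def)
  define S where "S = ball z r - {z}"
  have "connected S"
    unfolding S_def by (rule connected_open_delete) auto
  define OA OB where "OA = P -` (\<Union>a\<in>L \<inter> A. pos a)" and "OB = P -` (\<Union>a\<in>L - A. pos a)"
  have opn: "open OA" "open OB"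
    unfolding OA_def OB_def pos_def by (intro open_vimage cover_cont open_UN ballI open_coordinate_pos)+
  have cov: "S \<subseteq> OA \<union> OB"
  proof
    fix y assume y: "y \<in> S"
    have "y \<in> ball z (1/2)" "z \<in> ball z (1/2)" "y \<noteq> z"
      using y r(3) unfolding S_def by (blast, simp, blast)
    then have "P y \<noteq> P z"
      using inj_onD[OF cover_inj[of z], of y z] by blast
    have Py: "P y \<in> ?X" "P y v > 0" using y r(2) cover_range by (auto simp: S_def pos_def)
    obtain a where a: "a \<noteq> v" "P y a \<noteq> 0"
    proof (rule ccontr)
      assume "\<not> thesis"
      then have *: "{a. P y a \<noteq> 0} \<subseteq> {v}" using that by blast
      then have "P y v = 1" using realizationD_sum[OF Py(1), of "{v}"] by simp
      then have "P y = vertex_point v" using * by (auto simp: vertex_point_def fun_eq_iff)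
      then show False using \<open>P y \<noteq> P z\<close> z by simp
    qed
    then have "{v, a} \<in> K" using a Py(2) by (intro realizationD_face[OF Py(1)]) auto
    then have "a \<in> L" using a by (auto simp: L_def edges_def)
    moreover have "P y \<in> pos a" using a realizationD_pos[OF Py(1), of a] by (auto simp: pos_def)
    ultimately show "y \<in> OA \<union> OB" by (auto simp: OA_def OB_def)
  qed
  have disj: "OA \<inter> OB \<inter> S = {}"
  proof (rule ccontr)
    assume "OA \<inter> OB \<inter> S \<noteq> {}"
    then obtain y a b where y: "y \<in> S" "a \<in> L \<inter> A" "b \<in> L - A" "P y a > 0" "P y b > 0"
      by (auto simp: OA_def OB_def pos_def)
    have Py: "P y \<in> ?X" "P y v > 0" using y r(2) cover_range by (auto simp: S_def pos_def)
    have "{v, a, b} \<in> K" using y Py(2) by (intro realizationD_face[OF Py(1)]) auto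
    moreover have "a \<noteq> b" using y by blast
    ultimately have "{v, a, b} \<in> triangles K"
      using y L(1)[of a] L(1)[of b] by (simp add: triangles_def)
    then show False using step y by blast
  qed
  \<comment> \<open>The edge towards \<open>b\<close> starts at the vertex, so it has points in the
    neighborhood \<open>W\<close>, and these lift to the punctured disc.\<close>
  have hit: "\<exists>y\<in>S. P y \<in> pos b" if b: "b \<in> L" for b
  proof -
    obtain W where W: "open W" "P z \<in> W" "?X \<inter> W \<subseteq> P ` ball z r"
      using cover_open[OF open_ball, of z z r] r(1) by auto
    have "open (edge_point v b -` W)" "0 \<in> edge_point v b -` W"
      using open_vimage[OF W(1) continuous_edge_point] W(2) z by auto
    then obtain e where e: "e > 0" "ball 0 e \<subseteq> edge_point v b -` W"
      using open_contains_ball by blast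
    define d where "d = min (e/2) 1"
    have d: "d > 0" "d \<le> 1" "d \<in> ball 0 e" using e(1) by (auto simp: d_def)
    have "edge_point v b d \<in> ?X \<inter> W"
      using edge_point_in[OF L(2)[OF b] _ d(2)] L(1)[OF b] d(1) subsetD[OF e(2) d(3)] by simp
    then obtain y where y: "y \<in> ball z r" "P y = edge_point v b d"
      using W(3) by (smt (verit) imageE subsetD)
    have pb: "P y b > 0" using y(2) L(1)[OF b] d by (simp add: edge_point_def vertex_point_def)
    then have "y \<noteq> z" using z L(1)[OF b] by (auto simp: vertex_point_def)
    then show ?thesis using y pb by (intro bexI[of _ y]) (auto simp: S_def pos_def)
  qed
  have "OA \<inter> S \<noteq> {}" using hit[of w] w unfolding OA_def L_def by blast
  moreover have "OB \<inter> S \<noteq> {}" using hit[of u] u \<open>u \<notin> A\<close> unfolding OB_def L_def by blast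
  ultimately show False
    using connectedD[OF \<open>connected S\<close> opn disj cov] by simp
qed

text \<open>The total barycentric weight on \<open>A\<close> is continuous on a connected space, and
  it takes only the values 0 and 1 because no edge leaves \<open>A\<close>.\<close>

lemma vertices_connected:
  assumes v: "v \<in> vertices K" "v \<in> A"
    and step: "\<And>x y. {x, y} \<in> edges K \<Longrightarrow> x \<in> A \<Longrightarrow> y \<in> A"
    and u: "u \<in> vertices K"
  shows "u \<in> A"
proof (rule ccontr)
  assume "u \<notin> A"
  let ?X = "geometric_realization K"
  define g where "g = (\<lambda>x :: 'v \<Rightarrow> real. \<Sum>a\<in>A \<inter> vertices K. x a)"
  have g01: "g x \<in> {0, 1}" if x: "x \<in> ?X" for x
  proof -
    let ?S = "{a. x a \<noteq> 0}"
    have S: "?S \<in> K" "finite ?S" using realizationD_supp[OF x] simplex_finite by auto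
    have edge: "{a, b} \<in> edges K" if "a \<in> ?S" "b \<in> ?S" "a \<noteq> b" for a b
    proof -
      have "{a, b} \<in> K" using that by (intro realizationD_face[OF x]) auto
      then show ?thesis using that by (simp add: edges_def)
    qed
    have "?S \<subseteq> A \<or> ?S \<inter> A = {}"
    proof (rule ccontr)
      assume "\<not> ?thesis"
      then obtain a b where "a \<in> ?S" "b \<in> ?S" "a \<in> A" "b \<notin> A" by blast
      then show False using step[OF edge, of a b] by blast
    qed
    then show ?thesis
    proof
      assume "?S \<subseteq> A"
      then have "?S \<subseteq> A \<inter> vertices K" using realizationD_vertex[OF x] by blast
      then show ?thesis using realizationD_sum[OF x] vertices_finite by (simp add: g_def)
    next
      assume "?S \<inter> A = {}"
      then have "g x = 0" unfolding g_def by (intro sum.neutral) auto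
      then show ?thesis by simp
    qed
  qed
  have "g constant_on ?X"
  proof (rule continuous_finite_range_constant[OF cover_connected])
    show "continuous_on ?X g"
      unfolding g_def by (intro continuous_on_sum continuous_coordinate)
    show "finite (g ` ?X)" by (rule finite_subset[of _ "{0, 1}"]) (use g01 in blast, simp)
  qed
  then have "g (vertex_point v) = g (vertex_point u)"
    using vertex_point_in[OF v(1)] vertex_point_in[OF u] by (auto simp: constant_on_def)
  then show False
    using v u \<open>u \<notin> A\<close> vertices_finite by (simp add: g_def vertex_point_def)
qed

end

section \<open>Integer cocycles modulo 2\<close>

text \<open>The relation ranges over all orderings of a triangle, so antisymmetry along edges is a
  consequence (\<open>cocycle_antisym\<close>).\<close>

definition cocycle :: "'v set set \<Rightarrow> ('v \<Rightarrow> 'v \<Rightarrow> int) \<Rightarrow> bool" where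
  "cocycle K \<theta> \<longleftrightarrow> (\<forall>u v w. {u, v, w} \<in> triangles K \<longrightarrow> \<theta> u v + \<theta> v w = \<theta> u w)"

text \<open>The class of \<open>\<theta>\<close> in the first cohomology with coefficients modulo 2
  vanishes.\<close>

definition even_coboundary :: "'v set set \<Rightarrow> ('v \<Rightarrow> 'v \<Rightarrow> int) \<Rightarrow> bool" where
  "even_coboundary K \<theta> \<longleftrightarrow>
     (\<exists>\<phi> :: 'v \<Rightarrow> int. \<forall>u v. {u, v} \<in> edges K \<longrightarrow> even (\<theta> u v - (\<phi> v - \<phi> u)))"

lemma cocycleD: "cocycle K \<theta> \<Longrightarrow> {u, v, w} \<in> triangles K \<Longrightarrow> \<theta> u v + \<theta> v w = \<theta> u w"
  by (simp add: cocycle_def)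

lemma cocycle_combination:
  assumes "cocycle K \<alpha>" "cocycle K \<beta>"
  shows "cocycle K (\<lambda>u v. a * \<alpha> u v + b * \<beta> u v)"
  unfolding cocycle_def
proof (intro allI impI)
  fix u v w assume t: "{u, v, w} \<in> triangles K"
  show "a * \<alpha> u v + b * \<beta> u v + (a * \<alpha> v w + b * \<beta> v w) = a * \<alpha> u w + b * \<beta> u w"
    by (simp add: cocycleD[OF assms(1) t, symmetric] cocycleD[OF assms(2) t, symmetric] algebra_simps)
qed

context triangulated_torus
begin

lemma triangle_edges:
  assumes "{u, v, w} \<in> triangles K"
  shows "{u, v} \<in> edges K" "u \<noteq> v" "u \<noteq> w" "v \<noteq> w"
proof -
  have c: "card {u, v, w} = 3" "{u, v, w} \<in> K" using assms by (auto simp: triangles_def)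
  show "u \<noteq> v" "u \<noteq> w" "v \<noteq> w"
    using c(1) by (auto simp: card_insert_if split: if_splits)
  then show "{u, v} \<in> edges K"
    using faceD[OF c(2), of "{u, v}"] by (simp add: edges_def)
qed

lemma cocycle_antisym:
  assumes "cocycle K \<theta>" "{u, v} \<in> edges K"
  shows "\<theta> v u = - \<theta> u v"
proof -
  obtain x where "{u, v, x} \<in> triangles K" using edge_in_two_triangles[OF assms(2)] by blast
  then have "\<theta> u v + \<theta> v x = \<theta> u x" "\<theta> v u + \<theta> u x = \<theta> v x"
    using cocycleD[OF assms(1)] by (simp, metis insert_commute)
  then show ?thesis by linarith
qed

text \<open>The linear function \<open>\<Sum>\<^sub>w x\<^sub>w \<theta>(v, w)\<close> on the open star of \<open>v\<close> is determined by the
  cocycle up to an integer, so its exponential is a globally defined map to the circle.\<close>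

definition star_value :: "('v \<Rightarrow> 'v \<Rightarrow> int) \<Rightarrow> 'v \<Rightarrow> ('v \<Rightarrow> real) \<Rightarrow> real" where
  "star_value \<theta> v x = (\<Sum>w\<in>vertices K - {v}. x w * of_int (\<theta> v w))"

definition circle_map :: "('v \<Rightarrow> 'v \<Rightarrow> int) \<Rightarrow> ('v \<Rightarrow> real) \<Rightarrow> complex" where
  "circle_map \<theta> x = cis (2 * pi * star_value \<theta> (SOME v. 0 < x v) x)"

text \<open>By the cocycle relation each vertex contributes its barycentric weight times
  \<open>\<theta> u v\<close> to the difference, and the weights add up to 1.\<close>

lemma star_value_change:
  assumes \<theta>: "cocycle K \<theta>" and x: "x \<in> geometric_realization K" and u: "0 < x u" and v: "0 < x v"
    and uv: "u \<noteq> v"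
  shows "star_value \<theta> u x = star_value \<theta> v x + of_int (\<theta> u v)"
proof -
  let ?V = "vertices K"
  have mem: "u \<in> ?V" "v \<in> ?V" using realizationD_vertex[OF x] u v by auto
  have "{u, v} \<in> K" using u v by (intro realizationD_face[OF x]) auto
  then have e: "{u, v} \<in> edges K" using uv by (simp add: edges_def)
  define S where "S = ?V - {u, v}"
  have fin: "finite S" using vertices_finite by (simp add: S_def)
  have V: "?V - {u} = insert v S" "?V - {v} = insert u S" "?V = insert u (insert v S)"
    using mem uv by (auto simp: S_def)
  have nin: "u \<notin> S" "v \<notin> S" by (auto simp: S_def)
  have "(\<Sum>w\<in>?V. x w) = 1"
    using realizationD_vertex[OF x] vertices_finite by (intro realizationD_sum[OF x]) auto
  then have one: "x u + x v + (\<Sum>w\<in>S. x w) = 1" using fin nin uv unfolding V(3) by simp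
  have "x w * of_int (\<theta> u w) = x w * of_int (\<theta> v w) + x w * of_int (\<theta> u v)" if "w \<in> S" for w
  proof (cases "x w = 0")
    case False
    have "{u, v, w} \<in> K" using u v False by (intro realizationD_face[OF x]) auto
    then have "{u, v, w} \<in> triangles K" using uv that by (auto simp: triangles_def S_def)
    then have "\<theta> u w = \<theta> v w + \<theta> u v" using cocycleD[OF \<theta>] by fastforce
    then show ?thesis by (simp add: distrib_left)
  qed simp
  then have "(\<Sum>w\<in>S. x w * of_int (\<theta> u w))
      = (\<Sum>w\<in>S. x w * of_int (\<theta> v w)) + (\<Sum>w\<in>S. x w) * of_int (\<theta> u v)"
    by (simp add: sum.distrib sum_distrib_right)
  moreover have "star_value \<theta> u x = x v * of_int (\<theta> u v) + (\<Sum>w\<in>S. x w * of_int (\<theta> u w))"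
    and "star_value \<theta> v x = - x u * of_int (\<theta> u v) + (\<Sum>w\<in>S. x w * of_int (\<theta> v w))"
    using fin nin cocycle_antisym[OF \<theta> e] by (simp_all add: star_value_def V(1,2))
  ultimately have "star_value \<theta> u x - star_value \<theta> v x
      = (x u + x v + (\<Sum>w\<in>S. x w)) * of_int (\<theta> u v)"
    by (simp add: algebra_simps)
  then show ?thesis by (simp add: one)
qed

lemma circle_map_eq:
  assumes \<theta>: "cocycle K \<theta>" and x: "x \<in> geometric_realization K" and v: "0 < x v"
  shows "circle_map \<theta> x = cis (2 * pi * star_value \<theta> v x)"
proof -
  define u where "u = (SOME v. 0 < x v)"
  have u: "0 < x u" unfolding u_def using someI[of "\<lambda>v. 0 < x v", OF v] .
  show ?thesis
  proof (cases "u = v")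
    case False
    have "star_value \<theta> u x = star_value \<theta> v x + of_int (\<theta> u v)"
      by (rule star_value_change[OF \<theta> x u v False])
    then have "circle_map \<theta> x = cis (2 * pi * star_value \<theta> v x) * cis (2 * pi * of_int (\<theta> u v))"
      by (simp only: circle_map_def u_def[symmetric] cis_mult distrib_left)
    then show ?thesis by (simp add: cis_multiple_2pi)
  qed (simp add: circle_map_def flip: u_def)
qed

lemma continuous_circle_map:
  assumes \<theta>: "cocycle K \<theta>"
  shows "continuous_on (geometric_realization K) (circle_map \<theta>)"
proof -
  let ?X = "geometric_realization K"
  have "(circle_map \<theta> \<longlongrightarrow> circle_map \<theta> x) (at x within ?X)" if x: "x \<in> ?X" for x
  proof -
    have "{v. x v \<noteq> 0} \<noteq> {}"
      using realizationD_supp[OF x] complex unfolding abstract_complex_def by blast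
    then obtain v where "x v \<noteq> 0" by blast
    then have v: "0 < x v" using realizationD_pos[OF x, of v] by simp
    let ?W = "{x :: 'v \<Rightarrow> real. 0 < x v}"
    have "continuous_on (?X \<inter> ?W) (\<lambda>x. cis (2 * pi * star_value \<theta> v x))"
      unfolding star_value_def cis_conv_exp by (intro continuous_intros continuous_coordinate)
    then have "continuous_on (?X \<inter> ?W) (circle_map \<theta>)"
      by (rule continuous_on_eq) (simp add: circle_map_eq[OF \<theta>, of _ v])
    then have "(circle_map \<theta> \<longlongrightarrow> circle_map \<theta> x) (at x within ?X \<inter> ?W)"
      using x v by (simp add: continuous_on_def)
    moreover have "at x within ?X = at x within ?X \<inter> ?W"
      by (rule at_within_nhd[of x ?W]) (use v open_coordinate_pos in auto)
    ultimately show ?thesis by simp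
  qed
  then show ?thesis by (simp add: continuous_on_def)
qed

text \<open>The plane is contractible, so the pulled back map has a logarithm. A translation by a
  period changes the logarithm by a continuous function with values in the integer multiples of 2 pi
  i, hence by a constant.\<close>

lemma circle_map_lift:
  assumes \<theta>: "cocycle K \<theta>"
  obtains L :: "real \<times> real \<Rightarrow> complex" and m n :: int where
    "continuous_on UNIV L" "\<And>z. exp (L z) = circle_map \<theta> (P z)"
    "\<And>s t. L (s + 1, t) = L (s, t) + 2 * pi * of_int m * \<i>"
    "\<And>s t. L (s, t + 1) = L (s, t) + 2 * pi * of_int n * \<i>"
proof -
  have "continuous_on UNIV (circle_map \<theta> \<circ> P)"
    using continuous_circle_map[OF \<theta>] cover_range by (intro continuous_on_compose cover_cont) simp
  then obtain L where L: "continuous_on UNIV L" "\<And>z. circle_map \<theta> (P z) = exp (L z)"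
    by (rule continuous_logarithm_on_contractible[of UNIV "circle_map \<theta> \<circ> P"])
       (auto simp: circle_map_def convex_imp_contractible)
  have period: "\<exists>m :: int. \<forall>z. L (z + d) = L z + 2 * pi * of_int m * \<i>"
    if d: "\<And>z. P (z + d) = P z" for d
  proof -
    define D where "D = (\<lambda>z. L (z + d) - L z)"
    have D: "\<exists>m :: int. D z = 2 * pi * of_int m * \<i>" for z
    proof -
      have "exp (D z) = 1" using L(2)[of z] L(2)[of "z + d"] d[of z] by (simp add: D_def exp_diff)
      then obtain m :: int where "Re (D z) = 0" "Im (D z) = of_int (2 * m) * pi"
        unfolding exp_eq_1 by blast
      then show ?thesis by (intro exI[of _ m]) (simp add: complex_eq_iff)
    qed
    have "D constant_on UNIV"
    proof (rule continuous_discrete_range_constant[OF connected_UNIV])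
      show "continuous_on UNIV D"
        unfolding D_def
        by (intro continuous_intros continuous_on_compose2[OF L(1)]) auto
      show "\<exists>e>0. \<forall>y. y \<in> UNIV \<and> D y \<noteq> D x \<longrightarrow> e \<le> norm (D y - D x)" for x
      proof (intro exI[of _ "2 * pi"] conjI allI impI)
        fix y assume y: "y \<in> UNIV \<and> D y \<noteq> D x"
        obtain k l :: int where kl: "D x = 2 * pi * of_int k * \<i>" "D y = 2 * pi * of_int l * \<i>"
          using D by metis
        have "D y - D x = of_real (2 * pi * of_int (l - k)) * \<i>"
          by (simp add: kl algebra_simps)
        then have "norm (D y - D x) = 2 * pi * \<bar>of_int (l - k)\<bar>"
          by (simp only: norm_mult norm_of_real norm_ii) (simp add: abs_mult)
        moreover have "l \<noteq> k" using y kl by auto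
        then have "1 \<le> \<bar>of_int (l - k) :: real\<bar>" by linarith
        ultimately show "2 * pi \<le> norm (D y - D x)" by (simp add: mult_le_cancel_left1)
      qed simp
    qed
    then obtain c where c: "\<And>z. D z = c" by (auto simp: constant_on_def)
    obtain m :: int where "c = 2 * pi * of_int m * \<i>" using D c by metis
    then have "L (z + d) = L z + 2 * pi * of_int m * \<i>" for z
      using c[of z] by (simp add: D_def algebra_simps)
    then show ?thesis by blast
  qed
  obtain m :: int where m: "\<forall>z. L (z + (1, 0)) = L z + 2 * pi * of_int m * \<i>"
    using period[of "(1, 0)"] cover_period by force
  obtain n :: int where n: "\<forall>z. L (z + (0, 1)) = L z + 2 * pi * of_int n * \<i>"
    using period[of "(0, 1)"] cover_period by force
  show ?thesis
  proof
    show "L (s + 1, t) = L (s, t) + 2 * pi * of_int m * \<i>" for s t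
      using m[rule_format, of "(s, t)"] by simp
    show "L (s, t + 1) = L (s, t) + 2 * pi * of_int n * \<i>" for s t
      using n[rule_format, of "(s, t)"] by simp
  qed (use L in auto)
qed

text \<open>The integers \<open>m\<close> and \<open>n\<close> are the periods of
  \<open>\<theta>\<close> along the two coordinate loops of the torus.\<close>

definition lifts :: "('v \<Rightarrow> 'v \<Rightarrow> int) \<Rightarrow> (real \<times> real \<Rightarrow> complex) \<Rightarrow> int \<Rightarrow> int \<Rightarrow> bool" where
  "lifts \<theta> L m n \<longleftrightarrow> continuous_on UNIV L \<and> (\<forall>z. exp (L z) = circle_map \<theta> (P z)) \<and>
     (\<forall>s t. L (s + 1, t) = L (s, t) + 2 * pi * of_int m * \<i>) \<and>
     (\<forall>s t. L (s, t + 1) = L (s, t) + 2 * pi * of_int n * \<i>)"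

lemma circle_map_add: "circle_map (\<lambda>u v. \<alpha> u v + \<beta> u v) x = circle_map \<alpha> x * circle_map \<beta> x"
  by (simp add: circle_map_def star_value_def cis_mult sum.distrib distrib_left)

lemma lifts_add:
  "lifts \<alpha> L m n \<Longrightarrow> lifts \<beta> M k l \<Longrightarrow> lifts (\<lambda>u v. \<alpha> u v + \<beta> u v) (\<lambda>z. L z + M z) (m + k) (n + l)"
  by (auto simp: lifts_def circle_map_add exp_add algebra_simps intro!: continuous_intros)

text \<open>With even periods, half of the logarithm still has a well-defined exponential on the
  torus: a square root \<open>T\<close> of the circle map. It is 1 or -1 at vertices, and along an
  edge it makes \<open>\<theta> v w\<close> half turns, so its signs are a potential modulo
  2.\<close>

lemma even_lift_imp_even_coboundary:
  assumes \<theta>: "cocycle K \<theta>" and L: "lifts \<theta> L m n" and even: "even m" "even n"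
  shows "even_coboundary K \<theta>"
proof -
  let ?X = "geometric_realization K"
  define S where "S = (\<lambda>z. exp (L z / 2))"
  have S_cont: "continuous_on UNIV S"
    using L unfolding S_def lifts_def by (intro continuous_intros) auto
  have half: "exp (complex_of_real (2 * pi * of_int k) * \<i> / 2) = 1" if "even k" for k :: int
  proof -
    obtain l where "k = 2 * l" using \<open>even k\<close> by blast
    then have "complex_of_real (2 * pi * of_int k) * \<i> / 2 = of_int (2 * l) * (complex_of_real pi * \<i>)"
      by simp
    then show ?thesis using exp_2pi_1_int[of l] by (simp add: mult_ac)
  qed
  have S1: "S (s + 1, t) = S (s, t)" "S (s, t + 1) = S (s, t)" for s t
    using L half[OF even(1)] half[OF even(2)]
    by (simp_all add: S_def lifts_def add_divide_distrib exp_add)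
  have per: "f (s + of_int k) = f s" if "\<And>s. f (s + 1) = f s"
    for f :: "real \<Rightarrow> complex" and k :: int and s
  proof (induction k rule: int_induct[where k = 0])
    case (step1 i)
    then show ?case using that[of "s + of_int i"] by (simp add: add.assoc)
  next
    case (step2 i)
    then show ?case using that[of "s + of_int (i - 1)"] by (simp add: add.assoc)
  qed simp
  have S_fibre: "S y = S z" if eq: "P y = P z" for y z
  proof -
    obtain k l :: int where "y = z + (of_int k, of_int l)" using cover_fibre[OF eq] by blast
    then have "S y = S (fst z + of_int k, snd z + of_int l)" by (cases z) simp
    also have "\<dots> = S (fst z, snd z + of_int l)" by (rule per[of "\<lambda>s. S (s, _)"]) (rule S1)
    also have "\<dots> = S z" using per[of "\<lambda>t. S (fst z, t)"] S1(2) by simp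
    finally show ?thesis .
  qed
  define T where "T = (\<lambda>x. S (SOME z. P z = x))"
  have TP: "T (P z) = S z" for z
    unfolding T_def by (rule S_fibre) (rule someI[of "\<lambda>y. P y = P z" z], rule refl)
  \<comment> \<open>Continuity descends from the plane because \<open>P\<close> is open onto the
    realization.\<close>
  have T_cont: "continuous_on ?X T"
    unfolding continuous_on_topological
  proof (intro ballI allI impI)
    fix x B assume x: "x \<in> ?X" and B: "open B" "T x \<in> B"
    obtain z where z: "x = P z" using x cover_range by (metis imageE)
    have "open (S -` B)" "z \<in> S -` B"
      using open_vimage[OF B(1) S_cont] B(2) by (auto simp: z TP)
    from cover_open[OF this] obtain W where W: "open W" "P z \<in> W" "?X \<inter> W \<subseteq> P ` (S -` B)" by blast
    have "T y \<in> B" if y: "y \<in> ?X" "y \<in> W" for y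
    proof -
      obtain q where "y = P q" "q \<in> S -` B" using W(3) y by blast
      then show ?thesis by (simp add: TP)
    qed
    then show "\<exists>A. open A \<and> x \<in> A \<and> (\<forall>y\<in>?X. y \<in> A \<longrightarrow> T y \<in> B)"
      using W(1,2) z by blast
  qed
  have T_sq: "(T x)\<^sup>2 = circle_map \<theta> x" if x: "x \<in> ?X" for x
  proof -
    obtain z where z: "x = P z" using x cover_range by (metis imageE)
    have "(S z)\<^sup>2 = exp (L z)"
      by (simp add: S_def power2_eq_square flip: exp_add)
    moreover have "exp (L z) = circle_map \<theta> (P z)" using L unfolding lifts_def by blast
    ultimately show ?thesis by (simp add: z TP)
  qed
  have vp: "T (vertex_point v) = 1 \<or> T (vertex_point v) = -1" if v: "v \<in> vertices K" for v
  proof -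
    have "star_value \<theta> v (vertex_point v) = 0"
      unfolding star_value_def by (rule sum.neutral) (simp add: vertex_point_def)
    then have "circle_map \<theta> (vertex_point v) = 1"
      using circle_map_eq[OF \<theta> vertex_point_in[OF v], of v] by (simp add: vertex_point_def)
    then show ?thesis using T_sq[OF vertex_point_in[OF v]] by (simp add: power2_eq_1_iff)
  qed
  define \<phi> :: "'v \<Rightarrow> int" where "\<phi> v = (if T (vertex_point v) = 1 then 0 else 1)" for v
  have "even (\<theta> v w - (\<phi> w - \<phi> v))" if e: "{v, w} \<in> edges K" for v w
  proof -
    have vw: "v \<noteq> w" "{v, w} \<in> K" "v \<in> vertices K" "w \<in> vertices K"
      using e by (auto simp: edges_def vertices_def)
    let ?q = "edge_point v w"
    \<comment> \<open>The second factor undoes the expected half turns; what remains squares to 1,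
      so it is constant along the edge.\<close>
    define g where "g = (\<lambda>r. T (?q r) * cis (- (pi * r * of_int (\<theta> v w))))"
    have q_in: "?q r \<in> ?X" if "r \<in> {0..1}" for r
      using edge_point_in[OF vw(2)] that vw(1) by simp
    have sq: "(g r)\<^sup>2 = 1" if r: "r \<in> {0..1}" for r
    proof -
      have "circle_map \<theta> (?q r) = cis (2 * pi * r * of_int (\<theta> v w))"
      proof (cases "r = 1")
        \<comment> \<open>At this end the point has left the open star of \<open>v\<close>, so the
          value is read off at the vertex \<open>w\<close>.\<close>
        case True
        have "circle_map \<theta> (vertex_point w) = 1"
          using T_sq[OF vertex_point_in[OF vw(4)]] vp[OF vw(4)] by auto
        then show ?thesis using True by (simp add: cis_multiple_2pi)
      next
        case False
        have "star_value \<theta> v (?q r) = (\<Sum>u\<in>vertices K - {v}. if u = w then r * of_int (\<theta> v w) else 0)"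
          unfolding star_value_def
          by (rule sum.cong) (auto simp: edge_point_def vertex_point_def)
        also have "\<dots> = r * of_int (\<theta> v w)"
          using vw vertices_finite by simp
        finally have "star_value \<theta> v (?q r) = r * of_int (\<theta> v w)" .
        moreover have "0 < ?q r v" using False r vw(1) by (simp add: edge_point_def vertex_point_def)
        ultimately show ?thesis using circle_map_eq[OF \<theta> q_in[OF r], of v] by (simp add: mult_ac)
      qed
      then have "(g r)\<^sup>2 = cis (2 * pi * r * of_int (\<theta> v w)) * (cis (- (pi * r * of_int (\<theta> v w))))\<^sup>2"
        using T_sq[OF q_in[OF r]] by (simp add: g_def power_mult_distrib)
      also have "\<dots> = cis 0"
        unfolding power2_eq_square cis_mult by (rule arg_cong[of _ _ cis]) simp
      finally show ?thesis by simp
    qed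
    have "g constant_on {0..1}"
    proof (rule continuous_finite_range_constant)
      show "connected {0..1::real}" by simp
      show "continuous_on {0..1} g"
        unfolding g_def cis_conv_exp
        by (intro continuous_intros continuous_on_compose2[OF T_cont continuous_edge_point])
           (use q_in in auto)
      show "finite (g ` {0..1})"
      proof (rule finite_subset)
        show "g ` {0..1} \<subseteq> {1, -1}"
          using sq by (intro image_subsetI) (metis insertCI power2_eq_1_iff)
      qed simp
    qed
    then have "g 0 = g 1" by (auto simp: constant_on_def)
    then have eq: "T (vertex_point v) = T (vertex_point w) * cis (- (pi * of_int (\<theta> v w)))"
      by (simp add: g_def)
    have "cis (- (pi * of_int k)) = (if even k then 1 else -1)" for k :: int
      by (auto simp: complex_eq_iff cos_npi_int sin_npi_int)
    then show ?thesis
      using eq vp[OF vw(3)] vp[OF vw(4)] by (auto simp: \<phi>_def split: if_splits)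
  qed
  then show ?thesis unfolding even_coboundary_def by blast
qed

text \<open>The parities of the two periods form a vector over the field with two elements, and
  three vectors in a plane are dependent. This is the bound 2 on the dimension of the first
  cohomology.\<close>

lemma three_cocycles_dependent:
  assumes "cocycle K \<alpha>" "cocycle K \<beta>" "cocycle K \<gamma>"
  obtains a b c :: int where "a \<in> {0, 1}" "b \<in> {0, 1}" "c \<in> {0, 1}" "(a, b, c) \<noteq> (0, 0, 0)"
    "even_coboundary K (\<lambda>u v. a * \<alpha> u v + b * \<beta> u v + c * \<gamma> u v)"
proof -
  obtain A m\<alpha> n\<alpha> where A: "lifts \<alpha> A m\<alpha> n\<alpha>" using circle_map_lift[OF assms(1)] unfolding lifts_def by metis
  obtain B m\<beta> n\<beta> where B: "lifts \<beta> B m\<beta> n\<beta>" using circle_map_lift[OF assms(2)] unfolding lifts_def by metis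
  obtain C m\<gamma> n\<gamma> where C: "lifts \<gamma> C m\<gamma> n\<gamma>" using circle_map_lift[OF assms(3)] unfolding lifts_def by metis
  have scale: "\<exists>M. lifts (\<lambda>u v. a * \<theta> u v) M (a * m) (a * n)"
    if "lifts \<theta> L m n" "a \<in> {0, 1}" for \<theta> L m n and a :: int
  proof (cases "a = 0")
    case True
    then have "lifts (\<lambda>u v. a * \<theta> u v) (\<lambda>z. 0) (a * m) (a * n)"
      by (simp add: lifts_def circle_map_def star_value_def)
    then show ?thesis by blast
  qed (use that in auto)
  have comb: "even_coboundary K (\<lambda>u v. a * \<alpha> u v + b * \<beta> u v + c * \<gamma> u v)"
    if abc: "a \<in> {0, 1}" "b \<in> {0, 1}" "c \<in> {0, 1}"
      "even (a * m\<alpha> + b * m\<beta> + c * m\<gamma>)" "even (a * n\<alpha> + b * n\<beta> + c * n\<gamma>)" for a b c :: int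
  proof -
    obtain A' where A': "lifts (\<lambda>u v. a * \<alpha> u v) A' (a * m\<alpha>) (a * n\<alpha>)" using scale[OF A abc(1)] by blast
    obtain B' where B': "lifts (\<lambda>u v. b * \<beta> u v) B' (b * m\<beta>) (b * n\<beta>)" using scale[OF B abc(2)] by blast
    obtain C' where C': "lifts (\<lambda>u v. c * \<gamma> u v) C' (c * m\<gamma>) (c * n\<gamma>)" using scale[OF C abc(3)] by blast
    have coc: "cocycle K (\<lambda>u v. a * \<alpha> u v + b * \<beta> u v + c * \<gamma> u v)"
      using cocycle_combination[OF cocycle_combination[OF assms(1,2), of a b] assms(3), of 1 c] by simp
    show ?thesis
      by (rule even_lift_imp_even_coboundary[OF coc lifts_add[OF lifts_add[OF A' B'] C'] abc(4,5)])
  qed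
  have "\<exists>a\<in>{0, 1}. \<exists>b\<in>{0, 1}. \<exists>c\<in>{0, 1 :: int}. (a, b, c) \<noteq> (0, 0, 0) \<and>
      even (a * m\<alpha> + b * m\<beta> + c * m\<gamma>) \<and> even (a * n\<alpha> + b * n\<beta> + c * n\<gamma>)"
    by auto
  then obtain a b c :: int where abc: "a \<in> {0, 1}" "b \<in> {0, 1}" "c \<in> {0, 1}" "(a, b, c) \<noteq> (0, 0, 0)"
      "even (a * m\<alpha> + b * m\<beta> + c * m\<gamma>)" "even (a * n\<alpha> + b * n\<beta> + c * n\<gamma>)"
    by (elim bexE conjE)
  show ?thesis by (rule that[OF abc(1-4) comb[OF abc(1-3,5,6)]])
qed

end

section \<open>The intersection pairing\<close>

lemma sum_involution:
  fixes g :: "'b \<Rightarrow> int"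
  assumes "\<And>q. q \<in> A \<Longrightarrow> \<iota> q \<in> A \<and> \<iota> (\<iota> q) = q \<and> g (\<iota> q) = - g q"
  shows "sum g A = 0"
proof -
  have "sum g A = sum (\<lambda>q. - g q) A"
    by (rule sum.reindex_bij_witness[of _ \<iota> \<iota>]) (use assms in auto)
  then show ?thesis by (simp add: sum_negf)
qed

locale three_colored_torus = triangulated_torus P K
  for P :: "real \<times> real \<Rightarrow> 'v \<Rightarrow> real" and K :: "'v set set" +
  fixes R :: "('v \<times> 'v \<times> 'v) set" and c :: "'v \<Rightarrow> nat"
  assumes orientation: "surface_orientation K R"
    and coloring: "c \<in> complex_colorings K 3"
begin

section \<open>Orientation and strong connectivity of the triangles\<close>

lemma c_range: "v \<in> vertices K \<Longrightarrow> c v \<in> {1, 2, 3}"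
  using coloring by (auto simp: colorings_def PiE_def Pi_def)

lemma c_edge: "{u, v} \<in> edges K \<Longrightarrow> c u \<noteq> c v"
  using coloring unfolding colorings_def by blast

lemma edge_vertices: "{u, v} \<in> edges K \<Longrightarrow> u \<in> vertices K \<and> v \<in> vertices K \<and> u \<noteq> v"
  by (auto simp: edges_def vertices_def)

lemma triangle_rotate: "{u, v, w} \<in> triangles K \<Longrightarrow> {v, w, u} \<in> triangles K"
  by (simp add: insert_commute)

lemma triangle_swap: "{u, v, w} \<in> triangles K \<Longrightarrow> {v, u, w} \<in> triangles K"
  by (simp add: insert_commute)

lemma triangle_all_edges:
  assumes "{u, v, w} \<in> triangles K"
  shows "{u, v} \<in> edges K" "{v, w} \<in> edges K" "{u, w} \<in> edges K"
  using triangle_edges(1)[OF assms] triangle_edges(1)[OF triangle_rotate[OF assms]]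
    triangle_edges(1)[OF triangle_rotate[OF triangle_rotate[OF assms]]]
  by (simp_all add: insert_commute)

lemma triangle_exists:
  assumes "t \<in> triangles K"
  obtains u v w where "t = {u, v, w}" "{u, v, w} \<in> triangles K"
proof -
  have "card t = 3" using assms by (simp add: triangles_def)
  then obtain u v w where "t = {u, v, w}" unfolding card_3_iff by blast
  then show ?thesis using that[of u v w] assms by simp
qed

lemma triangle_colors:
  assumes "{u, v, w} \<in> triangles K"
  shows "c u \<in> {1, 2, 3}" "c v \<in> {1, 2, 3}" "c w \<in> {1, 2, 3}" "c u \<noteq> c v" "c v \<noteq> c w" "c u \<noteq> c w"
  using triangle_all_edges[OF assms] c_edge edge_vertices c_range by metis+

lemma apex_color:
  assumes "{u, v, x} \<in> triangles K" "{u, v, y} \<in> triangles K"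
  shows "c x = c y"
  using triangle_colors[OF assms(1)] triangle_colors[OF assms(2)] by auto

lemma R_triangle: "(u, v, w) \<in> R \<Longrightarrow> {u, v, w} \<in> triangles K"
  using orientation unfolding surface_orientation_def by blast

lemma R_rotate: "(u, v, w) \<in> R \<Longrightarrow> (v, w, u) \<in> R"
  using orientation unfolding surface_orientation_def by blast

lemma R_swap: "{u, v, w} \<in> triangles K \<Longrightarrow> (u, v, w) \<in> R \<longleftrightarrow> (v, u, w) \<notin> R"
  using orientation unfolding surface_orientation_def by blast

lemma R_rotate_iff: "(v, w, u) \<in> R \<longleftrightarrow> (u, v, w) \<in> R"
  using R_rotate by blast

lemma R_across:
  assumes "{u, v, x} \<in> triangles K" "{u, v, y} \<in> triangles K" "x \<noteq> y"
  shows "(u, v, x) \<in> R \<longleftrightarrow> (u, v, y) \<notin> R"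
proof -
  have step: "(b, a, d) \<in> R"
    if "(a, b, e) \<in> R" "{a, b, d} \<in> triangles K" "d \<noteq> e" for a b d e
    using orientation that unfolding surface_orientation_def by blast
  have "(v, u, y) \<in> R" if "(u, v, x) \<in> R" using step[OF that assms(2)] assms(3) by blast
  moreover have "(u, v, x) \<in> R" if "(v, u, y) \<in> R"
    using step[OF that triangle_swap[OF assms(1)]] assms(3) by blast
  ultimately show ?thesis using R_swap[OF assms(2)] by blast
qed

text \<open>Distinct triangles on an edge induce opposite directions on it, and an edge has only two
  directions.\<close>

lemma at_most_two_triangles:
  assumes "{u, v, x} \<in> triangles K" "{u, v, y} \<in> triangles K" "{u, v, z} \<in> triangles K"
    "x \<noteq> y" "x \<noteq> z"
  shows "y = z"
  using R_across[OF assms(1,2,4)] R_across[OF assms(1,3,5)] R_across[OF assms(2,3)] by blast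

definition other :: "'v \<Rightarrow> 'v \<Rightarrow> 'v \<Rightarrow> 'v" where
  "other u v x = (THE y. y \<noteq> x \<and> {u, v, y} \<in> triangles K)"

lemma other:
  assumes "{u, v, x} \<in> triangles K"
  shows "other u v x \<noteq> x" "{u, v, other u v x} \<in> triangles K"
    "{u, v, y} \<in> triangles K \<Longrightarrow> y \<noteq> x \<Longrightarrow> y = other u v x"
    "other u v (other u v x) = x" "c (other u v x) = c x"
proof -
  obtain y where y: "y \<noteq> x" "{u, v, y} \<in> triangles K"
    using edge_in_two_triangles[OF triangle_edges(1)[OF assms]] by metis
  have uniq: "z = y" if "z \<noteq> x" "{u, v, z} \<in> triangles K" for z
    using at_most_two_triangles[OF assms that(2) y(2)] that(1) y(1) by blast
  have o: "other u v x = y" unfolding other_def by (rule the_equality) (simp add: y, use uniq in blast)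
  show "other u v x \<noteq> x" "{u, v, other u v x} \<in> triangles K" using o y by auto
  show "{u, v, y} \<in> triangles K \<Longrightarrow> y \<noteq> x \<Longrightarrow> y = other u v x" for y using uniq o by blast
  have "other u v y = x"
    unfolding other_def by (rule the_equality) (use assms y(1) uniq in blast)+
  then show "other u v (other u v x) = x" by (simp add: o)
  show "c (other u v x) = c x" using apex_color[OF assms y(2)] o by simp
qed

text \<open>Any two triangles are joined by a chain of triangles with common edges: connected links
  allow turning around a vertex, and the connected 1-skeleton allows passing to the next
  vertex.\<close>

lemma triangle_induct:
  assumes t: "{a, b, d} \<in> triangles K" "A a b d"
    and perm: "\<And>u v w. {u, v, w} \<in> triangles K \<Longrightarrow> A u v w \<Longrightarrow> A v w u \<and> A v u w"
    and cross: "\<And>u v x y. {u, v, x} \<in> triangles K \<Longrightarrow> {u, v, y} \<in> triangles K \<Longrightarrow> A u v x \<Longrightarrow> A u v y"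
    and s: "{u, v, w} \<in> triangles K"
  shows "A u v w"
proof -
  have star: "A x y z" if xyz: "{x, y, z} \<in> triangles K" and pq: "{x, p, q} \<in> triangles K" "A x p q"
    for x y z p q
  proof -
    define B where "B = {r. \<forall>s. {x, r, s} \<in> triangles K \<longrightarrow> A x r s}"
    have "y \<in> B"
    proof (rule link_connected[where w = p and v = x])
      show "{x, p} \<in> edges K" using triangle_all_edges[OF pq(1)] by simp
      show "p \<in> B" using cross[OF pq(1) _ pq(2)] by (auto simp: B_def)
      show "n \<in> B" if "{x, m, n} \<in> triangles K" "m \<in> B" for m n
      proof -
        have "A x m n" using that by (auto simp: B_def)
        moreover have *: "{x, n, m} \<in> triangles K" using that(1) by (simp add: insert_commute)
        ultimately have "A x n m" using perm[OF that(1)] perm[OF triangle_rotate[OF that(1)]]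
            perm[OF triangle_rotate[OF triangle_rotate[OF that(1)]]]
            perm[OF triangle_swap[OF that(1)]] by blast
        then show ?thesis using cross[OF *] by (auto simp: B_def)
      qed
      show "{x, y} \<in> edges K" using triangle_all_edges[OF xyz] by simp
    qed
    then show ?thesis using xyz by (simp add: B_def)
  qed
  define B where "B = {x. \<forall>y z. {x, y, z} \<in> triangles K \<longrightarrow> A x y z}"
  have "u \<in> B"
  proof (rule vertices_connected)
    show "a \<in> vertices K" "u \<in> vertices K"
      using edge_vertices triangle_all_edges[OF t(1)] triangle_all_edges[OF s] by blast+
    show "a \<in> B" using star[OF _ t] by (auto simp: B_def)
    show "y \<in> B" if e: "{x, y} \<in> edges K" "x \<in> B" for x y
    proof -
      obtain z where z: "{x, y, z} \<in> triangles K" using edge_in_two_triangles[OF e(1)] by blast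
      then have "A x y z" using e(2) by (simp add: B_def)
      then have "A y x z" using perm[OF z] by blast
      then show ?thesis using star[OF _ triangle_swap[OF z]] by (auto simp: B_def)
    qed
  qed
  then show ?thesis using s by (simp add: B_def)
qed

text \<open>Every triangle is listed once, with its vertices in the order of their colors under \<open>c\<close>.\<close>

definition chambers :: "('v \<times> 'v \<times> 'v) set" where
  "chambers = {(x, y, z). {x, y, z} \<in> triangles K \<and> c x = 1 \<and> c y = 2 \<and> c z = 3}"

definition sg :: "'v \<Rightarrow> 'v \<Rightarrow> 'v \<Rightarrow> int" where
  "sg x y z = (if (x, y, z) \<in> R then 1 else -1)"

text \<open>The simplicial cup product on the fundamental cycle, front edge times back edge. The
  coloring \<open>c\<close> supplies the consistent ordering of the vertices of each triangle that
  this formula needs.\<close>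

definition pairing :: "('v \<Rightarrow> 'v \<Rightarrow> int) \<Rightarrow> ('v \<Rightarrow> 'v \<Rightarrow> int) \<Rightarrow> int" where
  "pairing \<alpha> \<beta> = (\<Sum>(x, y, z)\<in>chambers. sg x y z * (\<alpha> x y * \<beta> y z))"

lemma chambers_finite: "finite chambers"
proof (rule finite_subset)
  show "chambers \<subseteq> vertices K \<times> vertices K \<times> vertices K"
    using triangle_all_edges edge_vertices unfolding chambers_def by blast
qed (use vertices_finite in auto)

lemma sg_rotate: "sg y z x = sg x y z"
  by (simp add: sg_def R_rotate_iff)

lemma sg_across:
  assumes "{u, v, x} \<in> triangles K" "{u, v, y} \<in> triangles K" "x \<noteq> y"
  shows "sg u v y = - sg u v x"
  using R_across[OF assms] by (simp add: sg_def)

text \<open>The fundamental cycle has no boundary: exchanging the two triangles at an edge reverses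
  the sign and keeps the edge, hence its colors.\<close>

lemma sum_edges:
  "(\<Sum>(x, y, z)\<in>chambers. sg x y z * F x y) = 0"
  "(\<Sum>(x, y, z)\<in>chambers. sg x y z * F y z) = 0"
  "(\<Sum>(x, y, z)\<in>chambers. sg x y z * F x z) = 0"
proof -
  show "(\<Sum>(x, y, z)\<in>chambers. sg x y z * F x y) = 0"
  proof (rule sum_involution[where \<iota> = "\<lambda>(x, y, z). (x, y, other x y z)"], clarify)
    fix x y z assume "(x, y, z) \<in> chambers"
    then have t: "{x, y, z} \<in> triangles K" "c x = 1" "c y = 2" "c z = 3" by (auto simp: chambers_def)
    show "(x, y, other x y z) \<in> chambers \<and> (x, y, other x y (other x y z)) = (x, y, z) \<and>
        sg x y (other x y z) * F x y = - (sg x y z * F x y)"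
      using other(1,2,4,5)[OF t(1)] t sg_across[OF t(1) other(2)[OF t(1)]] by (auto simp: chambers_def)
  qed
  show "(\<Sum>(x, y, z)\<in>chambers. sg x y z * F y z) = 0"
  proof (rule sum_involution[where \<iota> = "\<lambda>(x, y, z). (other y z x, y, z)"], clarify)
    fix x y z assume "(x, y, z) \<in> chambers"
    then have t: "{y, z, x} \<in> triangles K" "c x = 1" "c y = 2" "c z = 3"
      by (auto simp: chambers_def insert_commute)
    show "(other y z x, y, z) \<in> chambers \<and> (other y z (other y z x), y, z) = (x, y, z) \<and>
        sg (other y z x) y z * F y z = - (sg x y z * F y z)"
      using other(1,2,4,5)[OF t(1)] t sg_across[OF t(1) other(2)[OF t(1)]] triangle_rotate
      by (auto simp: chambers_def sg_rotate[of y z])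
  qed
  show "(\<Sum>(x, y, z)\<in>chambers. sg x y z * F x z) = 0"
  proof (rule sum_involution[where \<iota> = "\<lambda>(x, y, z). (x, other z x y, z)"], clarify)
    fix x y z assume "(x, y, z) \<in> chambers"
    then have t: "{z, x, y} \<in> triangles K" "c x = 1" "c y = 2" "c z = 3"
      by (auto simp: chambers_def insert_commute)
    show "(x, other z x y, z) \<in> chambers \<and> (x, other z x (other z x y), z) = (x, y, z) \<and>
        sg x (other z x y) z * F x z = - (sg x y z * F x z)"
      using other(1,2,4,5)[OF t(1)] t sg_across[OF t(1) other(2)[OF t(1)]] triangle_rotate
      by (auto simp: chambers_def sg_rotate[of _ _ z])
  qed
qed

lemma pairing_combination:
  "pairing (\<lambda>u v. a * \<alpha> u v + b * \<beta> u v) \<gamma> = a * pairing \<alpha> \<gamma> + b * pairing \<beta> \<gamma>"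
  "pairing \<gamma> (\<lambda>u v. a * \<alpha> u v + b * \<beta> u v) = a * pairing \<gamma> \<alpha> + b * pairing \<gamma> \<beta>"
  by (simp_all add: pairing_def case_prod_unfold sum_distrib_left sum.distrib[symmetric] algebra_simps)

text \<open>The two products add up to minus the coboundary of the pointwise product of
  \<open>\<alpha>\<close> and \<open>\<beta>\<close>, which \<open>sum_edges\<close> kills.\<close>

lemma pairing_antisym:
  assumes "cocycle K \<alpha>" "cocycle K \<beta>"
  shows "pairing \<beta> \<alpha> = - pairing \<alpha> \<beta>"
proof -
  have "pairing \<alpha> \<beta> + pairing \<beta> \<alpha> = (\<Sum>(x, y, z)\<in>chambers. sg x y z * (\<alpha> x z * \<beta> x z)
      - sg x y z * (\<alpha> x y * \<beta> x y) - sg x y z * (\<alpha> y z * \<beta> y z))"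
    unfolding pairing_def sum.distrib[symmetric]
  proof (rule sum.cong, rule refl, clarify)
    fix x y z assume "(x, y, z) \<in> chambers"
    then have t: "{x, y, z} \<in> triangles K" by (simp add: chambers_def)
    show "sg x y z * (\<alpha> x y * \<beta> y z) + sg x y z * (\<beta> x y * \<alpha> y z) = sg x y z * (\<alpha> x z * \<beta> x z)
      - sg x y z * (\<alpha> x y * \<beta> x y) - sg x y z * (\<alpha> y z * \<beta> y z)"
      by (simp add: cocycleD[OF assms(1) t, symmetric] cocycleD[OF assms(2) t, symmetric] algebra_simps)
  qed
  also have "\<dots> = 0"
    using sum_edges(3)[of "\<lambda>x z. \<alpha> x z * \<beta> x z"] sum_edges(1)[of "\<lambda>x z. \<alpha> x z * \<beta> x z"]
      sum_edges(2)[of "\<lambda>x z. \<alpha> x z * \<beta> x z"]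
    by (simp add: case_prod_unfold sum_subtractf)
  finally show ?thesis by simp
qed

lemma pairing_self: "cocycle K \<alpha> \<Longrightarrow> pairing \<alpha> \<alpha> = 0"
  using pairing_antisym[of \<alpha> \<alpha>] by simp

lemma cocycle_coboundary: "cocycle K (\<lambda>u v. \<phi> v - \<phi> u)"
  by (simp add: cocycle_def)

text \<open>The product is itself a coboundary, namely of the cochain that sends an edge from
  \<open>x\<close> to \<open>y\<close> to \<open>\<phi> x * \<beta> x y\<close>.\<close>

lemma pairing_coboundary:
  assumes "cocycle K \<beta>"
  shows "pairing (\<lambda>u v. \<phi> v - \<phi> u) \<beta> = 0" "pairing \<beta> (\<lambda>u v. \<phi> v - \<phi> u) = 0"
proof -
  have "pairing (\<lambda>u v. \<phi> v - \<phi> u) \<beta> = (\<Sum>(x, y, z)\<in>chambers. sg x y z * (\<phi> y * \<beta> y z)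
      - sg x y z * (\<phi> x * \<beta> x z) + sg x y z * (\<phi> x * \<beta> x y))"
    unfolding pairing_def
  proof (rule sum.cong, rule refl, clarify)
    fix x y z assume "(x, y, z) \<in> chambers"
    then have t: "{x, y, z} \<in> triangles K" by (simp add: chambers_def)
    show "sg x y z * ((\<phi> y - \<phi> x) * \<beta> y z) = sg x y z * (\<phi> y * \<beta> y z)
      - sg x y z * (\<phi> x * \<beta> x z) + sg x y z * (\<phi> x * \<beta> x y)"
      by (simp add: cocycleD[OF assms t, symmetric] algebra_simps)
  qed
  also have "\<dots> = 0"
    using sum_edges(3)[of "\<lambda>x z. \<phi> x * \<beta> x z"] sum_edges(1)[of "\<lambda>x y. \<phi> x * \<beta> x y"]
      sum_edges(2)[of "\<lambda>y z. \<phi> y * \<beta> y z"]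
    by (simp add: case_prod_unfold sum_subtractf sum.distrib)
  finally show *: "pairing (\<lambda>u v. \<phi> v - \<phi> u) \<beta> = 0" .
  show "pairing \<beta> (\<lambda>u v. \<phi> v - \<phi> u) = 0"
    using pairing_antisym[OF cocycle_coboundary assms, of \<phi>] * by simp
qed

lemma chamber_edges:
  assumes "(x, y, z) \<in> chambers"
  shows "{x, y} \<in> edges K" "{y, z} \<in> edges K" "{x, z} \<in> edges K"
  using triangle_all_edges[of x y z] assms by (auto simp: chambers_def)

lemma pairing_cong:
  assumes "\<And>u v. {u, v} \<in> edges K \<Longrightarrow> \<alpha> u v = \<alpha>' u v" "\<And>u v. {u, v} \<in> edges K \<Longrightarrow> \<beta> u v = \<beta>' u v"
  shows "pairing \<alpha> \<beta> = pairing \<alpha>' \<beta>'"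
  unfolding pairing_def
  by (rule sum.cong, rule refl, clarify) (use assms chamber_edges in metis)

text \<open>Pulls a factor \<open>m\<close> out of a pairing: the coboundary part pairs to zero, and
  the rest, divided exactly by \<open>m\<close> along edges, is again a cocycle.\<close>

lemma cocycle_mod_coboundary:
  assumes \<theta>: "cocycle K \<theta>" and m: "m \<noteq> 0"
    and dvd: "\<And>u v. {u, v} \<in> edges K \<Longrightarrow> m dvd \<theta> u v - (\<phi> v - \<phi> u)"
  obtains \<mu> where "cocycle K \<mu>" "\<And>u v. {u, v} \<in> edges K \<Longrightarrow> \<theta> u v = \<phi> v - \<phi> u + m * \<mu> u v"
    "\<And>\<gamma>. cocycle K \<gamma> \<Longrightarrow> pairing \<gamma> \<theta> = m * pairing \<gamma> \<mu>"
    "\<And>\<gamma>. cocycle K \<gamma> \<Longrightarrow> pairing \<theta> \<gamma> = m * pairing \<mu> \<gamma>"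
proof -
  define \<mu> where "\<mu> = (\<lambda>u v. (\<theta> u v - (\<phi> v - \<phi> u)) div m)"
  have dec: "\<theta> u v = \<phi> v - \<phi> u + m * \<mu> u v" if "{u, v} \<in> edges K" for u v
    using dvd[OF that] by (simp add: \<mu>_def)
  have \<mu>: "cocycle K \<mu>"
    unfolding cocycle_def
  proof (intro allI impI)
    fix u v w assume t: "{u, v, w} \<in> triangles K"
    have "m * (\<mu> u v + \<mu> v w) = m * \<mu> u w"
      using cocycleD[OF \<theta> t] dec[OF triangle_all_edges(1)[OF t]] dec[OF triangle_all_edges(2)[OF t]]
        dec[OF triangle_all_edges(3)[OF t]]
      by (simp add: algebra_simps)
    then show "\<mu> u v + \<mu> v w = \<mu> u w" using m by simp
  qed
  have "pairing \<gamma> \<theta> = pairing \<gamma> (\<lambda>u v. 1 * (\<phi> v - \<phi> u) + m * \<mu> u v)" for \<gamma>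
    by (rule pairing_cong) (simp_all add: dec)
  then have 1: "pairing \<gamma> \<theta> = m * pairing \<gamma> \<mu>" if "cocycle K \<gamma>" for \<gamma>
    using pairing_coboundary(2)[OF that, of \<phi>] unfolding pairing_combination by simp
  have 2: "pairing \<theta> \<gamma> = m * pairing \<mu> \<gamma>" if \<gamma>: "cocycle K \<gamma>" for \<gamma>
    using 1[OF \<gamma>] pairing_antisym[OF \<gamma> \<theta>] pairing_antisym[OF \<gamma> \<mu>] by simp
  show ?thesis by (rule that[OF \<mu> dec 1 2])
qed

lemma pairing_even_coboundary:
  assumes \<gamma>: "cocycle K \<gamma>" and \<theta>: "cocycle K \<theta>" and "even_coboundary K \<theta>"
  shows "even (pairing \<gamma> \<theta>)"
proof -
  obtain \<phi> :: "'v \<Rightarrow> int" where "\<And>u v. {u, v} \<in> edges K \<Longrightarrow> 2 dvd \<theta> u v - (\<phi> v - \<phi> u)"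
    using assms(3) unfolding even_coboundary_def by blast
  from cocycle_mod_coboundary[OF \<theta> _ this] show ?thesis
    using \<gamma> by (metis dvd_triv_left zero_neq_numeral)
qed

section \<open>Nondegeneracy of the pairing modulo 2\<close>

definition wall :: "'v \<Rightarrow> 'v \<Rightarrow> 'v \<Rightarrow> 'v \<Rightarrow> 'v \<Rightarrow> int" where
  "wall u v p = (\<lambda>a b. if {a, b} = {u, v} then if (a, b, p) \<in> R then 1 else -1 else 0)"

lemma wall_antisym:
  assumes "{u, v, p} \<in> triangles K"
  shows "wall u v p b a = - wall u v p a b"
proof (cases "{a, b} = {u, v}")
  case True
  then have "{a, b, p} = {u, v, p}" by blast
  then have "{a, b, p} \<in> triangles K" using assms by simp
  then show ?thesis using R_swap[of a b p] True by (auto simp: wall_def insert_commute)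
qed (auto simp: wall_def insert_commute)

text \<open>The coboundary of the wall cochain: crossing its edge trades one triangle for the
  other.\<close>

lemma wall_flux:
  assumes t: "{u, v, p} \<in> triangles K" "{u, v, q} \<in> triangles K" "p \<noteq> q" and abd: "(a, b, d) \<in> R"
  shows "wall u v p a b + wall u v p b d + wall u v p d a
    = of_bool ({a, b, d} = {u, v, p}) - of_bool ({a, b, d} = {u, v, q})"
proof -
  have main: "wall u v p a b + wall u v p b d + wall u v p d a
    = of_bool ({a, b, d} = {u, v, p}) - of_bool ({a, b, d} = {u, v, q})"
    if abd: "(a, b, d) \<in> R" and e: "{a, b} = {u, v}" for a b d
  proof -
    have s: "{a, b, d} \<in> triangles K" by (rule R_triangle[OF abd])
    have ne: "a \<noteq> b" "a \<noteq> d" "b \<noteq> d" using triangle_edges[OF s] by auto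
    have eq: "{a, b, x} = {u, v, x}" for x using e by blast
    have t': "{a, b, p} \<in> triangles K" "{a, b, q} \<in> triangles K" using t unfolding eq by auto
    have nd: "{b, d} \<noteq> {u, v}" "{d, a} \<noteq> {u, v}" using ne unfolding e[symmetric] by auto
    have third: "{a, b, d} = {u, v, x} \<longleftrightarrow> d = x" if "{a, b, x} \<in> triangles K" for x
      using ne triangle_edges[OF that] unfolding eq[symmetric] by auto
    have "d = p \<or> d = q" using at_most_two_triangles[OF t' s t(3)] by blast
    then show ?thesis
      using third[OF t'(1)] third[OF t'(2)] t(3) nd e abd R_across[OF t' t(3)]
      by (auto simp: wall_def)
  qed
  show ?thesis
  proof (cases "{a, b} = {u, v} \<or> {b, d} = {u, v} \<or> {d, a} = {u, v}")
    case True
    have rot: "{b, d, a} = {a, b, d}" "{d, a, b} = {a, b, d}" by auto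
    from True show ?thesis
    proof (elim disjE)
      assume "{a, b} = {u, v}"
      then show ?thesis by (rule main[OF abd])
    next
      assume "{b, d} = {u, v}"
      from main[OF R_rotate[OF abd] this] show ?thesis unfolding rot by linarith
    next
      assume "{d, a} = {u, v}"
      from main[OF R_rotate[OF R_rotate[OF abd]] this] show ?thesis unfolding rot by linarith
    qed
  next
    case False
    have uv: "u \<noteq> v" using triangle_edges[OF t(1)] by simp
    have "\<not> {u, v} \<subseteq> {a, b, d}" using False uv by blast
    then have "{a, b, d} \<noteq> {u, v, x}" for x by blast
    then show ?thesis using False by (simp add: wall_def)
  qed
qed

text \<open>All triangles represent the same class in the second cohomology: walk through adjacent
  triangles and subtract the wall of each crossed edge.\<close>

lemma cochain_from_triangle:
  assumes t0: "{a0, b0, d0} \<in> triangles K" and t: "{u, v, w} \<in> triangles K"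
  shows "\<exists>y :: 'v \<Rightarrow> 'v \<Rightarrow> int. (\<forall>a b. y b a = - y a b) \<and> (\<forall>a b d. (a, b, d) \<in> R \<longrightarrow>
    y a b + y b d + y d a = of_bool ({a, b, d} = {u, v, w}) - of_bool ({a, b, d} = {a0, b0, d0}))"
    (is "?A u v w")
proof (rule triangle_induct[OF t0, of ?A])
  show "?A a0 b0 d0" by (rule exI[of _ "\<lambda>a b. 0"]) simp
  show "?A v w u \<and> ?A v u w" if "?A u v w" for u v w
  proof -
    have "{v, w, u} = {u, v, w}" "{v, u, w} = {u, v, w}" by auto
    then show ?thesis using that by simp
  qed
  show "?A u v y" if x: "{u, v, x} \<in> triangles K" and y: "{u, v, y} \<in> triangles K" and "?A u v x" for u v x y
  proof (cases "x = y")
    case False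
    obtain Y :: "'v \<Rightarrow> 'v \<Rightarrow> int" where Y: "\<forall>a b. Y b a = - Y a b" "\<forall>a b d. (a, b, d) \<in> R \<longrightarrow>
      Y a b + Y b d + Y d a = of_bool ({a, b, d} = {u, v, x}) - of_bool ({a, b, d} = {a0, b0, d0})"
      using \<open>?A u v x\<close> by (elim exE conjE)
    show ?thesis
    proof (intro exI[of _ "\<lambda>a b. Y a b - wall u v x a b"] conjI allI impI)
      show "Y b a - wall u v x b a = - (Y a b - wall u v x a b)" for a b
        using wall_antisym[OF x, of b a] Y(1)[rule_format, of b a] by linarith
      show "Y a b - wall u v x a b + (Y b d - wall u v x b d) + (Y d a - wall u v x d a)
        = of_bool ({a, b, d} = {u, v, y}) - of_bool ({a, b, d} = {a0, b0, d0})"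
        if abd: "(a, b, d) \<in> R" for a b d
        using wall_flux[OF x y False abd] Y(2)[rule_format, OF abd] by linarith
    qed
  qed (use that in simp)
qed (rule t)

text \<open>The cup product reads its second factor only on edges between the colors 2 and
  3.\<close>

lemma pairing_wall_zero:
  assumes "{u, v, p} \<in> triangles K" "c u = 1 \<or> c v = 1"
  shows "pairing \<alpha> (wall u v p) = 0"
  unfolding pairing_def
proof (rule sum.neutral, clarify)
  fix x y z assume "(x, y, z) \<in> chambers"
  then have "{y, z} \<noteq> {u, v}" using assms(2) by (auto simp: chambers_def doubleton_eq_iff)
  then show "sg x y z * (\<alpha> x y * wall u v p y z) = 0" by (simp add: wall_def)
qed

text \<open>Only the two triangles at the wall contribute, through their front edges from
  \<open>p\<close> and \<open>q\<close> to \<open>u\<close>; modulo 2 the signs disappear.\<close>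

lemma pairing_wall_even:
  assumes t: "{u, v, p} \<in> triangles K" "{u, v, q} \<in> triangles K" "p \<noteq> q" "c u = 2" "c v = 3"
  shows "even (pairing \<alpha> (wall u v p) - (\<alpha> p u + \<alpha> q u))"
proof -
  let ?g = "\<lambda>(x, y, z). sg x y z * (\<alpha> x y * wall u v p y z)"
  have cp: "c p = 1" "c q = 1"
    using triangle_colors[OF t(1)] triangle_colors[OF t(2)] t by auto
  have sub: "{(p, u, v), (q, u, v)} \<subseteq> chambers"
    using triangle_rotate[OF triangle_rotate[OF t(1)]] triangle_rotate[OF triangle_rotate[OF t(2)]]
      t(4,5) cp by (simp add: chambers_def)
  have "pairing \<alpha> (wall u v p) = sum ?g {(p, u, v), (q, u, v)}"
    unfolding pairing_def
  proof (rule sum.mono_neutral_right[OF chambers_finite sub], rule ballI)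
    fix i assume i: "i \<in> chambers - {(p, u, v), (q, u, v)}"
    obtain x y z where eq: "i = (x, y, z)" by (cases i)
    have xyz: "(x, y, z) \<in> chambers" "(x, y, z) \<notin> {(p, u, v), (q, u, v)}" using i eq by auto
    have "sg x y z * (\<alpha> x y * wall u v p y z) = 0"
    proof (cases "{y, z} = {u, v}")
      case True
      then have yz: "y = u" "z = v" using xyz(1) t(4,5) by (auto simp: chambers_def doubleton_eq_iff)
      then have "{u, v, x} \<in> triangles K" using xyz(1) by (simp add: chambers_def insert_commute)
      then have "x = p \<or> x = q" using at_most_two_triangles[OF t(1,2) _ t(3)] by blast
      then show ?thesis using xyz(2) yz by auto
    qed (simp add: wall_def)
    then show "?g i = 0" by (simp add: eq)
  qed
  then show ?thesis using t(3) by (auto simp: wall_def sg_def)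
qed

lemma edges_empty:
  assumes "triangles K = {}"
  shows "edges K = {}"
proof (rule equals0I)
  fix e assume e: "e \<in> edges K"
  then obtain u v where "e = {u, v}" by (auto simp: edges_def card_2_iff)
  then show False using edge_in_two_triangles[of u v] e assms by simp
qed

text \<open>A potential for \<open>\<alpha>\<close> modulo 2 is built from the function
  \<open>G\<close> on triangles. Closed combinations of the cochains \<open>Y t\<close> and walls
  are cocycles and pair evenly with \<open>\<alpha>\<close>, so crossing an edge changes
  \<open>G\<close> by the pairing with its wall, which the two preceding lemmas evaluate.\<close>

lemma pairing_nondegenerate:
  assumes \<alpha>: "cocycle K \<alpha>" and even: "\<And>\<beta>. cocycle K \<beta> \<Longrightarrow> even (pairing \<alpha> \<beta>)"
  shows "even_coboundary K \<alpha>"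
proof (cases "triangles K = {}")
  case True
  then show ?thesis using edges_empty by (simp add: even_coboundary_def)
next
  case False
  then obtain a0 b0 d0 where t0: "{a0, b0, d0} \<in> triangles K" by (metis triangle_exists ex_in_conv)
  define flux where "flux t y \<longleftrightarrow> (\<forall>a b. y b a = - y a b) \<and> (\<forall>a b d. (a, b, d) \<in> R \<longrightarrow>
    y a b + y b d + y d a = of_bool ({a, b, d} = t) - of_bool ({a, b, d} = {a0, b0, d0}))"
    for t and y :: "'v \<Rightarrow> 'v \<Rightarrow> int"
  define Y where "Y t = (SOME y. flux t y)" for t
  have Y: "flux {u, v, w} (Y {u, v, w})" if "{u, v, w} \<in> triangles K" for u v w
    unfolding Y_def using cochain_from_triangle[OF t0 that] unfolding flux_def[symmetric] by (rule someI_ex)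
  define G where "G t = pairing \<alpha> (Y t)" for t
  have step: "even (G {u, v, q} - G {u, v, p} + pairing \<alpha> (wall u v p))"
    if p: "{u, v, p} \<in> triangles K" and q: "{u, v, q} \<in> triangles K" and "p \<noteq> q" for u v p q
  proof -
    \<comment> \<open>The three coboundaries cancel, so \<open>Z\<close> is a cocycle and the
      evenness hypothesis applies to it.\<close>
    define Z where "Z = (\<lambda>a b. 1 * (1 * Y {u, v, q} a b + (-1) * Y {u, v, p} a b) + 1 * wall u v p a b)"
    have anti: "Z b a = - Z a b" for a b
    proof -
      have "Y {u, v, p} b a = - Y {u, v, p} a b" "Y {u, v, q} b a = - Y {u, v, q} a b"
        using Y[OF p] Y[OF q] unfolding flux_def by blast+
      then show ?thesis using wall_antisym[OF p, of b a] by (simp add: Z_def)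
    qed
    have flux: "Z a b + Z b d + Z d a = 0" if "(a, b, d) \<in> R" for a b d
    proof -
      have "Y {u, v, q} a b + Y {u, v, q} b d + Y {u, v, q} d a
          = of_bool ({a, b, d} = {u, v, q}) - of_bool ({a, b, d} = {a0, b0, d0})"
        "Y {u, v, p} a b + Y {u, v, p} b d + Y {u, v, p} d a
          = of_bool ({a, b, d} = {u, v, p}) - of_bool ({a, b, d} = {a0, b0, d0})"
        using Y[OF p] Y[OF q] that unfolding flux_def by blast+
      then show ?thesis using wall_flux[OF p q \<open>p \<noteq> q\<close> that]
        unfolding Z_def mult_1 mult_minus1 by linarith
    qed
    have "cocycle K Z"
      unfolding cocycle_def
    proof (intro allI impI)
      fix a b d assume "{a, b, d} \<in> triangles K"
      then have "(a, b, d) \<in> R \<or> (b, a, d) \<in> R" using R_swap by blast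
      then have "Z a b + Z b d + Z d a = 0 \<or> Z b a + Z a d + Z d b = 0" using flux by blast
      then show "Z a b + Z b d = Z a d" using anti[of a b] anti[of b d] anti[of a d] by linarith
    qed
    then have "even (pairing \<alpha> Z)" by (rule even)
    then show ?thesis unfolding Z_def pairing_combination G_def by simp
  qed
  define one where "one t = (THE x. x \<in> t \<and> c x = 1)" for t
  have one: "one t = x" if tx: "t \<in> triangles K" "x \<in> t" "c x = 1" for t x
  proof -
    obtain u v w where "t = {u, v, w}" "{u, v, w} \<in> triangles K" using tx(1) by (rule triangle_exists)
    then have "\<forall>y\<in>t. c y = 1 \<longrightarrow> y = x" using triangle_colors[of u v w] tx(2,3) by auto
    then have "y = x" if "y \<in> t \<and> c y = 1" for y using that by blast
    then show ?thesis unfolding one_def using tx(2,3) by (intro the_equality conjI)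
  qed
  \<comment> \<open>\<open>G\<close> changes as though it were the potential at the color 1 vertex
    of the triangle; adding \<open>\<alpha>\<close> from there to \<open>v\<close> gives a value at
    \<open>v\<close> that modulo 2 is the same for all triangles at \<open>v\<close>.\<close>
  define val where "val t v = G t + (if c v = 1 then 0 else \<alpha> (one t) v)" for t v
  have cross: "even (val {v, m, n'} v - val {v, m, n} v)"
    if n: "{v, m, n} \<in> triangles K" and n': "{v, m, n'} \<in> triangles K" for v m n n'
  proof (cases "n = n'")
    case False
    note st = step[OF n n' False]
    note n2 = triangle_swap[OF n] and n2' = triangle_swap[OF n']
    have sw: "{m, v, n} = {v, m, n}" "{m, v, n'} = {v, m, n'}" by auto
    note col = triangle_colors[OF n] triangle_colors[OF n']
    note w0 = pairing_wall_zero[OF n, of \<alpha>]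
    consider "c v = 1" | "c m = 1" "c v \<noteq> 1" | "c v = 2" "c m = 3" "c n = 1" "c n' = 1"
      | "c v = 3" "c m = 2" "c n = 1" "c n' = 1"
      using col by auto
    then show ?thesis
    proof cases
      case 1
      then show ?thesis using st w0 by (simp add: val_def)
    next
      case 2
      then have "one {v, m, n} = m" "one {v, m, n'} = m" using one[OF n] one[OF n'] by auto
      then show ?thesis using st w0 2 by (simp add: val_def)
    next
      case 3
      then have "one {v, m, n} = n" "one {v, m, n'} = n'" using one[OF n] one[OF n'] by auto
      then show ?thesis using st pairing_wall_even[OF n n' False 3(1,2), of \<alpha>] 3(1)
        by (simp add: val_def) presburger
    next
      \<comment> \<open>The wall formula takes the color 2 end first, here \<open>m\<close>; moving
        on to \<open>v\<close> adds \<open>\<alpha> m v\<close> on both sides, which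
        cancels.\<close>
      case 4
      then have "one {v, m, n} = n" "one {v, m, n'} = n'" using one[OF n] one[OF n'] by auto
      moreover have "\<alpha> n m + \<alpha> m v = \<alpha> n v" "\<alpha> n' m + \<alpha> m v = \<alpha> n' v"
        using n n' by (auto intro!: cocycleD[OF \<alpha>] simp: insert_commute)
      moreover have "even (G {v, m, n'} - G {v, m, n} + pairing \<alpha> (wall m v n))"
        using step[OF n2 n2' False] unfolding sw .
      ultimately show ?thesis using pairing_wall_even[OF n2 n2' False 4(2,1), of \<alpha>] 4(1)
        by (simp add: val_def) presburger
    qed
  qed simp
  have all: "even (val {v, m, n} v - val {v, p, q} v)"
    if vmn: "{v, m, n} \<in> triangles K" and vpq: "{v, p, q} \<in> triangles K" for v m n p q
  proof -
    define B where "B = {m. \<forall>n. {v, m, n} \<in> triangles K \<longrightarrow> even (val {v, m, n} v - val {v, p, q} v)}"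
    have "m \<in> B"
    proof (rule link_connected)
      show "{v, p} \<in> edges K" "{v, m} \<in> edges K" using triangle_all_edges[OF vpq] triangle_all_edges[OF vmn] by auto
      show "p \<in> B" using cross[OF vpq] by (simp add: B_def)
      show "y \<in> B" if t: "{v, x, y} \<in> triangles K" "x \<in> B" for x y
      proof -
        have t': "{v, y, x} \<in> triangles K" and e: "{v, y, x} = {v, x, y}" using t(1) by (auto simp: insert_commute)
        have "even (val {v, y, x} v - val {v, p, q} v)" using t unfolding e by (simp add: B_def)
        then have "even (val {v, y, n} v - val {v, p, q} v)" if "{v, y, n} \<in> triangles K" for n
          using cross[OF t' that] by presburger
        then show ?thesis by (simp add: B_def)
      qed
    qed
    then show ?thesis using vmn by (simp add: B_def)
  qed
  define \<phi> where "\<phi> v = (SOME k. \<exists>p q. k = val {v, p, q} v \<and> {v, p, q} \<in> triangles K)" for v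
  have \<phi>: "even (val {v, m, n} v - \<phi> v)" if "{v, m, n} \<in> triangles K" for v m n
  proof -
    have "\<exists>p q. \<phi> v = val {v, p, q} v \<and> {v, p, q} \<in> triangles K"
      unfolding \<phi>_def by (rule someI_ex) (use that in blast)
    then show ?thesis using all[OF that] by metis
  qed
  have "even (\<alpha> u v - (\<phi> v - \<phi> u))" if e: "{u, v} \<in> edges K" for u v
  proof -
    obtain w where t: "{u, v, w} \<in> triangles K" using edge_in_two_triangles[OF e] by blast
    have sw: "{v, u, w} = {u, v, w}" by auto
    have "even (val {u, v, w} u - \<phi> u)" "even (val {u, v, w} v - \<phi> v)"
      using \<phi>[OF t] \<phi>[OF triangle_swap[OF t]] unfolding sw by auto
    moreover have "val {u, v, w} v - val {u, v, w} u = \<alpha> u v"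
    proof -
      consider "c u = 1" "c v \<noteq> 1" | "c v = 1" "c u \<noteq> 1" | "c w = 1" "c u \<noteq> 1" "c v \<noteq> 1"
        using triangle_colors[OF t] by auto
      then show ?thesis
      proof cases
        case 1
        then have "one {u, v, w} = u" by (intro one[OF t]) auto
        then show ?thesis using 1 by (simp add: val_def)
      next
        case 2
        then have "one {u, v, w} = v" by (intro one[OF t]) auto
        then show ?thesis using 2 cocycle_antisym[OF \<alpha> e] by (simp add: val_def)
      next
        case 3
        then have "one {u, v, w} = w" by (intro one[OF t]) auto
        moreover have "\<alpha> w u + \<alpha> u v = \<alpha> w v"
          using t by (auto intro!: cocycleD[OF \<alpha>] simp: insert_commute)
        ultimately show ?thesis using 3 by (simp add: val_def)
      qed
    qed
    ultimately show ?thesis by presburger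
  qed
  then show ?thesis unfolding even_coboundary_def by blast
qed

text \<open>If \<open>\<alpha>\<close> and \<open>\<beta>\<close> are independent modulo 2, the
  dimension bound puts every \<open>\<gamma>\<close> in their span modulo coboundaries. Then
  \<open>\<alpha>\<close> pairs evenly with every cocycle, against nondegeneracy.\<close>

lemma even_pairing_imp_dependent:
  assumes \<alpha>: "cocycle K \<alpha>" and \<beta>: "cocycle K \<beta>" and even: "even (pairing \<alpha> \<beta>)"
  shows "even_coboundary K \<alpha> \<or> even_coboundary K \<beta> \<or> even_coboundary K (\<lambda>u v. \<alpha> u v + \<beta> u v)"
proof (rule ccontr)
  assume not: "\<not> ?thesis"
  have "even (pairing \<alpha> \<gamma>)" if \<gamma>: "cocycle K \<gamma>" for \<gamma>
  proof -
    obtain a b d :: int where abd: "a \<in> {0, 1}" "b \<in> {0, 1}" "d \<in> {0, 1}" "(a, b, d) \<noteq> (0, 0, 0)"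
      "even_coboundary K (\<lambda>u v. a * \<alpha> u v + b * \<beta> u v + d * \<gamma> u v)" (is "even_coboundary K ?\<theta>")
      by (rule three_cocycles_dependent[OF \<alpha> \<beta> \<gamma>])
    have d: "d = 1"
    proof (rule ccontr)
      assume "d \<noteq> 1"
      then have "d = 0" using abd(3) by simp
      then show False using abd not by auto
    qed
    have th: "?\<theta> = (\<lambda>u v. 1 * (a * \<alpha> u v + b * \<beta> u v) + 1 * \<gamma> u v)" using d by simp
    have \<theta>: "cocycle K ?\<theta>" unfolding th by (intro cocycle_combination \<alpha> \<beta> \<gamma>)
    have "even (pairing \<alpha> ?\<theta>)" by (rule pairing_even_coboundary[OF \<alpha> \<theta> abd(5)])
    moreover have "pairing \<alpha> ?\<theta> = b * pairing \<alpha> \<beta> + pairing \<alpha> \<gamma>"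
      unfolding th pairing_combination using pairing_self[OF \<alpha>] by simp
    ultimately show ?thesis using even by simp
  qed
  then show False using pairing_nondegenerate[OF \<alpha>] not by blast
qed

section \<open>Heights of a 4-coloring\<close>

text \<open>A 4-coloring is encoded by two bits \<open>A\<close>, \<open>B\<close> per vertex. The pair \<open>(A, B)\<close> of a 4-coloring
  and the 3-coloring \<open>c\<close> develop \<open>K\<close> into the triangular lattice: along an edge the lattice vector is
  \<open>\<plusminus>(1, 0)\<close>, \<open>\<plusminus>(0, 1)\<close> or \<open>\<plusminus>(-1, -1)\<close> according to the difference of the bits, with the sign given
  by \<open>c\<close>. Its two coordinates are \<open>height A B\<close> and \<open>height B A\<close>.\<close>

definition step_sign :: "'v \<Rightarrow> 'v \<Rightarrow> int" where
  "step_sign u v = (if (c u, c v) \<in> {(1, 2), (2, 3), (3, 1)} then 1 else -1)"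

definition height :: "('v \<Rightarrow> bool) \<Rightarrow> ('v \<Rightarrow> bool) \<Rightarrow> 'v \<Rightarrow> 'v \<Rightarrow> int" where
  "height A B u v = step_sign u v * (if A u = A v then 0 else if B u = B v then 1 else -1)"

definition proper :: "('v \<Rightarrow> bool) \<Rightarrow> ('v \<Rightarrow> bool) \<Rightarrow> bool" where
  "proper A B \<longleftrightarrow> (\<forall>u v. {u, v} \<in> edges K \<longrightarrow> A u \<noteq> A v \<or> B u \<noteq> B v)"

abbreviation xor_bit :: "('v \<Rightarrow> bool) \<Rightarrow> ('v \<Rightarrow> bool) \<Rightarrow> 'v \<Rightarrow> bool" where
  "xor_bit A B \<equiv> \<lambda>v. A v \<noteq> B v"

lemma properD: "proper A B \<Longrightarrow> {u, v} \<in> edges K \<Longrightarrow> A u \<noteq> A v \<or> B u \<noteq> B v"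
  by (simp add: proper_def)

lemma proper_swap: "proper A B \<Longrightarrow> proper B A"
  by (auto simp: proper_def)

lemma proper_xor: "proper A B \<Longrightarrow> proper A (xor_bit A B)"
  by (auto simp: proper_def)

lemma step_sign_cases: "step_sign u v = 1 \<or> step_sign u v = -1"
  by (simp add: step_sign_def)

lemma step_sign_triangle:
  assumes "{u, v, w} \<in> triangles K"
  shows "step_sign v w = step_sign u v" "step_sign u w = - step_sign u v" "step_sign v u = - step_sign u v"
  using triangle_colors[OF assms] by (auto simp: step_sign_def)

lemma step_sign_across:
  assumes "{u, v, x} \<in> triangles K" "{u, v, y} \<in> triangles K"
  shows "step_sign u x = step_sign u y"
  using apex_color[OF assms] by (simp add: step_sign_def)

lemma proper_triangle:
  assumes "proper A B" "{u, v, w} \<in> triangles K"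
  shows "A u \<noteq> A v \<or> B u \<noteq> B v" "A v \<noteq> A w \<or> B v \<noteq> B w" "A u \<noteq> A w \<or> B u \<noteq> B w"
  using properD[OF assms(1)] triangle_all_edges[OF assms(2)] by blast+

text \<open>Around a triangle the step signs agree and the differences of the bits are the three
  nonzero ones, so the three lattice vectors with sum zero occur once each.\<close>

lemma height_cocycle:
  assumes "proper A B"
  shows "cocycle K (height A B)"
  unfolding cocycle_def
proof (intro allI impI)
  fix u v w assume t: "{u, v, w} \<in> triangles K"
  show "height A B u v + height A B v w = height A B u w"
    using proper_triangle[OF assms t] unfolding height_def step_sign_triangle[OF t]
    by (cases "A u"; cases "A v"; cases "A w"; cases "B u"; cases "B v"; cases "B w") simp_all
qed

lemma height_parity: "even (height A B u v - (of_bool (A v) - of_bool (A u)))"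
  using step_sign_cases[of u v] by (auto simp: height_def)

text \<open>The lattice vectors (1, 0), (0, 1) and (-1, -1) all have coordinate sum 1 modulo 3, so
  only the step sign survives, and it is the difference of \<open>c\<close> modulo 3.\<close>

lemma height_sum_mod_3:
  assumes "proper A B" and e: "{u, v} \<in> edges K"
  shows "3 dvd height A B u v + height B A u v - (int (c v) - int (c u))"
proof -
  have c: "c u \<in> {1, 2, 3}" "c v \<in> {1, 2, 3}" "c u \<noteq> c v"
    using c_edge[OF e] edge_vertices[OF e] c_range by auto
  then have s: "3 dvd step_sign u v - (int (c v) - int (c u))" by (auto simp: step_sign_def)
  have "height A B u v + height B A u v \<in> {step_sign u v, -2 * step_sign u v}"
    using properD[OF assms] by (auto simp: height_def)
  then show ?thesis using s by (elim insertE) (presburger+, simp)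
qed

text \<open>Using the sum of the bits in place of \<open>B\<close> is a linear change of lattice
  coordinates; it gives access to the third lattice direction.\<close>

lemma height_xor:
  assumes "proper A B" "{u, v} \<in> edges K"
  shows "height (xor_bit A B) A u v = height B A u v - height A B u v"
    "height A (xor_bit A B) u v = - height A B u v"
  using properD[OF assms] by (auto simp: height_def)

text \<open>The signed area of the development in units of the lattice parallelogram, that is, half
  the signed number of triangles. Four triangles cover the tetrahedron once, so this is twice the
  degree up to sign.\<close>

definition degree_pairing :: "('v \<Rightarrow> bool) \<Rightarrow> ('v \<Rightarrow> bool) \<Rightarrow> int" where
  "degree_pairing A B = pairing (height A B) (height B A)"

lemma degree_pairing_swap: "proper A B \<Longrightarrow> degree_pairing B A = - degree_pairing A B"
  unfolding degree_pairing_def by (rule pairing_antisym[OF height_cocycle height_cocycle[OF proper_swap]])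

lemma degree_pairing_xor:
  assumes AB: "proper A B"
  shows "degree_pairing A (xor_bit A B) = - degree_pairing A B"
proof -
  have 1: "height A (xor_bit A B) u v = (-1) * height A B u v + 0 * height A B u v"
    if "{u, v} \<in> edges K" for u v
    using height_xor(2)[OF AB that] by linarith
  have 2: "height (xor_bit A B) A u v = 1 * height B A u v + (-1) * height A B u v"
    if "{u, v} \<in> edges K" for u v
    using height_xor(1)[OF AB that] by linarith
  have "degree_pairing A (xor_bit A B) = pairing (\<lambda>u v. (-1) * height A B u v + 0 * height A B u v)
      (\<lambda>u v. 1 * height B A u v + (-1) * height A B u v)"
    unfolding degree_pairing_def by (rule pairing_cong[OF 1 2])
  also have "\<dots> = - degree_pairing A B"
    unfolding pairing_combination degree_pairing_def using pairing_self[OF height_cocycle[OF AB]] by simp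
  finally show ?thesis .
qed

lemma half_heights:
  assumes AB: "proper A B"
  obtains \<mu> \<nu> where "cocycle K \<mu>" "cocycle K \<nu>" "degree_pairing A B = 4 * pairing \<mu> \<nu>"
    "\<And>u v. {u, v} \<in> edges K \<Longrightarrow> height A B u v = of_bool (A v) - of_bool (A u) + 2 * \<mu> u v"
    "\<And>u v. {u, v} \<in> edges K \<Longrightarrow> height B A u v = of_bool (B v) - of_bool (B u) + 2 * \<nu> u v"
proof (rule cocycle_mod_coboundary[OF height_cocycle[OF AB] _ height_parity])
  fix \<mu> assume \<mu>: "cocycle K \<mu>" "\<And>\<gamma>. cocycle K \<gamma> \<Longrightarrow> pairing (height A B) \<gamma> = 2 * pairing \<mu> \<gamma>"
    "\<And>u v. {u, v} \<in> edges K \<Longrightarrow> height A B u v = of_bool (A v) - of_bool (A u) + 2 * \<mu> u v"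
  note BA = height_cocycle[OF proper_swap[OF AB]]
  show thesis
  proof (rule cocycle_mod_coboundary[OF BA _ height_parity])
    fix \<nu> assume \<nu>: "cocycle K \<nu>" "\<And>\<gamma>. cocycle K \<gamma> \<Longrightarrow> pairing \<gamma> (height B A) = 2 * pairing \<gamma> \<nu>"
      "\<And>u v. {u, v} \<in> edges K \<Longrightarrow> height B A u v = of_bool (B v) - of_bool (B u) + 2 * \<nu> u v"
    have "degree_pairing A B = 4 * pairing \<mu> \<nu>"
      using \<mu>(2)[OF BA] \<nu>(2)[OF \<mu>(1)] by (simp add: degree_pairing_def)
    then show thesis by (rule that[OF \<mu>(1) \<nu>(1) _ \<mu>(3) \<nu>(3)])
  qed simp
qed simp

text \<open>The factor 4 comes from halving both heights. For the factor 3, the second height may be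
  replaced by the sum of both because the pairing is alternating, and the sum is a coboundary modulo
  3.\<close>

lemma degree_pairing_dvd:
  assumes AB: "proper A B"
  shows "12 dvd degree_pairing A B"
proof -
  note h = height_cocycle[OF AB] and h' = height_cocycle[OF proper_swap[OF AB]]
  let ?s = "\<lambda>u v. 1 * height A B u v + 1 * height B A u v"
  have s: "cocycle K ?s" by (intro cocycle_combination h h')
  have "pairing (height A B) ?s = degree_pairing A B"
    unfolding pairing_combination degree_pairing_def using pairing_self[OF h] by simp
  moreover have "3 dvd pairing (height A B) ?s"
  proof (rule cocycle_mod_coboundary[OF s, of 3 "\<lambda>v. int (c v)"])
    show "3 dvd 1 * height A B u v + 1 * height B A u v - (int (c v) - int (c u))"
      if "{u, v} \<in> edges K" for u v
      using height_sum_mod_3[OF AB that] by simp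
    fix \<mu> assume "\<And>\<gamma>. cocycle K \<gamma> \<Longrightarrow> pairing \<gamma> ?s = 3 * pairing \<gamma> \<mu>"
    from this[OF h] show ?thesis by simp
  qed simp
  moreover have "4 dvd degree_pairing A B"
    by (rule half_heights[OF AB]) simp
  ultimately show ?thesis by presburger
qed

text \<open>Write h, h' for the two heights and \<open>\<beta>\<close> for the part of h' on edges
  leaving \<open>X\<close>. The flip turns them into h - \<open>\<beta>\<close> and h' -
  2\<open>\<beta>\<close>, so the pairing changes by -2 times that of h with \<open>\<beta>\<close>,
  minus that of \<open>\<beta>\<close> with h'. The latter vanishes. In the former,
  \<open>\<beta>\<close> is modulo 2 the coboundary of the indicator of \<open>X\<close>, and h is a
  coboundary plus 2\<open>\<mu>\<close>, so it is divisible by 4.\<close>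

lemma flip_degree_pairing:
  assumes AB: "proper A B"
    and X: "\<And>u v. {u, v} \<in> edges K \<Longrightarrow> B u = B v \<Longrightarrow> u \<in> X \<longleftrightarrow> v \<in> X"
  shows "8 dvd degree_pairing (\<lambda>v. A v \<noteq> (v \<in> X)) B - degree_pairing A B"
proof -
  let ?A = "\<lambda>v. A v \<noteq> (v \<in> X)"
  define \<beta> where "\<beta> u v = (if (u \<in> X) = (v \<in> X) then 0 else height B A u v)" for u v
  note h = height_cocycle[OF AB] and h' = height_cocycle[OF proper_swap[OF AB]]
  have \<beta>: "cocycle K \<beta>"
    unfolding cocycle_def
  proof (intro allI impI)
    fix u v w assume t: "{u, v, w} \<in> triangles K"
    note e = triangle_all_edges[OF t]
    have z: "height B A x y = 0" if "B x = B y" for x y using that by (simp add: height_def)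
    show "\<beta> u v + \<beta> v w = \<beta> u w"
      using cocycleD[OF h' t] X[OF e(1)] X[OF e(2)] X[OF e(3)] z[of u v] z[of v w] z[of u w]
      by (cases "B u"; cases "B v"; cases "B w") (auto simp: \<beta>_def)
  qed
  have four: "4 dvd pairing (height A B) \<beta>"
  proof (rule cocycle_mod_coboundary[OF h _ height_parity])
    fix \<mu> assume \<mu>: "cocycle K \<mu>" "\<And>\<gamma>. cocycle K \<gamma> \<Longrightarrow> pairing (height A B) \<gamma> = 2 * pairing \<mu> \<gamma>"
    have "even (\<beta> u v - (of_bool (v \<in> X) - of_bool (u \<in> X)))" if e: "{u, v} \<in> edges K" for u v
      using X[OF e] step_sign_cases[of u v] by (auto simp: \<beta>_def height_def)
    then have "even_coboundary K \<beta>" unfolding even_coboundary_def by (intro exI[of _ "\<lambda>v. of_bool (v \<in> X)"]) simp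
    then have "even (pairing \<mu> \<beta>)" by (rule pairing_even_coboundary[OF \<mu>(1) \<beta>])
    then show ?thesis using \<mu>(2)[OF \<beta>] by presburger
  qed simp
  have "height ?A B u v = height A B u v - \<beta> u v" "height B ?A u v = height B A u v - 2 * \<beta> u v"
    if e: "{u, v} \<in> edges K" for u v
    using X[OF e] properD[OF AB e] by (auto simp: \<beta>_def height_def)
  then have "degree_pairing ?A B = pairing (\<lambda>u v. 1 * height A B u v + (-1) * \<beta> u v)
      (\<lambda>u v. 1 * height B A u v + (-2) * \<beta> u v)"
    unfolding degree_pairing_def by (intro pairing_cong) simp_all
  also have "\<dots> = degree_pairing A B - 2 * pairing (height A B) \<beta> - pairing \<beta> (height B A)"
    unfolding pairing_combination degree_pairing_def using pairing_self[OF \<beta>] by simp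
  also have "pairing \<beta> (height B A) = 0"
  proof -
    \<comment> \<open>This vanishes triangle by triangle: if \<open>X\<close> changes along xy but
      not along yz while \<open>B\<close> changes along both, then \<open>B x = B z\<close> although
      \<open>X\<close> separates x from z.\<close>
    have "pairing \<beta> (\<lambda>u v. 1 * height B A u v + (-1) * \<beta> u v) = 0"
      unfolding pairing_def
    proof (rule sum.neutral, clarify)
      fix x y z assume "(x, y, z) \<in> chambers"
      note e = chamber_edges[OF this]
      show "sg x y z * (\<beta> x y * (1 * height B A y z + (-1) * \<beta> y z)) = 0"
        using X[OF e(1)] X[OF e(2)] X[OF e(3)]
        by (cases "B x"; cases "B y"; cases "B z") (auto simp: \<beta>_def height_def)
    qed
    then show ?thesis unfolding pairing_combination using pairing_self[OF \<beta>] by simp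
  qed
  finally show ?thesis using four by presburger
qed

end

section \<open>The degree\<close>

lemma tetrahedron_triangles:
  "triangles tetrahedron_boundary = {{1, 2, 3}, {1, 2, 4}, {1, 3, 4}, {2, 3, 4}}"
proof -
  have "t \<in> {{1, 2, 3}, {1, 2, 4}, {1, 3, 4}, {2, 3, 4}}" if "t \<in> triangles tetrahedron_boundary" for t
  proof -
    have t: "t \<subseteq> {1, 2, 3, 4}" "card t = 3"
      using that by (auto simp: triangles_def tetrahedron_boundary_def)
    then have "card ({1, 2, 3, 4} - t) = 1"
      using card_Diff_subset[of t "{1, 2, 3, 4}"] finite_subset[OF t(1)] by simp
    then obtain m where m: "{1, 2, 3, 4} - t = {m}" by (auto simp: card_1_singleton_iff)
    then have tm: "t = {1, 2, 3, 4} - {m}" and "m = 1 \<or> m = 2 \<or> m = 3 \<or> m = 4" using t(1) by blast+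
    moreover have "{1, 2, 3, 4} - {1} = {2, 3, 4 :: nat}" "{1, 2, 3, 4} - {2} = {1, 3, 4 :: nat}"
      "{1, 2, 3, 4} - {3} = {1, 2, 4 :: nat}" "{1, 2, 3, 4} - {4} = {1, 2, 3 :: nat}" by auto
    ultimately show ?thesis unfolding tm by (elim disjE) (simp_all only: insert_iff simp_thms)
  qed
  moreover have "t \<in> triangles tetrahedron_boundary" if "t \<in> {{1, 2, 3}, {1, 2, 4}, {1, 3, 4}, {2, 3, 4}}" for t
  proof -
    have "t \<subset> {1, 2, 3, 4}"
    proof
      show "t \<subseteq> {1, 2, 3, 4}" using that by blast
      have "\<not> {1, 2, 3, 4} \<subseteq> {a, b, d}" if "(a, b, d) \<in> {(1, 2, 3), (1, 2, 4), (1, 3, 4), (2, 3, 4 :: nat)}" for a b d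
        using that by (elim insertE emptyE) simp_all
      then show "t \<noteq> {1, 2, 3, 4}" using that by (elim insertE emptyE) blast+
    qed
    moreover have "card t = 3" "t \<noteq> {}" using that by (elim insertE emptyE; simp)+
    ultimately show ?thesis by (simp add: triangles_def tetrahedron_boundary_def)
  qed
  ultimately show ?thesis by blast
qed

text \<open>Orientation of the face \<open>{i, j, k}\<close>, as the determinant of the lattice vectors of the
  steps from \<open>i\<close> to \<open>j\<close> and from \<open>j\<close> to \<open>k\<close>.\<close>

definition bit_step :: "nat set \<Rightarrow> nat set \<Rightarrow> nat \<Rightarrow> nat \<Rightarrow> int" where
  "bit_step M N i j = (if (i \<in> M) = (j \<in> M) then 0 else if (i \<in> N) = (j \<in> N) then 1 else -1)"

definition face_sign :: "nat \<Rightarrow> nat \<Rightarrow> nat \<Rightarrow> int" where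
  "face_sign i j k = bit_step {1, 3} {2, 3} i j * bit_step {2, 3} {1, 3} j k
     - bit_step {2, 3} {1, 3} i j * bit_step {1, 3} {2, 3} j k"

lemma color_triple_cases:
  fixes i j k :: nat
  assumes "i \<in> {1..4}" "j \<in> {1..4}" "k \<in> {1..4}" "i \<noteq> j" "j \<noteq> k" "i \<noteq> k"
  shows "(i, j, k) \<in> {(1,2,3),(2,3,1),(3,1,2),(2,1,3),(1,3,2),(3,2,1),
    (1,2,4),(2,4,1),(4,1,2),(2,1,4),(1,4,2),(4,2,1),
    (1,3,4),(3,4,1),(4,1,3),(3,1,4),(1,4,3),(4,3,1),
    (2,3,4),(3,4,2),(4,2,3),(3,2,4),(2,4,3),(4,3,2)}"
proof -
  have "i \<in> {1,2,3,4}" "j \<in> {1,2,3,4}" "k \<in> {1,2,3,4}" using assms(1-3) by auto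
  then show ?thesis using assms(4-6) by (elim insertE emptyE) simp_all
qed

text \<open>The orientation spreads from the face 123 across its edges to the other three faces, so
  a single sign decides it.\<close>

lemma tetrahedron_orientation:
  assumes S: "surface_orientation tetrahedron_boundary S"
  obtains \<sigma> :: int where "\<sigma> \<in> {1, -1}"
    "\<And>i j k. i \<in> {1..4} \<Longrightarrow> j \<in> {1..4} \<Longrightarrow> k \<in> {1..4} \<Longrightarrow> i \<noteq> j \<Longrightarrow> j \<noteq> k \<Longrightarrow> i \<noteq> k \<Longrightarrow>
      (if (i, j, k) \<in> S then 1 else -1) = \<sigma> * face_sign i j k"
proof -
  have rot: "(i, j, k) \<in> S \<longleftrightarrow> (j, k, i) \<in> S" for i j k
    using S unfolding surface_orientation_def by blast
  have swap: "(i, j, k) \<in> S \<longleftrightarrow> (j, i, k) \<notin> S" if "{i, j, k} \<in> triangles tetrahedron_boundary" for i j k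
    using S that unfolding surface_orientation_def by blast
  have across: "(j, i, l) \<in> S" if "(i, j, k) \<in> S" "{i, j, l} \<in> triangles tetrahedron_boundary" "l \<noteq> k" for i j k l
    using S that unfolding surface_orientation_def by blast
  have tri: "{1, 2, 3} \<in> triangles tetrahedron_boundary" "{1, 2, 4} \<in> triangles tetrahedron_boundary"
    "{1, 3, 4} \<in> triangles tetrahedron_boundary" "{2, 3, 4} \<in> triangles tetrahedron_boundary"
    by (simp_all add: tetrahedron_triangles)
  have tri': "{2, 1, 3} \<in> triangles tetrahedron_boundary" "{2, 1, 4} \<in> triangles tetrahedron_boundary"
    "{3, 1, 4} \<in> triangles tetrahedron_boundary" "{3, 1, 2} \<in> triangles tetrahedron_boundary"
    "{1, 3, 2} \<in> triangles tetrahedron_boundary"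
    "{3, 2, 1} \<in> triangles tetrahedron_boundary" "{2, 3, 1} \<in> triangles tetrahedron_boundary"
    "{3, 2, 4} \<in> triangles tetrahedron_boundary"
    using tri by (simp_all add: insert_commute)
  have s: "(2, 1, 3) \<in> S \<longleftrightarrow> (1, 2, 3) \<notin> S" using swap[OF tri(1)] by blast
  have a: "(1, 2, 4) \<in> S \<longleftrightarrow> (1, 2, 3) \<notin> S"
    using across[of 1 2 3 4] across[of 2 1 3 4] tri tri' s swap[OF tri(2)] by auto
  have b: "(1, 3, 4) \<in> S \<longleftrightarrow> (1, 2, 3) \<in> S"
    using across[of 3 1 2 4] across[of 1 3 2 4] tri tri' s swap[OF tri(3)] rot[of 1 2 3] rot[of 2 3 1]
      rot[of 2 1 3] rot[of 1 3 2] by auto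
  have d: "(2, 3, 4) \<in> S \<longleftrightarrow> (1, 2, 3) \<notin> S"
    using across[of 2 3 1 4] across[of 3 2 1 4] tri tri' s swap[OF tri(4)] rot[of 1 2 3]
      rot[of 2 1 3] rot[of 1 3 2] by auto
  have s': "(2, 1, 4) \<in> S \<longleftrightarrow> (1, 2, 4) \<notin> S" "(3, 1, 4) \<in> S \<longleftrightarrow> (1, 3, 4) \<notin> S"
    "(3, 2, 4) \<in> S \<longleftrightarrow> (2, 3, 4) \<notin> S"
    using swap[OF tri(2)] swap[OF tri(3)] swap[OF tri(4)] by blast+
  define \<sigma> :: int where "\<sigma> = (if (1, 2, 3) \<in> S then 1 else -1)"
  show thesis
  proof (rule that)
    show "\<sigma> \<in> {1, -1}" by (simp add: \<sigma>_def)
    fix i j k :: nat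
    assume ijk: "i \<in> {1..4}" "j \<in> {1..4}" "k \<in> {1..4}" "i \<noteq> j" "j \<noteq> k" "i \<noteq> k"
    note r = rot[of 1 2 3] rot[of 2 3 1] rot[of 2 1 3] rot[of 1 3 2]
      rot[of 1 2 4] rot[of 2 4 1] rot[of 2 1 4] rot[of 1 4 2]
      rot[of 1 3 4] rot[of 3 4 1] rot[of 3 1 4] rot[of 1 4 3]
      rot[of 2 3 4] rot[of 3 4 2] rot[of 3 2 4] rot[of 2 4 3]
    show "(if (i, j, k) \<in> S then 1 else -1) = \<sigma> * face_sign i j k"
      using color_triple_cases[OF ijk]
      by (simp only: insert_iff empty_iff prod.inject simp_thms, elim disjE conjE)
         (simp_all add: r[symmetric] s a b d s' \<sigma>_def face_sign_def bit_step_def del: One_nat_def)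
  qed
qed

section \<open>The degree as a cup product\<close>

context three_colored_torus
begin

text \<open>The two bits encode the colors 4, 1, 2, 3 as (0, 0), (1, 0), (0, 1), (1, 1).\<close>

abbreviation color_degree :: "('v \<Rightarrow> nat) \<Rightarrow> int" where
  "color_degree f \<equiv> degree_pairing (\<lambda>v. f v \<in> {1, 3}) (\<lambda>v. f v \<in> {2, 3})"

lemma coloring_range: "f \<in> complex_colorings K q \<Longrightarrow> v \<in> vertices K \<Longrightarrow> f v \<in> {1..q}"
  by (auto simp: colorings_def PiE_def Pi_def)

lemma coloring_edge: "f \<in> complex_colorings K q \<Longrightarrow> {u, v} \<in> edges K \<Longrightarrow> f u \<noteq> f v"
  unfolding colorings_def by blast

lemma coloring_triangle:
  assumes "f \<in> complex_colorings K q" "{u, v, w} \<in> triangles K"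
  shows "f u \<in> {1..q}" "f v \<in> {1..q}" "f w \<in> {1..q}" "f u \<noteq> f v" "f v \<noteq> f w" "f u \<noteq> f w"
  using triangle_all_edges[OF assms(2)] edge_vertices coloring_range[OF assms(1)] coloring_edge[OF assms(1)]
  by metis+

lemma proper_bits:
  assumes f: "f \<in> complex_colorings K 4" and d: "distinct [p, q, r, t]" "{p, q, r, t} = {1..4}"
  shows "proper (\<lambda>v. f v \<in> {q, r}) (\<lambda>v. f v \<in> {r, t})"
  unfolding proper_def
proof (intro allI impI)
  fix u v assume e: "{u, v} \<in> edges K"
  have "f u \<in> {p, q, r, t}" "f v \<in> {p, q, r, t}" "f u \<noteq> f v"
    using coloring_range[OF f] coloring_edge[OF f e] edge_vertices[OF e] d(2) by auto
  moreover have "p \<noteq> q" "p \<noteq> r" "p \<noteq> t" "q \<noteq> r" "q \<noteq> t" "r \<noteq> t" using d(1) by auto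
  ultimately show "(f u \<in> {q, r}) \<noteq> (f v \<in> {q, r}) \<or> (f u \<in> {r, t}) \<noteq> (f v \<in> {r, t})"
    by (elim insertE emptyE) simp_all
qed

lemma four_colors: "{1..4 :: nat} = {1, 2, 3, 4}"
  by auto

lemma proper_standard:
  assumes f: "f \<in> complex_colorings K 4"
  shows "proper (\<lambda>v. f v \<in> {1, 3}) (\<lambda>v. f v \<in> {2, 3})"
proof -
  have "{4, 1, 3, 2} = {1..4 :: nat}" "{3, 2} = {2, 3 :: nat}" by auto
  then show ?thesis using proper_bits[OF f, of 4 1 3 2] by simp
qed

text \<open>In chamber order both steps have sign 1, so \<open>face_sign\<close> is the determinant
  of the two height vectors; by antisymmetry its two terms contribute equally.\<close>

lemma face_sum:
  assumes f: "f \<in> complex_colorings K 4"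
  shows "(\<Sum>(x, y, z)\<in>chambers. sg x y z * face_sign (f x) (f y) (f z)) = 2 * color_degree f"
proof -
  let ?A = "\<lambda>v. f v \<in> {1, 3}" and ?B = "\<lambda>v. f v \<in> {2, 3}"
  have AB: "proper ?A ?B" by (rule proper_standard[OF f])
  have "(\<Sum>(x, y, z)\<in>chambers. sg x y z * face_sign (f x) (f y) (f z))
      = pairing (height ?A ?B) (height ?B ?A) - pairing (height ?B ?A) (height ?A ?B)"
    unfolding pairing_def sum_subtractf[symmetric]
  proof (rule sum.cong, rule refl, clarify)
    fix x y z assume "(x, y, z) \<in> chambers"
    then have s: "step_sign x y = 1" "step_sign y z = 1" by (auto simp: chambers_def step_sign_def)
    show "sg x y z * face_sign (f x) (f y) (f z) = sg x y z * (height ?A ?B x y * height ?B ?A y z) -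
        sg x y z * (height ?B ?A x y * height ?A ?B y z)"
      by (simp only: face_sign_def bit_step_def height_def s mult_1 right_diff_distrib)
  qed
  also have "\<dots> = 2 * color_degree f"
    using pairing_antisym[OF height_cocycle[OF AB] height_cocycle[OF proper_swap[OF AB]]]
    by (simp add: degree_pairing_def)
  finally show ?thesis .
qed

definition face_degree :: "('v \<Rightarrow> nat) \<Rightarrow> nat set \<Rightarrow> int" where
  "face_degree f t = (\<Sum>(x, y, z)\<in>chambers. sg x y z * (face_sign (f x) (f y) (f z) * of_bool ({f x, f y, f z} = t)))"

text \<open>Count the edges with colors \<open>a\<close>, \<open>b\<close>, each with opposite signs from its two triangles.\<close>

lemma face_degree_eq:
  assumes f: "f \<in> complex_colorings K 4"
    and id: "\<And>i j k. i \<in> {1..4} \<Longrightarrow> j \<in> {1..4} \<Longrightarrow> k \<in> {1..4} \<Longrightarrow> i \<noteq> j \<Longrightarrow> j \<noteq> k \<Longrightarrow> i \<noteq> k \<Longrightarrow>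
      \<epsilon> * (\<kappa> i j + \<kappa> j k - \<kappa> i k) = face_sign i j k * of_bool ({i, j, k} = t) - face_sign i j k * of_bool ({i, j, k} = t')"
  shows "face_degree f t = face_degree f t'"
proof -
  have "face_degree f t - face_degree f t' = (\<Sum>(x, y, z)\<in>chambers. sg x y z * (\<epsilon> * \<kappa> (f x) (f y)) +
      sg x y z * (\<epsilon> * \<kappa> (f y) (f z)) - sg x y z * (\<epsilon> * \<kappa> (f x) (f z)))"
    unfolding face_degree_def sum_subtractf[symmetric]
  proof (rule sum.cong, rule refl, clarify)
    fix x y z assume "(x, y, z) \<in> chambers"
    then have t: "{x, y, z} \<in> triangles K" by (simp add: chambers_def)
    have "\<epsilon> * \<kappa> (f x) (f y) + \<epsilon> * \<kappa> (f y) (f z) - \<epsilon> * \<kappa> (f x) (f z)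
      = face_sign (f x) (f y) (f z) * of_bool ({f x, f y, f z} = t) - face_sign (f x) (f y) (f z) * of_bool ({f x, f y, f z} = t')"
      using id[OF coloring_triangle[OF f t]] by (simp add: algebra_simps)
    from arg_cong[OF this, of "\<lambda>k. sg x y z * k"]
    show "sg x y z * (face_sign (f x) (f y) (f z) * of_bool ({f x, f y, f z} = t)) -
        sg x y z * (face_sign (f x) (f y) (f z) * of_bool ({f x, f y, f z} = t')) =
       sg x y z * (\<epsilon> * \<kappa> (f x) (f y)) + sg x y z * (\<epsilon> * \<kappa> (f y) (f z)) - sg x y z * (\<epsilon> * \<kappa> (f x) (f z))"
      by (simp add: algebra_simps)
  qed
  also have "\<dots> = 0"
    using sum_edges(1)[of "\<lambda>x y. \<epsilon> * \<kappa> (f x) (f y)"] sum_edges(2)[of "\<lambda>x y. \<epsilon> * \<kappa> (f x) (f y)"]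
      sum_edges(3)[of "\<lambda>x y. \<epsilon> * \<kappa> (f x) (f y)"]
    by (simp add: case_prod_unfold sum_subtractf sum.distrib)
  finally show ?thesis by simp
qed

text \<open>A cochain on the tetrahedron whose coboundary is supported on the two faces at the edge
  \<open>{a, b}\<close>.\<close>

definition edge_sign :: "nat \<Rightarrow> nat \<Rightarrow> nat \<Rightarrow> nat \<Rightarrow> int" where
  "edge_sign a b i j = of_bool (i = a \<and> j = b) - of_bool (i = b \<and> j = a)"

lemma color_triple_set_eq:
  "({i, j, k :: nat} = {a, b, d}) \<longleftrightarrow> i \<in> {a, b, d} \<and> j \<in> {a, b, d} \<and> k \<in> {a, b, d} \<and>
     a \<in> {i, j, k} \<and> b \<in> {i, j, k} \<and> d \<in> {i, j, k}"
  by blast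

text \<open>Each other face shares an edge with 123, so all four signed counts agree. Their total is
  \<open>2 * color_degree f\<close> by \<open>face_sum\<close>, which makes each of them half of
  \<open>color_degree f\<close>.\<close>

lemma face_degrees:
  assumes f: "f \<in> complex_colorings K 4"
  shows "face_degree f {1, 2, 4} = face_degree f {1, 2, 3}" "face_degree f {1, 3, 4} = face_degree f {1, 2, 3}"
    "face_degree f {2, 3, 4} = face_degree f {1, 2, 3}" "2 * face_degree f {1, 2, 3} = color_degree f"
proof -
  have id: "- 1 * (edge_sign 1 2 i j + edge_sign 1 2 j k - edge_sign 1 2 i k) =
      face_sign i j k * of_bool ({i, j, k} = {1, 2, 4}) - face_sign i j k * of_bool ({i, j, k} = {1, 2, 3}) \<and>
    1 * (edge_sign 1 3 i j + edge_sign 1 3 j k - edge_sign 1 3 i k) =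
      face_sign i j k * of_bool ({i, j, k} = {1, 3, 4}) - face_sign i j k * of_bool ({i, j, k} = {1, 2, 3}) \<and>
    - 1 * (edge_sign 2 3 i j + edge_sign 2 3 j k - edge_sign 2 3 i k) =
      face_sign i j k * of_bool ({i, j, k} = {2, 3, 4}) - face_sign i j k * of_bool ({i, j, k} = {1, 2, 3}) \<and>
    of_bool ({i, j, k} = {1, 2, 3}) + of_bool ({i, j, k} = {1, 2, 4}) +
      of_bool ({i, j, k} = {1, 3, 4}) + of_bool ({i, j, k} = {2, 3, 4}) = (1 :: int)"
    if "i \<in> {1..4}" "j \<in> {1..4}" "k \<in> {1..4}" "i \<noteq> j" "j \<noteq> k" "i \<noteq> k" for i j k :: nat
    using color_triple_cases[OF that] unfolding color_triple_set_eq
    by (simp only: insert_iff empty_iff prod.inject simp_thms, elim disjE conjE)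
       (simp_all add: edge_sign_def face_sign_def bit_step_def)
  show 1: "face_degree f {1, 2, 4} = face_degree f {1, 2, 3}"
    by (rule face_degree_eq[OF f, of "-1" "edge_sign 1 2"]) (use id in blast)
  show 2: "face_degree f {1, 3, 4} = face_degree f {1, 2, 3}"
    by (rule face_degree_eq[OF f, of 1 "edge_sign 1 3"]) (use id in blast)
  show 3: "face_degree f {2, 3, 4} = face_degree f {1, 2, 3}"
    by (rule face_degree_eq[OF f, of "-1" "edge_sign 2 3"]) (use id in blast)
  have "face_degree f {1, 2, 3} + face_degree f {1, 2, 4} + face_degree f {1, 3, 4} + face_degree f {2, 3, 4}
    = (\<Sum>(x, y, z)\<in>chambers. sg x y z * face_sign (f x) (f y) (f z))"
    unfolding face_degree_def sum.distrib[symmetric]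
  proof (rule sum.cong, rule refl, clarify)
    fix x y z assume "(x, y, z) \<in> chambers"
    then have t: "{x, y, z} \<in> triangles K" by (simp add: chambers_def)
    let ?F = "face_sign (f x) (f y) (f z)" and ?t = "{f x, f y, f z}"
    have "?F * (of_bool (?t = {1, 2, 3}) + of_bool (?t = {1, 2, 4}) +
      of_bool (?t = {1, 3, 4}) + of_bool (?t = {2, 3, 4})) = ?F"
      using id[OF coloring_triangle[OF f t]] by simp
    then have "sg x y z * (?F * of_bool (?t = {1, 2, 3}) + ?F * of_bool (?t = {1, 2, 4}) +
      ?F * of_bool (?t = {1, 3, 4}) + ?F * of_bool (?t = {2, 3, 4})) = sg x y z * ?F"
      by (simp only: distrib_left)
    then show "sg x y z * (?F * of_bool (?t = {1, 2, 3})) + sg x y z * (?F * of_bool (?t = {1, 2, 4})) +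
       sg x y z * (?F * of_bool (?t = {1, 3, 4})) + sg x y z * (?F * of_bool (?t = {2, 3, 4})) = sg x y z * ?F"
      by (simp only: distrib_left)
  qed
  then show "2 * face_degree f {1, 2, 3} = color_degree f" using face_sum[OF f] 1 2 3 by linarith
qed

lemma orientation_of_permuted:
  assumes "{a, b, d} = {x, y, z}" "{x, y, z} \<in> triangles K" "{a, b, d} \<in> triangles K"
  shows "(a, b, d) \<in> {(x, y, z), (y, z, x), (z, x, y)} \<or> (a, b, d) \<in> {(y, x, z), (x, z, y), (z, y, x)}"
proof -
  have "a \<in> {x, y, z}" "b \<in> {x, y, z}" "d \<in> {x, y, z}" using assms(1) by blast+
  then show ?thesis
    using triangle_edges(2-)[OF assms(3)] by (elim insertE emptyE) simp_all
qed

text \<open>Every triangle is the vertex set of exactly one chamber, and it is preserved or reversed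
  according to the product \<open>ep\<close> of its signs in \<open>R\<close> and \<open>S\<close>.
  Hence the two counts differ by a sum over chambers, which is a face degree up to
  \<open>\<sigma>\<close>.\<close>

lemma map_degree_color_degree:
  assumes f: "f \<in> complex_colorings K 4" and S: "surface_orientation tetrahedron_boundary S"
  shows "2 * map_degree R S K f = color_degree f \<or> 2 * map_degree R S K f = - color_degree f"
proof -
  obtain \<sigma> :: int where \<sigma>: "\<sigma> \<in> {1, -1}" "\<And>i j k. i \<in> {1..4} \<Longrightarrow> j \<in> {1..4} \<Longrightarrow> k \<in> {1..4} \<Longrightarrow>
      i \<noteq> j \<Longrightarrow> j \<noteq> k \<Longrightarrow> i \<noteq> k \<Longrightarrow> (if (i, j, k) \<in> S then 1 else -1) = \<sigma> * face_sign i j k"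
    using tetrahedron_orientation[OF S] by blast
  have Srot: "(i, j, k) \<in> S \<longleftrightarrow> (j, k, i) \<in> S" for i j k
    using S unfolding surface_orientation_def by blast
  have Sswap: "(j, i, k) \<in> S \<longleftrightarrow> (i, j, k) \<notin> S"
    if "{i, j, k} \<in> triangles tetrahedron_boundary" for i j k
    using S that unfolding surface_orientation_def by blast
  have deg: "int (card (preserved_triangles R S K f t)) - int (card (reversed_triangles R S K f t))
      = \<sigma> * face_degree f t" if t: "t \<in> triangles tetrahedron_boundary" for t
  proof -
    define C where "C = {(x, y, z) \<in> chambers. {f x, f y, f z} = t}"
    define ep where "ep = (\<lambda>(x, y, z). sg x y z * (if (f x, f y, f z) \<in> S then 1 else -1 :: int))"
    define V where "V = (\<lambda>(x :: 'v, y, z). {x, y, z})"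
    have fin: "finite C" using chambers_finite by (auto simp: C_def intro: finite_subset)
    have inj: "inj_on V C"
    proof (rule inj_onI)
      fix p q assume "p \<in> C" "q \<in> C" "V p = V q"
      moreover obtain x y z x' y' z' where pq: "p = (x, y, z)" "q = (x', y', z')" by (cases p; cases q)
      ultimately have "{x, y, z} = {x', y', z'}" and col: "c x = 1" "c y = 2" "c z = 3"
          "c x' = 1" "c y' = 2" "c z' = 3"
        by (simp_all add: C_def chambers_def V_def)
      then have "x \<in> {x', y', z'}" "y \<in> {x', y', z'}" "z \<in> {x', y', z'}" by blast+
      then show "p = q" unfolding pq using col by (elim insertE emptyE) simp_all
    qed
    have onto: "\<exists>q\<in>C. s = V q" if s: "s \<in> triangles K" "f ` s = t" for s
    proof -
      obtain u v w where uvw: "s = {u, v, w}" "{u, v, w} \<in> triangles K" using s(1) by (rule triangle_exists)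
      have ch: "\<exists>q\<in>chambers. s = V q"
      proof -
        have perms: "{u, w, v} = {u, v, w}" "{v, u, w} = {u, v, w}" "{v, w, u} = {u, v, w}"
          "{w, u, v} = {u, v, w}" "{w, v, u} = {u, v, w}" by auto
        have "(u, v, w) \<in> chambers \<or> (u, w, v) \<in> chambers \<or> (v, u, w) \<in> chambers \<or>
            (v, w, u) \<in> chambers \<or> (w, u, v) \<in> chambers \<or> (w, v, u) \<in> chambers"
          using triangle_colors[OF uvw(2)] unfolding chambers_def mem_Collect_eq prod.case perms
          by (elim insertE emptyE) (simp_all add: uvw(2))
        moreover have "V (u, v, w) = s" "V (u, w, v) = s" "V (v, u, w) = s" "V (v, w, u) = s"
          "V (w, u, v) = s" "V (w, v, u) = s" unfolding V_def uvw(1) prod.case by blast+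
        ultimately show ?thesis by metis
      qed
      then obtain x y z where "(x, y, z) \<in> chambers" "s = {x, y, z}" by (auto simp: V_def)
      then show ?thesis using s(2) by (intro bexI[of _ "(x, y, z)"]) (auto simp: C_def V_def)
    qed
    \<comment> \<open>\<open>R\<close> and \<open>S\<close> are both invariant under rotation and
      reversed by swaps, so the chamber order of the triangle decides for all orders.\<close>
    have mem: "(V q \<in> preserved_triangles R S K f t \<longleftrightarrow> ep q = 1) \<and>
        (V q \<in> reversed_triangles R S K f t \<longleftrightarrow> ep q = -1)" if q: "q \<in> C" for q
    proof -
      obtain x y z where xyz: "q = (x, y, z)" by (cases q)
      have tri: "{x, y, z} \<in> triangles K" and img: "f ` {x, y, z} = t" "{f x, f y, f z} = t"
        using q by (auto simp: xyz C_def chambers_def)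
      have ft: "{f x, f y, f z} \<in> triangles tetrahedron_boundary" using t img by simp
      note Ro = R_rotate_iff[of y z x] R_rotate_iff[of z x y] R_swap[OF tri]
        R_rotate_iff[of x z y] R_rotate_iff[of z y x]
      note So = Srot[of "f x" "f y" "f z"] Srot[of "f y" "f z" "f x"] Sswap[OF ft]
        Srot[of "f y" "f x" "f z"] Srot[of "f x" "f z" "f y"]
      have "(\<exists>a b d. {x, y, z} = {a, b, d} \<and> (a, b, d) \<in> R \<and> (f a, f b, f d) \<in> S)
          \<longleftrightarrow> ((x, y, z) \<in> R \<longleftrightarrow> (f x, f y, f z) \<in> S)" (is "?L \<longleftrightarrow> ?M")
      proof
        assume ?L
        then obtain a b d where abd: "{x, y, z} = {a, b, d}" "(a, b, d) \<in> R" "(f a, f b, f d) \<in> S"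
          by blast
        show ?M
          using orientation_of_permuted[OF abd(1)[symmetric] tri R_triangle[OF abd(2)]] abd(2,3) Ro So by auto
      next
        assume ?M
        show ?L
        proof (cases "(x, y, z) \<in> R")
          case True
          then show ?thesis using \<open>?M\<close> by (intro exI[of _ x] exI[of _ y] exI[of _ z]) simp
        next
          case False
          then have "(y, x, z) \<in> R" "(f y, f x, f z) \<in> S" using Ro So \<open>?M\<close> by blast+
          then show ?thesis by (intro exI[of _ y] exI[of _ x] exI[of _ z]) (simp add: insert_commute)
        qed
      qed
      moreover have "(\<exists>a b d. {x, y, z} = {a, b, d} \<and> (a, b, d) \<in> R \<and> (f b, f a, f d) \<in> S)
          \<longleftrightarrow> ((x, y, z) \<in> R \<longleftrightarrow> (f x, f y, f z) \<notin> S)" (is "?L \<longleftrightarrow> ?M")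
      proof
        assume ?L
        then obtain a b d where abd: "{x, y, z} = {a, b, d}" "(a, b, d) \<in> R" "(f b, f a, f d) \<in> S"
          by blast
        show ?M
          using orientation_of_permuted[OF abd(1)[symmetric] tri R_triangle[OF abd(2)]] abd(2,3) Ro So by auto
      next
        assume ?M
        show ?L
        proof (cases "(x, y, z) \<in> R")
          case True
          then have "(f y, f x, f z) \<in> S" using So \<open>?M\<close> by blast
          then show ?thesis using True by (intro exI[of _ x] exI[of _ y] exI[of _ z]) simp
        next
          case False
          then have "(y, x, z) \<in> R" "(f x, f y, f z) \<in> S" using Ro So \<open>?M\<close> by blast+
          then show ?thesis by (intro exI[of _ y] exI[of _ x] exI[of _ z]) (simp add: insert_commute)
        qed
      qed
      moreover have "ep q = 1 \<longleftrightarrow> ((x, y, z) \<in> R \<longleftrightarrow> (f x, f y, f z) \<in> S)"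
        "ep q = -1 \<longleftrightarrow> ((x, y, z) \<in> R \<longleftrightarrow> (f x, f y, f z) \<notin> S)"
        by (auto simp: ep_def xyz sg_def)
      moreover have "V q = {x, y, z}" by (simp add: V_def xyz)
      ultimately show ?thesis
        using tri img(1) unfolding preserved_triangles_def reversed_triangles_def by simp
    qed
    have P: "preserved_triangles R S K f t = V ` {q \<in> C. ep q = 1}"
    proof
      show "preserved_triangles R S K f t \<subseteq> V ` {q \<in> C. ep q = 1}"
      proof
        fix s assume s: "s \<in> preserved_triangles R S K f t"
        then obtain q where "q \<in> C" "s = V q" using onto unfolding preserved_triangles_def by blast
        then show "s \<in> V ` {q \<in> C. ep q = 1}" using mem s by blast
      qed
    qed (use mem in blast)
    have N: "reversed_triangles R S K f t = V ` {q \<in> C. ep q = -1}"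
    proof
      show "reversed_triangles R S K f t \<subseteq> V ` {q \<in> C. ep q = -1}"
      proof
        fix s assume s: "s \<in> reversed_triangles R S K f t"
        then obtain q where "q \<in> C" "s = V q" using onto unfolding reversed_triangles_def by blast
        then show "s \<in> V ` {q \<in> C. ep q = -1}" using mem s by blast
      qed
    qed (use mem in blast)
    have cards: "card (preserved_triangles R S K f t) = card {q \<in> C. ep q = 1}"
      "card (reversed_triangles R S K f t) = card {q \<in> C. ep q = -1}"
      unfolding P N by (rule card_image, rule inj_on_subset[OF inj], blast)+
    have "sum ep C = (\<Sum>q\<in>C. of_bool (ep q = 1) - of_bool (ep q = -1))"
      by (rule sum.cong) (auto simp: ep_def sg_def split: if_splits)
    also have "\<dots> = int (card {q \<in> C. ep q = 1}) - int (card {q \<in> C. ep q = -1})"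
      using fin by (simp add: sum_subtractf of_bool_def sum.If_cases Int_def)
    finally have "int (card (preserved_triangles R S K f t)) - int (card (reversed_triangles R S K f t)) = sum ep C"
      unfolding cards by simp
    also have "sum ep C = (\<Sum>q\<in>chambers. if q \<in> C then ep q else 0)"
      using chambers_finite by (simp add: sum.If_cases C_def Int_def conj_commute) 
         (rule sum.cong, auto)
    also have "\<dots> = (\<Sum>(x, y, z)\<in>chambers. \<sigma> * (sg x y z * (face_sign (f x) (f y) (f z) * of_bool ({f x, f y, f z} = t))))"
    proof (rule sum.cong, rule refl, clarify)
      fix x y z assume xyz: "(x, y, z) \<in> chambers"
      then have tr: "{x, y, z} \<in> triangles K" by (simp add: chambers_def)
      show "(if (x, y, z) \<in> C then ep (x, y, z) else 0)
          = \<sigma> * (sg x y z * (face_sign (f x) (f y) (f z) * of_bool ({f x, f y, f z} = t)))"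
        using \<sigma>(2)[OF coloring_triangle[OF f tr]] xyz by (simp add: C_def ep_def)
    qed
    also have "\<dots> = \<sigma> * face_degree f t"
      by (simp add: face_degree_def sum_distrib_left case_prod_unfold)
    finally show ?thesis .
  qed
  have "map_degree R S K f = \<sigma> * face_degree f {1, 2, 3}"
    unfolding map_degree_def
  proof (rule the_equality)
    show "\<forall>t\<in>triangles tetrahedron_boundary. int (card (preserved_triangles R S K f t)) -
        int (card (reversed_triangles R S K f t)) = \<sigma> * face_degree f {1, 2, 3}"
      using deg face_degrees[OF f] by (simp add: tetrahedron_triangles)
    show "d = \<sigma> * face_degree f {1, 2, 3}"
      if "\<forall>t\<in>triangles tetrahedron_boundary. int (card (preserved_triangles R S K f t)) -
        int (card (reversed_triangles R S K f t)) = d" for d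
      using that deg[of "{1, 2, 3}"] by (simp add: tetrahedron_triangles)
  qed
  then show ?thesis using face_degrees(4)[OF f] \<sigma>(1) by auto
qed

end

section \<open>Kempe changes\<close>

definition swap_colors :: "nat \<Rightarrow> nat \<Rightarrow> 'v set \<Rightarrow> ('v \<Rightarrow> nat) \<Rightarrow> 'v \<Rightarrow> nat" where
  "swap_colors a b X f = (\<lambda>w. if w \<in> X then Transposition.transpose a b (f w) else f w)"

text \<open>These are the unions of Kempe components for \<open>a\<close> and \<open>b\<close>.
  Folds and transpositions of colors swap such unions at once.\<close>

definition kempe_closed :: "'v set set \<Rightarrow> ('v \<Rightarrow> nat) \<Rightarrow> nat \<Rightarrow> nat \<Rightarrow> 'v set \<Rightarrow> bool" where
  "kempe_closed E f a b X \<longleftrightarrow> (\<forall>v\<in>X. f v \<in> {a, b}) \<and>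
     (\<forall>u v. {u, v} \<in> E \<longrightarrow> f u \<in> {a, b} \<longrightarrow> f v \<in> {a, b} \<longrightarrow> u \<in> X \<longrightarrow> v \<in> X)"

lemma kempe_closedD:
  assumes "kempe_closed E f a b X"
  shows "v \<in> X \<Longrightarrow> f v \<in> {a, b}"
    "{u, v} \<in> E \<Longrightarrow> f u \<in> {a, b} \<Longrightarrow> f v \<in> {a, b} \<Longrightarrow> u \<in> X \<longleftrightarrow> v \<in> X"
proof -
  show "v \<in> X \<Longrightarrow> f v \<in> {a, b}" using assms unfolding kempe_closed_def by blast
  have step: "v \<in> X" if "{u, v} \<in> E" "f u \<in> {a, b}" "f v \<in> {a, b}" "u \<in> X" for u v
    using assms that unfolding kempe_closed_def by blast
  show "u \<in> X \<longleftrightarrow> v \<in> X" if "{u, v} \<in> E" "f u \<in> {a, b}" "f v \<in> {a, b}"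
    using step[OF that] step[of v u] that by (auto simp: insert_commute)
qed

lemma swap_colors_pair: "swap_colors a b X f w \<in> {a, b} \<longleftrightarrow> f w \<in> {a, b}"
  by (auto simp: swap_colors_def Transposition.transpose_def)

lemma swap_colors_swap_colors:
  "Y \<subseteq> X \<Longrightarrow> swap_colors a b (X - Y) (swap_colors a b Y f) = swap_colors a b X f"
  by (auto simp: swap_colors_def fun_eq_iff)

lemma swap_colors_self: "swap_colors a b X (swap_colors a b X f) = f"
  by (auto simp: swap_colors_def fun_eq_iff)

lemma swap_colors_coloring:
  assumes f: "f \<in> colorings V E q" and ab: "a \<in> {1..q}" "b \<in> {1..q}"
    and X: "kempe_closed E f a b X" "X \<subseteq> V"
  shows "swap_colors a b X f \<in> colorings V E q"
proof -
  have fV: "f \<in> V \<rightarrow>\<^sub>E {1..q}" and fE: "\<And>u v. {u, v} \<in> E \<Longrightarrow> f u \<noteq> f v"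
    using f by (auto simp: colorings_def)
  have "swap_colors a b X f u \<noteq> swap_colors a b X f v" if e: "{u, v} \<in> E" for u v
  proof (cases "f u \<in> {a, b} \<and> f v \<in> {a, b}")
    case True
    then show ?thesis using kempe_closedD(2)[OF X(1) e] fE[OF e] by (auto simp: swap_colors_def)
  next
    case False
    then show ?thesis
      using fE[OF e] swap_colors_pair[of a b X f u] swap_colors_pair[of a b X f v]
      by (auto simp: swap_colors_def Transposition.transpose_def split: if_splits)
  qed
  moreover have "swap_colors a b X f \<in> V \<rightarrow>\<^sub>E {1..q}"
    using fV ab X(2) by (auto simp: PiE_iff swap_colors_def Transposition.transpose_def extensional_def)
  ultimately show ?thesis by (simp add: colorings_def)
qed

lemma kempe_component_closed:
  assumes v: "f v \<in> {a, b}"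
  shows "kempe_closed E f a b (kempe_component E f a b v)" "v \<in> kempe_component E f a b v"
    "kempe_closed E f a b X \<Longrightarrow> v \<in> X \<Longrightarrow> kempe_component E f a b v \<subseteq> X"
proof -
  let ?r = "{(x, y). {x, y} \<in> E \<and> f x \<in> {a, b} \<and> f y \<in> {a, b}}"
  have mem: "f w \<in> {a, b}" if "(v, w) \<in> ?r\<^sup>*" for w
    using that by (induction rule: rtrancl_induct) (use v in auto)
  have step: "(v, y) \<in> ?r\<^sup>*" if "(v, x) \<in> ?r\<^sup>*" "{x, y} \<in> E" "f x \<in> {a, b}" "f y \<in> {a, b}" for x y
    using that(1) by (rule rtrancl_into_rtrancl) (use that in blast)
  show "kempe_closed E f a b (kempe_component E f a b v)"
    unfolding kempe_closed_def kempe_component_def mem_Collect_eq using mem step by blast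
  show "v \<in> kempe_component E f a b v" by (simp add: kempe_component_def)
  show "kempe_component E f a b v \<subseteq> X" if X: "kempe_closed E f a b X" "v \<in> X"
  proof
    fix w assume "w \<in> kempe_component E f a b v"
    then have "(v, w) \<in> ?r\<^sup>*" by (simp add: kempe_component_def)
    then show "w \<in> X"
    proof (induction rule: rtrancl_induct)
      case base
      show ?case by (rule X(2))
    next
      case (step y z)
      then show ?case using kempe_closedD(2)[OF X(1), of y z] by blast
    qed
  qed
qed

lemma kempe_component_subset:
  assumes "v \<in> V" "\<And>x y. {x, y} \<in> E \<Longrightarrow> y \<in> V"
  shows "kempe_component E f a b v \<subseteq> V"
proof
  fix w assume "w \<in> kempe_component E f a b v"
  then have "(v, w) \<in> {(x, y). {x, y} \<in> E \<and> f x \<in> {a, b} \<and> f y \<in> {a, b}}\<^sup>*"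
    by (simp add: kempe_component_def)
  then show "w \<in> V" by (induction rule: rtrancl_induct) (use assms in auto)
qed

lemma kempe_change_iff_swap_colors:
  "kempe_change V E q f g \<longleftrightarrow> (\<exists>a\<in>{1..q}. \<exists>b\<in>{1..q}. \<exists>v\<in>V. a \<noteq> b \<and> f v \<in> {a, b} \<and>
     g = swap_colors a b (kempe_component E f a b v) f)"
  by (simp add: kempe_change_def swap_colors_def)

lemma kempe_change_sym:
  assumes "kempe_change V E q f g"
  shows "kempe_change V E q g f"
proof -
  from assms obtain a b v where abv: "a \<in> {1..q}" "b \<in> {1..q}" "v \<in> V" "a \<noteq> b" "f v \<in> {a, b}"
    and g: "g = swap_colors a b (kempe_component E f a b v) f"
    unfolding kempe_change_iff_swap_colors by blast
  have pair: "g x \<in> {a, b} \<longleftrightarrow> f x \<in> {a, b}" for x unfolding g by (rule swap_colors_pair)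
  have "kempe_component E g a b v = kempe_component E f a b v"
    unfolding kempe_component_def pair by (rule refl)
  then have "f = swap_colors a b (kempe_component E g a b v) g" by (simp add: g swap_colors_self)
  then show ?thesis unfolding kempe_change_iff_swap_colors using abv pair by blast
qed

lemma color_permutation_sym:
  assumes f: "f \<in> colorings V E q" and "color_permutation V q f g"
  shows "color_permutation V q g f"
proof -
  obtain \<pi> where \<pi>: "\<pi> permutes {1..q}" "g = restrict (\<pi> \<circ> f) V"
    using assms(2) by (auto simp: color_permutation_def)
  have "f = restrict (inv \<pi> \<circ> g) V"
    using f by (auto simp: \<pi>(2) colorings_def PiE_iff extensional_def fun_eq_iff permutes_inverses[OF \<pi>(1)])
  then show ?thesis using permutes_inv[OF \<pi>(1)] by (auto simp: color_permutation_def)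
qed

lemma color_permutation_coloring:
  assumes f: "f \<in> colorings V E q" and g: "color_permutation V q f g"
    and E: "\<And>x y. {x, y} \<in> E \<Longrightarrow> x \<in> V \<and> y \<in> V"
  shows "g \<in> colorings V E q"
proof -
  obtain \<pi> where \<pi>: "\<pi> permutes {1..q}" "g = restrict (\<pi> \<circ> f) V"
    using g by (auto simp: color_permutation_def)
  have "\<pi> i \<in> {1..q}" if "i \<in> {1..q}" for i using permutes_in_image[OF \<pi>(1)] that by blast
  moreover have "\<pi> i \<noteq> \<pi> j" if "i \<noteq> j" for i j using permutes_inj[OF \<pi>(1)] that by (auto dest: injD)
  ultimately show ?thesis
    using f E unfolding colorings_def \<pi>(2) PiE_iff by (auto simp: extensional_def)
qed

text \<open>Swap one component at a time: the subgraph of colors \<open>a\<close> and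
  \<open>b\<close> does not change, so the rest of \<open>X\<close> is still a union of
  components.\<close>

lemma swap_colors_kempe_equivalent:
  assumes "finite X" "X \<subseteq> V" "kempe_closed E f a b X" "a \<in> {1..q}" "b \<in> {1..q}" "a \<noteq> b"
  shows "kempe_equivalent V E q f (swap_colors a b X f)"
  using assms(1-3)
proof (induction "card X" arbitrary: X f rule: less_induct)
  case less
  show ?case
  proof (cases "X = {}")
    case True
    then have "swap_colors a b X f = f" by (simp add: swap_colors_def)
    then show ?thesis by (simp add: kempe_equivalent_def)
  next
    case False
    then obtain v where v: "v \<in> X" by blast
    define C where "C = kempe_component E f a b v"
    define g where "g = swap_colors a b C f"
    have fv: "f v \<in> {a, b}" by (rule kempe_closedD(1)[OF less.prems(3) v])
    have C: "kempe_closed E f a b C" "v \<in> C" "C \<subseteq> X"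
      unfolding C_def using kempe_component_closed[of f v a b, OF fv] less.prems(3) v by blast+
    have "v \<in> V" using less.prems(2) v by blast
    then have "kempe_change V E q f g"
      unfolding kempe_change_iff_swap_colors g_def C_def using assms(4-6) fv by blast
    moreover have "kempe_equivalent V E q g (swap_colors a b (X - C) g)"
    proof (rule less.hyps)
      show "card (X - C) < card X" using less.prems(1) v C(2) by (intro psubset_card_mono) auto
      show "finite (X - C)" "X - C \<subseteq> V" using less.prems by auto
      have pair: "g x \<in> {a, b} \<longleftrightarrow> f x \<in> {a, b}" for x unfolding g_def by (rule swap_colors_pair)
      show "kempe_closed E g a b (X - C)"
        unfolding kempe_closed_def pair
        using kempe_closedD[OF less.prems(3)] kempe_closedD(2)[OF C(1)] by blast
    qed
    moreover have "swap_colors a b (X - C) g = swap_colors a b X f"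
      unfolding g_def by (rule swap_colors_swap_colors[OF C(3)])
    ultimately show ?thesis
      unfolding kempe_equivalent_def by (metis (no_types, lifting) converse_rtranclp_into_rtranclp)
  qed
qed

section \<open>Invariance of the degree modulo 12 under Kempe equivalence\<close>

context three_colored_torus
begin

abbreviation "V \<equiv> vertices K"
abbreviation "E \<equiv> edges K"

lemma degree_pairing_cong:
  assumes "\<And>u v. {u, v} \<in> E \<Longrightarrow> (A u = A v) = (A' u = A' v)"
    "\<And>u v. {u, v} \<in> E \<Longrightarrow> (B u = B v) = (B' u = B' v)"
  shows "degree_pairing A B = degree_pairing A' B'"
  unfolding degree_pairing_def by (rule pairing_cong) (simp_all add: height_def assms)

text \<open>A pair of colors and its complement separate the colors alike. The three resulting
  patterns are the three nonzero linear forms in the two bits, and heights depend on nothing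
  else.\<close>

lemma color_pair_pattern:
  fixes q r :: nat
  assumes "q \<in> {1..4}" "r \<in> {1..4}" "q \<noteq> r"
  shows "\<exists>M\<in>{{1, 3}, {2, 3}, {1, 2}}. \<forall>i\<in>{1..4}. \<forall>j\<in>{1..4}.
    ((i \<in> {q, r}) = (j \<in> {q, r})) = ((i \<in> M) = (j \<in> M))"
proof -
  have "q = 1 \<or> q = 2 \<or> q = 3 \<or> q = 4" "r = 1 \<or> r = 2 \<or> r = 3 \<or> r = 4" using assms by auto
  then have "\<exists>M\<in>{{1, 3}, {2, 3}, {1, 2}}. {q, r} = M \<or> {q, r} = {1, 2, 3, 4} - M"
    using assms(3) by (elim disjE) (simp_all add: doubleton_eq_iff insert_Diff_if)
  then obtain M where "M \<in> {{1, 3}, {2, 3}, {1, 2}}" "{q, r} = M \<or> {q, r} = {1..4} - M"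
    unfolding four_colors by blast
  then show ?thesis by (intro bexI[of _ M]) auto
qed

text \<open>Changing the linear forms that serve as bits alters the pairing at most in sign. So the
  bits can be adapted to the two colors of a Kempe change.\<close>

lemma arrangement_degree:
  assumes f: "f \<in> complex_colorings K 4" and d: "distinct [p, q, r, t]" "{p, q, r, t} = {1..4}"
  shows "8 dvd degree_pairing (\<lambda>v. f v \<in> {q, r}) (\<lambda>v. f v \<in> {r, t}) \<longleftrightarrow> 8 dvd color_degree f"
proof -
  have ne: "q \<noteq> r" "r \<noteq> t" "q \<noteq> t" and mem: "q \<in> {1..4}" "r \<in> {1..4}" "t \<in> {1..4}"
    using d by auto
  obtain M where M0: "M \<in> {{1, 3}, {2, 3}, {1, 2}}" "\<forall>i\<in>{1..4}. \<forall>j\<in>{1..4}.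
      ((i \<in> {q, r}) = (j \<in> {q, r})) = ((i \<in> M) = (j \<in> M))"
    using color_pair_pattern[OF mem(1,2) ne(1)] by (elim bexE)
  note M = M0(1) M0(2)[rule_format]
  obtain N where N0: "N \<in> {{1, 3}, {2, 3}, {1, 2}}" "\<forall>i\<in>{1..4}. \<forall>j\<in>{1..4}.
      ((i \<in> {r, t}) = (j \<in> {r, t})) = ((i \<in> N) = (j \<in> N))"
    using color_pair_pattern[OF mem(2,3) ne(2)] by (elim bexE)
  note N = N0(1) N0(2)[rule_format]
  have "M \<noteq> N" using M(2)[OF mem(1,2)] N(2)[OF mem(1,2)] ne by auto
  let ?D = "\<lambda>M N. degree_pairing (\<lambda>v. f v \<in> M) (\<lambda>v. f v \<in> N)"
  have range: "f u \<in> {1..4}" "f v \<in> {1..4}" if "{u, v} \<in> E" for u v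
    using coloring_range[OF f] edge_vertices[OF that] by auto
  have eq: "?D {q, r} {r, t} = ?D M N"
    by (rule degree_pairing_cong; rule M(2)[OF range] N(2)[OF range]; assumption)
  let ?A = "\<lambda>v. f v \<in> {1, 3}" and ?B = "\<lambda>v. f v \<in> {2, 3}"
  have AB: "proper ?A ?B" by (rule proper_standard[OF f])
  have xor: "((f u \<in> {1, 2}) = (f v \<in> {1, 2})) = (xor_bit ?A ?B u = xor_bit ?A ?B v)"
    "((f u \<in> {1, 2}) = (f v \<in> {1, 2})) = (xor_bit ?B ?A u = xor_bit ?B ?A v)"
    if "{u, v} \<in> E" for u v
  proof -
    have "f u \<in> {1, 2, 3, 4}" "f v \<in> {1, 2, 3, 4}" using range[OF that] unfolding four_colors .
    then show "((f u \<in> {1, 2}) = (f v \<in> {1, 2})) = (xor_bit ?A ?B u = xor_bit ?A ?B v)"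
      "((f u \<in> {1, 2}) = (f v \<in> {1, 2})) = (xor_bit ?B ?A u = xor_bit ?B ?A v)"
      by (elim insertE emptyE; simp)+
  qed
  have AX: "proper ?A (xor_bit ?A ?B)" and BX: "proper ?B (xor_bit ?B ?A)"
    by (rule proper_xor[OF AB], rule proper_xor[OF proper_swap[OF AB]])
  have 1: "?D {2, 3} {1, 3} = - color_degree f" by (rule degree_pairing_swap[OF AB])
  have "?D {1, 3} {1, 2} = degree_pairing ?A (xor_bit ?A ?B)"
    "?D {1, 2} {1, 3} = degree_pairing (xor_bit ?A ?B) ?A"
    "?D {2, 3} {1, 2} = degree_pairing ?B (xor_bit ?B ?A)"
    "?D {1, 2} {2, 3} = degree_pairing (xor_bit ?B ?A) ?B"
    by (rule degree_pairing_cong; (rule refl | rule xor; assumption))+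
  then have "?D {1, 3} {1, 2} = - color_degree f" "?D {1, 2} {1, 3} = color_degree f"
    "?D {2, 3} {1, 2} = color_degree f" "?D {1, 2} {2, 3} = - color_degree f"
    unfolding degree_pairing_swap[OF AX] degree_pairing_swap[OF BX]
      degree_pairing_xor[OF AB] degree_pairing_xor[OF proper_swap[OF AB]] 1 by simp_all
  then have "?D M N = color_degree f \<or> ?D M N = - color_degree f"
    using M(1) N(1) \<open>M \<noteq> N\<close> 1 by (elim insertE emptyE) (simp_all only: simp_thms)
  then show ?thesis unfolding eq by auto
qed

text \<open>In bits adapted to the pair, swapping \<open>a\<close> and \<open>b\<close> flips the
  first bit on \<open>X\<close> and keeps the second, so \<open>flip_degree_pairing\<close>
  applies.\<close>

lemma swap_colors_degree:
  assumes f: "f \<in> complex_colorings K 4" and ab: "a \<in> {1..4}" "b \<in> {1..4}" "a \<noteq> b"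
    and X: "kempe_closed E f a b X" "X \<subseteq> V"
  shows "8 dvd color_degree (swap_colors a b X f) \<longleftrightarrow> 8 dvd color_degree f"
proof -
  let ?g = "swap_colors a b X f"
  have g: "?g \<in> complex_colorings K 4" by (rule swap_colors_coloring[OF f ab(1,2) X])
  have "card ({1..4} - {a, b}) = 2" using ab by (simp add: card_Diff_subset)
  then obtain r t where rt: "{1..4} - {a, b} = {r, t}" "r \<noteq> t" unfolding card_2_iff by blast
  have "r \<in> {1..4} - {a, b}" "t \<in> {1..4} - {a, b}" unfolding rt(1) by simp_all
  then have d1: "distinct [a, b, r, t]" using rt(2) ab(3) by simp
  have "{1..4} = {a, b} \<union> ({1..4} - {a, b})" using ab by blast
  then have d2: "{a, b, r, t} = {1..4}" unfolding rt(1) by blast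
  note d = d1 d2
  \<comment> \<open>The colors \<open>a\<close>, \<open>b\<close>, \<open>r\<close>,
    \<open>t\<close> become (0, 0), (1, 0), (1, 1), (0, 1).\<close>
  let ?A = "\<lambda>v. f v \<in> {b, r}" and ?B = "\<lambda>v. f v \<in> {r, t}"
  have "(u \<in> X) = (v \<in> X)" if e: "{u, v} \<in> E" "?B u = ?B v" for u v
  proof -
    have "f u \<in> {a, b, r, t}" "f v \<in> {a, b, r, t}"
      using coloring_range[OF f] edge_vertices[OF e(1)] d(2) by auto
    then consider "f u \<in> {a, b}" "f v \<in> {a, b}" | "f u \<notin> {a, b}" "f v \<notin> {a, b}"
      using e(2) d(1) by auto
    then show ?thesis using kempe_closedD[OF X(1)] e(1) by cases blast+
  qed
  then have "8 dvd degree_pairing (\<lambda>v. ?A v \<noteq> (v \<in> X)) ?B - degree_pairing ?A ?B"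
    by (intro flip_degree_pairing proper_bits[OF f d])
  moreover have "(?A v \<noteq> (v \<in> X)) = (?g v \<in> {b, r}) \<and> ?B v = (?g v \<in> {r, t})" for v
  proof (cases "v \<in> X")
    case True
    then have "f v = a \<or> f v = b" using kempe_closedD(1)[OF X(1)] by blast
    then show ?thesis using True d(1) by (auto simp: swap_colors_def)
  qed (simp add: swap_colors_def)
  then have "(\<lambda>v. ?A v \<noteq> (v \<in> X)) = (\<lambda>v. ?g v \<in> {b, r})" "?B = (\<lambda>v. ?g v \<in> {r, t})"
    unfolding fun_eq_iff by blast+
  ultimately have "8 dvd degree_pairing (\<lambda>v. ?g v \<in> {b, r}) (\<lambda>v. ?g v \<in> {r, t}) - degree_pairing ?A ?B"
    by simp
  then show ?thesis
    using arrangement_degree[OF f d] arrangement_degree[OF g d] by (metis dvd_diff_commute dvd_diff_right_iff dvd_minus_iff zdvd_zdiffD)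
qed

lemma kempe_change_degree:
  assumes f: "f \<in> complex_colorings K 4" and "kempe_change V E 4 f g"
  shows "g \<in> complex_colorings K 4" "8 dvd color_degree g \<longleftrightarrow> 8 dvd color_degree f"
proof -
  from assms(2) obtain a b v where abv: "a \<in> {1..4}" "b \<in> {1..4}" "v \<in> V" "a \<noteq> b" "f v \<in> {a, b}"
    and g: "g = swap_colors a b (kempe_component E f a b v) f"
    unfolding kempe_change_iff_swap_colors by blast
  have X: "kempe_closed E f a b (kempe_component E f a b v)" "kempe_component E f a b v \<subseteq> V"
    using kempe_component_closed(1)[of f v a b, OF abv(5)] kempe_component_subset[OF abv(3)] edge_vertices
    by blast+
  show "g \<in> complex_colorings K 4" "8 dvd color_degree g \<longleftrightarrow> 8 dvd color_degree f"
    unfolding g by (rule swap_colors_coloring[OF f abv(1,2) X], rule swap_colors_degree[OF f abv(1,2,4) X])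
qed

text \<open>Transpositions generate the permutations, and transposing two colors swaps them on the
  union of all their components.\<close>

lemma color_permutation_degree:
  assumes f: "f \<in> complex_colorings K 4" and "color_permutation V 4 f g"
  shows "8 dvd color_degree g \<longleftrightarrow> 8 dvd color_degree f"
proof -
  obtain \<pi> where \<pi>: "\<pi> permutes {1..4}" "g = restrict (\<pi> \<circ> f) V"
    using assms(2) by (auto simp: color_permutation_def)
  have "restrict (\<pi> \<circ> f) V \<in> complex_colorings K 4 \<and>
      (8 dvd color_degree (restrict (\<pi> \<circ> f) V) \<longleftrightarrow> 8 dvd color_degree f)"
    using \<pi>(1) finite_atLeastAtMost
  proof (induction \<pi> rule: permutes_induct)
    case id
    have "restrict (id \<circ> f) V = f"
      using f by (auto simp: colorings_def PiE_iff extensional_def fun_eq_iff)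
    then show ?case using f by simp
  next
    case (swap a b \<rho>)
    let ?h = "restrict (\<rho> \<circ> f) V"
    define X where "X = {v \<in> V. ?h v \<in> {a, b}}"
    have X: "kempe_closed E ?h a b X" "X \<subseteq> V"
      using edge_vertices unfolding kempe_closed_def X_def by blast+
    have eq: "restrict (Transposition.transpose a b \<circ> \<rho> \<circ> f) V = swap_colors a b X ?h"
      by (auto simp: fun_eq_iff swap_colors_def X_def)
    note IH = swap.IH[THEN conjunct1] swap.IH[THEN conjunct2]
    show ?case
      unfolding eq swap_colors_degree[OF IH(1) swap.hyps(1-3) X]
      by (rule conjI[OF swap_colors_coloring[OF IH(1) swap.hyps(1,2) X] IH(2)])
  qed
  then show ?thesis by (simp add: \<pi>(2))
qed

text \<open>Symmetry is carried through the induction because reversing a color permutation uses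
  that the intermediate function is a coloring.\<close>

lemma kempe_equivalent_degree:
  assumes f: "f \<in> complex_colorings K 4" and "kempe_equivalent V E 4 f g"
  shows "g \<in> complex_colorings K 4 \<and> (8 dvd color_degree g \<longleftrightarrow> 8 dvd color_degree f) \<and> kempe_equivalent V E 4 g f"
  using assms(2) unfolding kempe_equivalent_def
proof (induction rule: rtranclp_induct)
  case base
  then show ?case using f by simp
next
  case (step g h)
  let ?r = "\<lambda>f g. kempe_change V E 4 f g \<or> color_permutation V 4 f g"
  have g: "g \<in> complex_colorings K 4" using step by simp
  have "h \<in> complex_colorings K 4 \<and> (8 dvd color_degree h \<longleftrightarrow> 8 dvd color_degree g) \<and> ?r h g"
    using step(2)
  proof
    assume "kempe_change V E 4 g h"
    then show ?thesis using kempe_change_degree[OF g] kempe_change_sym by blast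
  next
    assume p: "color_permutation V 4 g h"
    have "h \<in> complex_colorings K 4"
      by (rule color_permutation_coloring[OF g p]) (use edge_vertices in blast)
    then show ?thesis using color_permutation_degree[OF g p] color_permutation_sym[OF g p] by blast
  qed
  then show ?case using step(3) by (metis (no_types, lifting) converse_rtranclp_into_rtranclp)
qed

section \<open>Folding\<close>

text \<open>The development into the triangular lattice does not fold at the nonsingular edges.\<close>

definition nonsingular :: "('v \<Rightarrow> nat) \<Rightarrow> 'v set set" where
  "nonsingular f = {e. \<exists>u v x y. e = {u, v} \<and> {u, v, x} \<in> triangles K \<and> {u, v, y} \<in> triangles K \<and> f x \<noteq> f y}"

definition minimal :: "('v \<Rightarrow> nat) \<Rightarrow> bool" where
  "minimal f \<longleftrightarrow> f \<in> complex_colorings K 4 \<and>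
     (\<forall>g. kempe_equivalent V E 4 f g \<longrightarrow> card (nonsingular f) \<le> card (nonsingular g))"

lemma finite_nonsingular: "finite (nonsingular f)"
proof (rule finite_subset)
  show "nonsingular f \<subseteq> Pow V"
    using triangle_all_edges edge_vertices unfolding nonsingular_def by blast
qed (simp add: vertices_finite)

text \<open>If a coordinate of the development is globally defined modulo \<open>M\<close>, the preimage of a lattice
  line splits into several parts, and folding along one of them is a sequence of Kempe changes.\<close>

lemma fold_line:
  assumes min: "minimal f" and ab: "a \<in> {1..4}" "b \<in> {1..4}" "a \<noteq> b"
    and B: "\<And>w z. {w, z} \<in> E \<Longrightarrow> B w = B z \<longleftrightarrow> (f w \<in> {a, b}) = (f z \<in> {a, b})"
    and A: "\<And>w z. f w \<in> {a, b} \<Longrightarrow> f z \<in> {a, b} \<Longrightarrow> A w = A z \<longleftrightarrow> f w = f z"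
    and M: "M \<ge> 3" and \<eta>: "\<And>w z. {w, z} \<in> E \<Longrightarrow> M dvd height B A w z - (\<eta> z - \<eta> w)"
    and x: "{u, v, x} \<in> triangles K" and y: "{u, v, y} \<in> triangles K"
    and uv: "f u \<notin> {a, b}" "f v \<notin> {a, b}"
    and xy: "f x \<in> {a, b}" "f y \<in> {a, b}"
  shows "f x = f y"
proof (rule ccontr)
  assume ne: "f x \<noteq> f y"
  have f: "f \<in> complex_colorings K 4" using min by (simp add: minimal_def)
  \<comment> \<open>The vertices colored \<open>a\<close> or \<open>b\<close> whose height is that
    of \<open>x\<close> modulo \<open>M\<close>; along edges between such vertices the height does
    not change.\<close>
  define X where "X = {w \<in> V. f w \<in> {a, b} \<and> M dvd \<eta> w - \<eta> x}"
  define g where "g = swap_colors a b X f"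
  have flat: "w \<in> X \<longleftrightarrow> z \<in> X" if e: "{w, z} \<in> E" and "f w \<in> {a, b}" "f z \<in> {a, b}" for w z
  proof -
    have "height B A w z = 0" using B[OF e] that by (simp add: height_def)
    then have "M dvd (\<eta> z - \<eta> x) - (\<eta> w - \<eta> x)" using \<eta>[OF e] by (simp add: dvd_diff_commute)
    then have "M dvd \<eta> z - \<eta> x \<longleftrightarrow> M dvd \<eta> w - \<eta> x" using dvd_diff_right_iff dvd_diff_left_iff by blast
    then show ?thesis using that edge_vertices[OF e] by (simp add: X_def)
  qed
  have "\<forall>w\<in>X. f w \<in> {a, b}" by (simp add: X_def)
  then have X: "kempe_closed E f a b X" "X \<subseteq> V"
    using flat unfolding kempe_closed_def by (blast, auto simp: X_def)
  \<comment> \<open>Apexes of equal color over an edge lie at the same height modulo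
    \<open>M\<close>, so the swap treats them alike and creates no nonsingular edge.\<close>
  have across: "(m \<in> X) = (n \<in> X)"
    if t: "{w, z, m} \<in> triangles K" "{w, z, n} \<in> triangles K" and "f m = f n" "f m \<in> {a, b}" for w z m n
  proof -
    note em = triangle_all_edges[OF t(1)] and en = triangle_all_edges[OF t(2)]
    consider "f w \<in> {a, b}" | "f z \<in> {a, b}" | "f w \<notin> {a, b}" "f z \<notin> {a, b}" by blast
    then show ?thesis
    proof cases
      case 1
      then show ?thesis using flat[OF em(3)] flat[OF en(3)] that by simp
    next
      case 2
      then show ?thesis using flat[OF em(2)] flat[OF en(2)] that by simp
    next
      case 3
      have "height B A w m = height B A w n"
        using A[of m n] B[OF em(3)] B[OF en(3)] that 3 step_sign_across[OF t] by (simp add: height_def)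
      then have "M dvd (\<eta> m - \<eta> x) - (\<eta> n - \<eta> x)"
        using dvd_diff[OF \<eta>[OF en(3)] \<eta>[OF em(3)]] by simp
      then have "M dvd \<eta> m - \<eta> x \<longleftrightarrow> M dvd \<eta> n - \<eta> x" using dvd_diff_right_iff dvd_diff_left_iff by blast
      then show ?thesis using that edge_vertices[OF em(3)] edge_vertices[OF en(3)] by (simp add: X_def)
    qed
  qed
  have sub: "nonsingular g \<subseteq> nonsingular f"
  proof
    fix e assume "e \<in> nonsingular g"
    then obtain w z m n where e: "e = {w, z}" and t: "{w, z, m} \<in> triangles K" "{w, z, n} \<in> triangles K"
      and "g m \<noteq> g n" unfolding nonsingular_def by blast
    have "f m \<noteq> f n"
    proof
      assume eq: "f m = f n"
      have "(m \<in> X) = (n \<in> X) \<or> m \<notin> X \<and> n \<notin> X"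
        using across[OF t eq] eq by (auto simp: X_def)
      then show False using \<open>g m \<noteq> g n\<close> eq by (auto simp: g_def swap_colors_def)
    qed
    then show "e \<in> nonsingular f" unfolding nonsingular_def using e t by blast
  qed
  have ex: "{u, x} \<in> E" and ey: "{u, y} \<in> E" using triangle_all_edges[OF x] triangle_all_edges[OF y] by auto
  have "height B A u y = - height B A u x" and one: "height B A u x = 1 \<or> height B A u x = -1"
    using A[OF xy] ne B[OF ex] B[OF ey] uv xy step_sign_across[OF x y] step_sign_cases[of u x]
    by (auto simp: height_def)
  \<comment> \<open>The points \<open>x\<close> and \<open>y\<close> lie on opposite sides of the
    line through \<open>u\<close> and \<open>v\<close>, with heights differing by 2. Since
    \<open>M\<close> does not divide 2, only \<open>x\<close> is recolored, and the edge becomes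
    singular.\<close>
  then have "M dvd 2 * height B A u x + (\<eta> y - \<eta> x)" using dvd_diff[OF \<eta>[OF ex] \<eta>[OF ey]] by simp
  moreover have "\<not> M dvd 2 * height B A u x" using one M zdvd_imp_le[of M 2] by auto
  ultimately have "\<not> M dvd \<eta> y - \<eta> x" using dvd_add_left_iff by blast
  then have yX: "y \<notin> X" by (simp add: X_def)
  have xX: "x \<in> X" using xy edge_vertices[OF ex] by (simp add: X_def)
  have "{u, v} \<in> nonsingular f" unfolding nonsingular_def using x y ne by blast
  moreover have "{u, v} \<notin> nonsingular g"
  proof
    assume "{u, v} \<in> nonsingular g"
    then obtain w z m n where e: "{u, v} = {w, z}" and t: "{w, z, m} \<in> triangles K" "{w, z, n} \<in> triangles K"
      and "g m \<noteq> g n" unfolding nonsingular_def by blast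
    have "{w, z, m} = {u, v, m}" "{w, z, n} = {u, v, n}" using e by blast+
    then have "{u, v, m} \<in> triangles K" "{u, v, n} \<in> triangles K" using t by simp_all
    then have "m = x \<or> m = y" "n = x \<or> n = y"
      using at_most_two_triangles[OF x y] ne by metis+
    moreover have "g x = g y" using xX yX xy ne by (auto simp: g_def swap_colors_def)
    ultimately show False using \<open>g m \<noteq> g n\<close> by metis
  qed
  ultimately have "nonsingular g \<subset> nonsingular f" using sub by blast
  then have "card (nonsingular g) < card (nonsingular f)" by (rule psubset_card_mono[OF finite_nonsingular])
  moreover have "kempe_equivalent V E 4 f g"
    unfolding g_def
    by (rule swap_colors_kempe_equivalent[OF _ X(2,1) ab]) (use X(2) vertices_finite finite_subset in blast)
  ultimately show False using min unfolding minimal_def by (meson linorder_not_less)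
qed

text \<open>The lattice lines of this direction are colored alternately by \<open>{p, q}\<close> and
  by \<open>{r, t}\<close>. An edge along a line of one kind has its apexes on lines of the other
  kind, whose two colors are then swapped.\<close>

lemma fold_direction:
  assumes min: "minimal f" and d: "distinct [p, q, r, t]" "{p, q, r, t} = {1..4}"
    and M: "M \<ge> 3"
    and \<eta>: "\<And>w z. {w, z} \<in> E \<Longrightarrow> M dvd height (\<lambda>v. f v \<in> {r, t}) (\<lambda>v. f v \<in> {q, r}) w z - (\<eta> z - \<eta> w)"
    and x: "{u, v, x} \<in> triangles K" and y: "{u, v, y} \<in> triangles K"
    and uv: "(f u \<in> {r, t}) = (f v \<in> {r, t})"
  shows "f x = f y"
proof -
  have f: "f \<in> complex_colorings K 4" using min by (simp add: minimal_def)
  have range: "f w = p \<or> f w = q \<or> f w = r \<or> f w = t" if "w \<in> V" for w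
    using coloring_range[OF f that] unfolding d(2)[symmetric] by simp
  have ne: "p \<noteq> q" "p \<noteq> r" "p \<noteq> t" "q \<noteq> r" "q \<noteq> t" "r \<noteq> t" using d(1) by auto
  have in4: "p \<in> {1..4}" "q \<in> {1..4}" "r \<in> {1..4}" "t \<in> {1..4}"
    unfolding d(2)[symmetric] by simp_all
  have verts: "u \<in> V" "v \<in> V" "x \<in> V" "y \<in> V"
    using triangle_all_edges[OF x] triangle_all_edges[OF y] edge_vertices by blast+
  note cx = coloring_triangle(4-6)[OF f x] and cy = coloring_triangle(4-6)[OF f y]
  have pat: "(f w \<in> {r, t}) = (f z \<in> {r, t}) \<longleftrightarrow> (f w \<in> {p, q}) = (f z \<in> {p, q})" if "{w, z} \<in> E" for w z
    using range edge_vertices[OF that] ne by (metis insert_iff empty_iff)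
  show ?thesis
  proof (cases "f u \<in> {r, t}")
    case True
    then have uv': "f u = r \<or> f u = t" "f v = r \<or> f v = t" using uv by simp_all
    then have "f u \<notin> {p, q}" "f v \<notin> {p, q}" using ne by (elim disjE; simp)+
    moreover have "f x \<in> {p, q}" using uv' cx range[OF verts(3)] by (elim disjE) simp_all
    moreover have "f y \<in> {p, q}" using uv' cy range[OF verts(4)] by (elim disjE) simp_all
    moreover have "(f w \<in> {q, r}) = (f z \<in> {q, r}) \<longleftrightarrow> f w = f z"
      if "f w \<in> {p, q}" "f z \<in> {p, q}" for w z
      using that ne by (elim insertE emptyE) simp_all
    ultimately show ?thesis
      using fold_line[OF min in4(1,2) ne(1) pat _ M \<eta> x y] by blast
  next
    case False
    then have out: "f u \<notin> {r, t}" "f v \<notin> {r, t}" using uv by simp_all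
    then have uv': "f u = p \<or> f u = q" "f v = p \<or> f v = q"
      using range[OF verts(1)] range[OF verts(2)] by simp_all
    have "f x \<in> {r, t}" using uv' cx range[OF verts(3)] by (elim disjE) simp_all
    moreover have "f y \<in> {r, t}" using uv' cy range[OF verts(4)] by (elim disjE) simp_all
    moreover have "(f w \<in> {q, r}) = (f z \<in> {q, r}) \<longleftrightarrow> f w = f z"
      if "f w \<in> {r, t}" "f z \<in> {r, t}" for w z
      using that ne by (elim insertE emptyE) simp_all
    ultimately show ?thesis
      using fold_line[OF min in4(3,4) ne(6) refl _ M \<eta> x y] out by blast
  qed
qed

text \<open>All edges along the lines are folded, so the development stays between two neighboring
  lines. The side \<open>\<kappa>\<close> persists across such an edge because the apexes agree, and
  across any other edge because \<open>B\<close> changes along the edge itself.\<close>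

lemma height_flat_direction:
  assumes AB: "proper A B"
    and flat: "\<And>u v x y. {u, v, x} \<in> triangles K \<Longrightarrow> {u, v, y} \<in> triangles K \<Longrightarrow> B u = B v \<Longrightarrow> A x = A y \<and> B x = B y"
  obtains \<kappa> :: int where "\<And>u v. {u, v} \<in> E \<Longrightarrow> height B A u v = \<kappa> * (of_bool (B v) - of_bool (B u))"
proof (cases "triangles K = {}")
  case True
  then show ?thesis using that[of 0] edges_empty by simp
next
  case False
  define ok where "ok k u v \<longleftrightarrow> height B A u v = k * (of_bool (B v) - of_bool (B u))" for k :: int and u v
  define Q where "Q k u v w \<longleftrightarrow> ok k u v \<and> ok k v w \<and> ok k u w" for k u v w
  have anti: "ok k v u \<longleftrightarrow> ok k u v" if "{u, v} \<in> E" for k u v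
    using cocycle_antisym[OF height_cocycle[OF proper_swap[OF AB]] that]
    unfolding ok_def by (auto simp: algebra_simps)
  have ex: "\<exists>k\<in>{1, -1}. Q k u v w" if t: "{u, v, w} \<in> triangles K" for u v w
    using proper_triangle[OF AB t] step_sign_cases[of u v]
    unfolding Q_def ok_def height_def step_sign_triangle[OF t]
    by (cases "A u"; cases "A v"; cases "A w"; cases "B u"; cases "B v"; cases "B w") auto
  obtain a b d where t0: "{a, b, d} \<in> triangles K" using False triangle_exists by (metis ex_in_conv)
  obtain k where k: "Q k a b d" using ex[OF t0] by blast
  have all: "Q k u v w" if t: "{u, v, w} \<in> triangles K" for u v w
  proof (rule triangle_induct[where A = "Q k", OF t0 k _ _ t])
    show "Q k v w u \<and> Q k v u w" if t: "{u, v, w} \<in> triangles K" "Q k u v w" for u v w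
      using t(2) anti triangle_all_edges[OF t(1)] unfolding Q_def by blast
    show "Q k u v y" if x: "{u, v, x} \<in> triangles K" and y: "{u, v, y} \<in> triangles K" and "Q k u v x" for u v x y
    proof (cases "B u = B v")
      case True
      have "A x = A y" "B x = B y" using flat[OF x y True] by auto
      moreover have "step_sign v x = step_sign v y" using step_sign_across[OF triangle_swap[OF x] triangle_swap[OF y]] .
      ultimately have "height B A u y = height B A u x" "height B A v y = height B A v x" "B y = B x"
        using step_sign_across[OF x y] by (simp_all add: height_def)
      then show ?thesis using \<open>Q k u v x\<close> by (simp add: Q_def ok_def)
    next
      case False
      obtain l where l: "Q l u v y" using ex[OF y] by blast
      then have "k = l" using \<open>Q k u v x\<close> False unfolding Q_def ok_def by auto
      then show ?thesis using l by simp
    qed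
  qed
  show ?thesis
  proof (rule that[of k])
    fix u v assume "{u, v} \<in> E"
    then obtain w where "{u, v, w} \<in> triangles K" using edge_in_two_triangles by blast
    then show "height B A u v = k * (of_bool (B v) - of_bool (B u))"
      using all unfolding Q_def ok_def by blast
  qed
qed

text \<open>Once one height is a true coboundary, \<open>height_sum_mod_3\<close> yields potentials
  modulo 3 for the other two directions. Every edge runs in one of the three directions, so all
  edges are folded.\<close>

lemma minimal_all_singular:
  assumes min: "minimal f" and d: "distinct [p, q, r, t]" "{p, q, r, t} = {1..4}"
    and \<eta>: "\<And>w z. {w, z} \<in> E \<Longrightarrow> 4 dvd height (\<lambda>v. f v \<in> {r, t}) (\<lambda>v. f v \<in> {q, r}) w z - (\<eta> z - \<eta> w)"
    and x: "{u, v, x} \<in> triangles K" and y: "{u, v, y} \<in> triangles K"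
  shows "f x = f y"
proof -
  have f: "f \<in> complex_colorings K 4" using min by (simp add: minimal_def)
  let ?A = "\<lambda>v. f v \<in> {q, r}" and ?B = "\<lambda>v. f v \<in> {r, t}"
  have AB: "proper ?A ?B" by (rule proper_bits[OF f d])
  have sB: "f x = f y" if "{u, v, x} \<in> triangles K" "{u, v, y} \<in> triangles K" "?B u = ?B v" for u v x y
    by (rule fold_direction[OF min d _ \<eta> that]) simp
  obtain \<kappa> where \<kappa>: "\<And>u v. {u, v} \<in> E \<Longrightarrow> height ?B ?A u v = \<kappa> * (of_bool (?B v) - of_bool (?B u))"
    by (rule height_flat_direction[OF AB]) (use sB in metis)+
  have sA: "f x = f y" if t: "{u, v, x} \<in> triangles K" "{u, v, y} \<in> triangles K" "?A u = ?A v" for u v x y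
  \<comment> \<open>The two heights add up to the difference of \<open>c\<close> modulo 3;
    subtracting the known one leaves this potential.\<close>
  proof (rule fold_direction[OF min, of p t r q 3 "\<lambda>v. int (c v) - \<kappa> * of_bool (?B v)"])
    show "distinct [p, t, r, q]" "{p, t, r, q} = {1..4}" using d by auto
    show "3 dvd height (\<lambda>v. f v \<in> {r, q}) (\<lambda>v. f v \<in> {t, r}) w z
        - (int (c z) - \<kappa> * of_bool (?B z) - (int (c w) - \<kappa> * of_bool (?B w)))" if e: "{w, z} \<in> E" for w z
    proof -
      have sets: "{r, q} = {q, r}" "{t, r} = {r, t}" by auto
      have eq: "height ?A ?B w z - (int (c z) - \<kappa> * of_bool (?B z) - (int (c w) - \<kappa> * of_bool (?B w)))
        = height ?A ?B w z + height ?B ?A w z - (int (c z) - int (c w))"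
        unfolding \<kappa>[OF e] by (simp add: algebra_simps)
      show ?thesis unfolding sets eq by (rule height_sum_mod_3[OF AB e])
    qed
    show "(f u \<in> {r, q}) = (f v \<in> {r, q})" using t(3) by (simp only: insert_commute)
    show "{u, v, x} \<in> triangles K" "{u, v, y} \<in> triangles K" by (rule t)+
  qed simp
  have ne: "p \<noteq> q" "p \<noteq> r" "p \<noteq> t" "q \<noteq> r" "q \<noteq> t" "r \<noteq> t" using d(1) by auto
  have range: "f w = p \<or> f w = q \<or> f w = r \<or> f w = t" if "w \<in> V" for w
    using coloring_range[OF f that] unfolding d(2)[symmetric] by simp
  have D: "(f w \<in> {q, t}) = xor_bit ?A ?B w" if "w \<in> V" for w
    using range[OF that] ne by (elim disjE) simp_all
  have sD: "f x = f y" if t: "{u, v, x} \<in> triangles K" "{u, v, y} \<in> triangles K" "(f u \<in> {q, t}) = (f v \<in> {q, t})" for u v x y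
  \<comment> \<open>The third coordinate is the known height minus the other one, so the potentials
    are subtracted likewise.\<close>
  proof (rule fold_direction[OF min, of p r q t 3 "\<lambda>v. 2 * \<kappa> * of_bool (?B v) - int (c v)"])
    show "distinct [p, r, q, t]" "{p, r, q, t} = {1..4}" using d by auto
    show "3 dvd height (\<lambda>v. f v \<in> {q, t}) (\<lambda>v. f v \<in> {r, q}) w z
        - (2 * \<kappa> * of_bool (?B z) - int (c z) - (2 * \<kappa> * of_bool (?B w) - int (c w)))" if e: "{w, z} \<in> E" for w z
    proof -
      have "height (\<lambda>v. f v \<in> {q, t}) (\<lambda>v. f v \<in> {r, q}) w z = height (xor_bit ?A ?B) ?A w z"
        using D edge_vertices[OF e] by (simp add: height_def disj_commute)
      also have "\<dots> = height ?B ?A w z - height ?A ?B w z" by (rule height_xor(1)[OF AB e])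
      finally have "height (\<lambda>v. f v \<in> {q, t}) (\<lambda>v. f v \<in> {r, q}) w z
          - (2 * \<kappa> * of_bool (?B z) - int (c z) - (2 * \<kappa> * of_bool (?B w) - int (c w)))
        = - (height ?A ?B w z + height ?B ?A w z - (int (c z) - int (c w)))"
        unfolding \<kappa>[OF e] by (simp add: algebra_simps)
      then show ?thesis using height_sum_mod_3[OF AB e] by (simp only: dvd_minus_iff)
    qed
    show "{u, v, x} \<in> triangles K" "{u, v, y} \<in> triangles K" "(f u \<in> {q, t}) = (f v \<in> {q, t})"
      by (rule t)+
  qed simp
  have "u \<in> V" "v \<in> V" using triangle_all_edges[OF x] edge_vertices by blast+
  then have "?A u = ?A v \<or> ?B u = ?B v \<or> (f u \<in> {q, t}) = (f v \<in> {q, t})"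
    using D by blast
  then show ?thesis using sA[OF x y] sB[OF x y] sD[OF x y] by blast
qed

lemma c_coloring: "c \<in> complex_colorings K 4"
  using coloring by (force simp: colorings_def PiE_iff)

text \<open>Both \<open>f\<close> and \<open>c\<close> extend uniquely across every edge, by
  repeating the color of the apex, so their correspondence on one triangle spreads to all.\<close>

lemma all_singular_imp_color_permutation:
  assumes f: "f \<in> complex_colorings K 4"
    and sing: "\<And>u v x y. {u, v, x} \<in> triangles K \<Longrightarrow> {u, v, y} \<in> triangles K \<Longrightarrow> f x = f y"
    and t0: "{a, b, d} \<in> triangles K"
  shows "color_permutation V 4 c f"
proof -
  define G where "G i = f (if c a = i then a else if c b = i then b else d)" for i
  have tri: "f u = G (c u) \<and> f v = G (c v) \<and> f w = G (c w)" if "{u, v, w} \<in> triangles K" for u v w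
  proof (rule triangle_induct[where A = "\<lambda>u v w. f u = G (c u) \<and> f v = G (c v) \<and> f w = G (c w)", OF t0 _ _ _ that])
    show "f a = G (c a) \<and> f b = G (c b) \<and> f d = G (c d)"
      using triangle_colors[OF t0] by (simp add: G_def)
  qed (use sing apex_color in metis)+
  have fG: "f v = G (c v)" if "v \<in> V" for v
    using vertex_in_edge[OF that] edge_in_two_triangles tri by metis
  note t0c = triangle_colors[OF t0]
  have cs: "{1, 2, 3} = {c a, c b, c d}"
    using t0c by (elim insertE emptyE) (simp_all add: insert_commute)
  have Gabd: "G (c a) = f a" "G (c b) = f b" "G (c d) = f d" using tri[OF t0] by simp_all
  note f0 = coloring_triangle[OF f t0]
  have G4: "G ` {1, 2, 3} \<subseteq> {1..4}"
    unfolding cs using f0(1-3) by (simp only: image_insert image_empty Gabd insert_subset empty_subsetI simp_thms)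
  have inj: "inj_on G {1, 2, 3}"
    unfolding cs using f0(4-6) t0c(4-6) by (auto simp: Gabd)
  have "card ({1..4} - G ` {1, 2, 3}) = 1"
    using card_Diff_subset[OF _ G4] card_image[OF inj] by simp
  \<comment> \<open>The one color that \<open>f\<close> omits becomes the image of 4, which
    completes \<open>G\<close> to a permutation.\<close>
  then obtain e where e: "{1..4} - G ` {1, 2, 3} = {e}" by (auto simp: card_1_singleton_iff)
  define \<pi> where "\<pi> i = (if i \<in> {1, 2, 3} then G i else if i = 4 then e else i)" for i
  have en: "e \<notin> G ` {1, 2, 3}" and e4: "e \<in> {1..4}" using e by blast+
  have im: "\<pi> ` {1, 2, 3} = G ` {1, 2, 3}" by (rule image_cong) (simp_all add: \<pi>_def)
  have pi4: "\<pi> 4 = e" by (simp add: \<pi>_def)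
  have ins: "{1..4} = insert 4 {1, 2, 3 :: nat}" by auto
  have maps: "\<pi> ` {1..4} \<subseteq> {1..4}"
    using G4 e4 im pi4 unfolding ins image_insert[of _ 4] by simp
  have "inj_on \<pi> {1, 2, 3}" using inj by (rule inj_on_cong[THEN iffD1, rotated]) (simp add: \<pi>_def)
  moreover have "{1, 2, 3} - {4} = {1, 2, 3 :: nat}" by auto
  ultimately have inj\<pi>: "inj_on \<pi> {1..4}"
    unfolding ins inj_on_insert using im pi4 en by simp
  have "bij_betw \<pi> {1..4} {1..4}"
    unfolding bij_betw_def using endo_inj_surj[OF finite_atLeastAtMost maps inj\<pi>] inj\<pi> by (rule conjI[rotated])
  then have "\<pi> permutes {1..4}"
    by (rule bij_imp_permutes) (auto simp: \<pi>_def)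
  moreover have "f = restrict (\<pi> \<circ> c) V"
    using f fG c_range by (auto simp: fun_eq_iff \<pi>_def colorings_def PiE_iff extensional_def)
  ultimately show ?thesis by (auto simp: color_permutation_def)
qed

text \<open>Each of the three classes that may vanish modulo 2 belongs to one lattice direction, and
  its potential lifts to a potential modulo 4 for the height in that direction.\<close>

lemma minimal_imp_color_permutation:
  assumes min: "minimal f" and deg: "8 dvd color_degree f"
  shows "color_permutation V 4 c f"
proof (cases "triangles K = {}")
  case True
  have "V = {}" using vertex_in_edge edge_in_two_triangles True by blast
  moreover have f: "f \<in> complex_colorings K 4" using min by (simp add: minimal_def)
  ultimately have "f = restrict (id \<circ> c) V" by (auto simp: fun_eq_iff colorings_def)
  then show ?thesis unfolding color_permutation_def using permutes_id by blast
next
  case False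
  then obtain a b d where t0: "{a, b, d} \<in> triangles K" using triangle_exists by (metis ex_in_conv)
  have f: "f \<in> complex_colorings K 4" using min by (simp add: minimal_def)
  let ?A = "\<lambda>v. f v \<in> {1, 3}" and ?B = "\<lambda>v. f v \<in> {2, 3}"
  have AB: "proper ?A ?B" by (rule proper_standard[OF f])
  have sets: "{4, 1, 3, 2} = {1..4 :: nat}" "{4, 2, 3, 1} = {1..4 :: nat}" "{4, 3, 1, 2} = {1..4 :: nat}"
    "{3, 2} = {2, 3 :: nat}" "{3, 1} = {1, 3 :: nat}" by auto
  obtain \<mu> \<nu> where \<mu>: "cocycle K \<mu>" and \<nu>: "cocycle K \<nu>" and pair: "color_degree f = 4 * pairing \<mu> \<nu>"
    and h: "\<And>u v. {u, v} \<in> E \<Longrightarrow> height ?A ?B u v = of_bool (?A v) - of_bool (?A u) + 2 * \<mu> u v"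
      "\<And>u v. {u, v} \<in> E \<Longrightarrow> height ?B ?A u v = of_bool (?B v) - of_bool (?B u) + 2 * \<nu> u v"
    by (rule half_heights[OF AB]) blast
  have "even (pairing \<mu> \<nu>)" using deg pair by presburger
  then consider "even_coboundary K \<nu>" | "even_coboundary K \<mu>" | "even_coboundary K (\<lambda>u v. \<mu> u v + \<nu> u v)"
    using even_pairing_imp_dependent[OF \<mu> \<nu>] by blast
  then have "f x = f y" if t: "{u, v, x} \<in> triangles K" "{u, v, y} \<in> triangles K" for u v x y
  proof cases
    case 1
    then obtain \<phi> :: "'v \<Rightarrow> int" where \<phi>: "\<And>u v. {u, v} \<in> E \<Longrightarrow> even (\<nu> u v - (\<phi> v - \<phi> u))"
      unfolding even_coboundary_def by blast
    show ?thesis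
    proof (rule minimal_all_singular[OF min _ sets(1) _ t])
      \<comment> \<open>The height is the coboundary of the bit plus \<open>2 * \<nu>\<close>, so a
        potential \<open>\<phi>\<close> of \<open>\<nu>\<close> modulo 2 enters with factor
        2.\<close>
      show "4 dvd height (\<lambda>v. f v \<in> {3, 2}) (\<lambda>v. f v \<in> {1, 3}) w z -
          (of_bool (?B z) + 2 * \<phi> z - (of_bool (?B w) + 2 * \<phi> w))" if "{w, z} \<in> E" for w z
        unfolding sets h(2)[OF that] using \<phi>[OF that] by presburger
    qed simp
  next
    case 2
    then obtain \<phi> :: "'v \<Rightarrow> int" where \<phi>: "\<And>u v. {u, v} \<in> E \<Longrightarrow> even (\<mu> u v - (\<phi> v - \<phi> u))"
      unfolding even_coboundary_def by blast
    show ?thesis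
    proof (rule minimal_all_singular[OF min _ sets(2) _ t])
      show "4 dvd height (\<lambda>v. f v \<in> {3, 1}) (\<lambda>v. f v \<in> {2, 3}) w z -
          (of_bool (?A z) + 2 * \<phi> z - (of_bool (?A w) + 2 * \<phi> w))" if "{w, z} \<in> E" for w z
        unfolding sets h(1)[OF that] using \<phi>[OF that] by presburger
    qed simp
  next
    case 3
    then obtain \<phi> :: "'v \<Rightarrow> int" where \<phi>: "\<And>u v. {u, v} \<in> E \<Longrightarrow> even (\<mu> u v + \<nu> u v - (\<phi> v - \<phi> u))"
      unfolding even_coboundary_def by blast
    show ?thesis
    proof (rule minimal_all_singular[OF min _ sets(3) _ t])
      \<comment> \<open>The third coordinate involves \<open>\<nu> - \<mu>\<close>, which agrees
        with \<open>\<mu> + \<nu>\<close> modulo 2.\<close>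
      show "4 dvd height (\<lambda>v. f v \<in> {1, 2}) (\<lambda>v. f v \<in> {3, 1}) w z -
          (of_bool (?B z) - of_bool (?A z) + 2 * \<phi> z - (of_bool (?B w) - of_bool (?A w) + 2 * \<phi> w))"
        if e: "{w, z} \<in> E" for w z
      proof -
        have "(f y \<in> {1, 2}) = xor_bit ?A ?B y" if "y \<in> V" for y
          using coloring_range[OF f that] by auto
        then have "height (\<lambda>v. f v \<in> {1, 2}) (\<lambda>v. f v \<in> {3, 1}) w z = height (xor_bit ?A ?B) ?A w z"
          unfolding sets using edge_vertices[OF e] by (simp only: height_def)
        also have "\<dots> = height ?B ?A w z - height ?A ?B w z" by (rule height_xor(1)[OF AB e])
        finally show ?thesis unfolding h(1)[OF e] h(2)[OF e] using \<phi>[OF e] by presburger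
      qed
    qed simp
  qed
  then show ?thesis by (rule all_singular_imp_color_permutation[OF f _ t0])
qed

lemma equivalent_to_three_coloring:
  assumes f: "f \<in> complex_colorings K 4" and deg: "8 dvd color_degree f"
  shows "kempe_equivalent V E 4 c f"
proof -
  obtain g where g: "kempe_equivalent V E 4 f g"
    "\<And>h. kempe_equivalent V E 4 f h \<Longrightarrow> card (nonsingular g) \<le> card (nonsingular h)"
    using ex_has_least_nat[of "kempe_equivalent V E 4 f" f "\<lambda>g. card (nonsingular g)"]
    by (auto simp: kempe_equivalent_def)
  note fg = kempe_equivalent_degree[OF f g(1)]
  have "minimal g"
    unfolding minimal_def
  proof (intro conjI allI impI)
    show "g \<in> complex_colorings K 4" using fg by blast
    fix h assume "kempe_equivalent V E 4 g h"
    then have "kempe_equivalent V E 4 f h"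
      using g(1) unfolding kempe_equivalent_def by (rule rtranclp_trans[rotated])
    then show "card (nonsingular g) \<le> card (nonsingular h)" by (rule g(2))
  qed
  then have "color_permutation V 4 c g"
    by (rule minimal_imp_color_permutation) (use fg deg in blast)
  then have "kempe_equivalent V E 4 c g" unfolding kempe_equivalent_def by blast
  moreover have "kempe_equivalent V E 4 g f" using fg by blast
  ultimately show ?thesis unfolding kempe_equivalent_def by (rule rtranclp_trans)
qed

section \<open>Counting Kempe classes\<close>

lemma color_degree_c: "color_degree c = 0"
  unfolding degree_pairing_def pairing_def
proof (rule sum.neutral, clarify)
  fix x y z assume "(x, y, z) \<in> chambers"
  \<comment> \<open>The back edge goes from color 2 to color 3, which share the second bit, so the
    second factor is zero.\<close>
  then show "sg x y z * (height (\<lambda>v. c v \<in> {1, 3}) (\<lambda>v. c v \<in> {2, 3}) x y *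
      height (\<lambda>v. c v \<in> {2, 3}) (\<lambda>v. c v \<in> {1, 3}) y z) = 0"
    by (simp add: chambers_def height_def)
qed

text \<open>Writing the pairing as 12k, the degree is 6k up to sign, and 8 divides 12k exactly when
  k is even.\<close>

lemma map_degree_6_iff:
  assumes "f \<in> complex_colorings K 4" "surface_orientation tetrahedron_boundary S"
  shows "[map_degree R S K f = 6] (mod 12) \<longleftrightarrow> \<not> 8 dvd color_degree f"
  using map_degree_color_degree[OF assms] degree_pairing_dvd[OF proper_standard[OF assms(1)]]
  unfolding cong_def by presburger

text \<open>The colorings with pairing divisible by 8 are exactly the class of \<open>c\<close>; any
  other coloring gives a second class. The set of classes is finite, so \<open>card\<close> really
  counts it.\<close>

lemma kempe_number_gt_1_iff:
  "complex_kempe_number K 4 > 1 \<longleftrightarrow> (\<exists>f\<in>complex_colorings K 4. \<not> 8 dvd color_degree f)"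
proof -
  define C where "C = complex_colorings K 4"
  define r where "r = {(f, g). f \<in> C \<and> g \<in> C \<and> kempe_equivalent V E 4 f g}"
  have num: "complex_kempe_number K 4 = card (C // r)" by (simp add: kempe_number_def C_def r_def)
  have "C \<subseteq> V \<rightarrow>\<^sub>E {1..4}" by (auto simp: C_def colorings_def)
  then have "finite C" by (rule finite_subset) (simp add: finite_PiE vertices_finite)
  then have fin: "finite (C // r)" unfolding quotient_def by simp
  have self: "f \<in> r `` {f}" if "f \<in> C" for f using that by (simp add: r_def kempe_equivalent_def)
  show ?thesis
    unfolding num
  proof
    assume gt: "card (C // r) > 1"
    show "\<exists>f\<in>complex_colorings K 4. \<not> 8 dvd color_degree f"
    proof (rule ccontr)
      assume "\<not> ?thesis"
      then have eq: "kempe_equivalent V E 4 c f" if "f \<in> C" for f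
        using that equivalent_to_three_coloring unfolding C_def by blast
      have "r `` {f} = C" if f: "f \<in> C" for f
      proof
        show "C \<subseteq> r `` {f}"
        proof
          fix g assume g: "g \<in> C"
          have "kempe_equivalent V E 4 f c" using kempe_equivalent_degree[OF c_coloring eq[OF f]] by blast
          then have "kempe_equivalent V E 4 f g"
            using eq[OF g] unfolding kempe_equivalent_def by (rule rtranclp_trans)
          then show "g \<in> r `` {f}" using f g by (simp add: r_def)
        qed
      qed (auto simp: r_def)
      then have "C // r \<subseteq> {C}" unfolding quotient_def by blast
      then have "card (C // r) \<le> card {C}" by (intro card_mono) auto
      then show False using gt by simp
    qed
  next
    assume "\<exists>f\<in>complex_colorings K 4. \<not> 8 dvd color_degree f"
    then obtain f where f: "f \<in> C" "\<not> 8 dvd color_degree f" by (auto simp: C_def)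
    have c: "c \<in> C" using c_coloring by (simp add: C_def)
    have "r `` {c} \<noteq> r `` {f}"
    proof
      assume "r `` {c} = r `` {f}"
      then have "kempe_equivalent V E 4 c f" using self[OF f(1)] by (auto simp: r_def)
      then show False using kempe_equivalent_degree[OF c_coloring] f(2) color_degree_c by (metis dvd_0_right)
    qed
    then have "card {r `` {c}, r `` {f}} = 2" by simp
    moreover have "card {r `` {c}, r `` {f}} \<le> card (C // r)"
      using f(1) c by (intro card_mono fin) (auto intro: quotientI)
    ultimately show "card (C // r) > 1" by simp
  qed
qed

end

theorem corollary3p5:
  fixes T :: "'v set set"
    and R :: "('v \<times> 'v \<times> 'v) set"
    and S :: "(nat \<times> nat \<times> nat) set"
  assumes "torus_triangulation T"
    and "complex_colorings T 3 \<noteq> {}"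
    and "surface_orientation T R"
    and "surface_orientation tetrahedron_boundary S"
  shows "complex_kempe_number T 4 > 1 \<longleftrightarrow>
    (\<exists>f \<in> complex_colorings T 4. [map_degree R S T f = 6] (mod 12))"
proof -
  have T: "abstract_complex T" "geometric_realization T homeomorphic torus"
    using assms(1) by (auto simp: torus_triangulation_def)
  obtain c where c: "c \<in> complex_colorings T 3" using assms(2) by blast
  obtain P :: "real \<times> real \<Rightarrow> 'v \<Rightarrow> real" where P: "torus_cover P (geometric_realization T)"
    using torus_parametrization[OF T(2)] unfolding torus_cover_def by metis
  \<comment> \<open>Any two vertices of a simplex span an edge, so the 3-coloring is injective on
    it.\<close>
  have dim: "card s \<le> 3" if s: "s \<in> T" for s
  proof -
    have range: "c ` s \<subseteq> {1..3}" using c s by (auto simp: colorings_def vertices_def PiE_iff)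
    have "inj_on c s"
    proof (rule inj_onI, rule ccontr)
      fix x y assume xy: "x \<in> s" "y \<in> s" "c x = c y" "x \<noteq> y"
      have "{x, y} \<subseteq> s" using xy by blast
      then have "{x, y} \<in> T" using T(1) s unfolding abstract_complex_def by blast
      then have "{x, y} \<in> edges T" using xy by (simp add: edges_def)
      then show False using c xy(3) unfolding colorings_def by blast
    qed
    then show ?thesis using card_inj_on_le[OF _ range] by simp
  qed
  interpret three_colored_torus P T R c
    by (intro three_colored_torus.intro triangulated_torus.intro P triangulated_torus_axioms.intro
        three_colored_torus_axioms.intro T(1) dim assms(3) c)
  show ?thesis using kempe_number_gt_1_iff map_degree_6_iff[OF _ assms(4)] by blast
qed

end
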